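(* Assume that: (1) $(A,B)$ is stabilizable; (2) for all $\lambda\in\sigma(S)$, $\operatorname{rank}\begin{pmatrix} A-\lambda I_n & B\\ C & 0\end{pmatrix}=n+p$; (3) all the eigenvalues of $S$ are on the unit circle; (4) $A$ has no eigenvalues with modulus greater than $1$. Let $(G_1,G_2)$ be the minimal $p$-copy internal model of $S$, with $G_1\in\mathbb{R}^{n_z\times n_z}$. Then there exist matrices $K_x\in\mathbb{R}^{m\times n}$ and $K_z\in\mathbb{R}^{m\times n_z}$ such that the cooperative robust output regulation problem is solved by the distributed dynamic state feedback control law $$u_i(t)=K_x\eta_i(t)+K_z\bar z_i(t-r_{com}),\qquad \bar z_i(t+1)=G_1\bar z_i(t)+G_2e_{vi}(t),\qquad i=1,\dots,N,$$ if and only if the digraph $\bar{\mathcal G}$ contains a directed spanning tree with the node $0$ as the root.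
   Context: **Plant.** $N$ followers, for $t\in\mathbb{Z}^+=\{0,1,\dots\}$: $$x_i(t+1)=\bar A_ix_i(t)+\bar B_iu_i(t-r_{con})+\bar E_iv(t),\quad y_i(t)=\bar C_ix_i(t),\quad i=1,\dots,N,$$ where $x_i(t)\in\mathbb{R}^n$, $u_i(t)\in\mathbb{R}^m$, $y_i(t)\in\mathbb{R}^p$, and $r_{con}\in\mathbb{Z}^+$ is the input delay. Here $\bar A_i=A+\delta_iA$, $\bar B_i=B+\delta_iB$, $\bar E_i=E+\delta_iE$, $\bar C_i=C+\delta_iC$, where $A,B,E,C$ are the nominal matrices and $\delta_iA,\delta_iB,\delta_iE,\delta_iC$ are the uncertain parts. The vector $w$ collects all entries of all the uncertain parts; the nominal system is the one with $w=0$. **Exosystem (leader).** $v(t+1)=Sv(t)$, with $v(t)\in\mathbb{R}^q$ and $S\in\mathbb{R}^{q\times q}$. The leader output is $y_0(t)=-Fv(t)$ with $F\in\mathbb{R}^{p\times q}$, and the regulated outputs are $e_i(t)=y_i(t)-y_0(t)$, $i=1,\dots,N$. **Graph.** $\bar{\mathcal G}=(\bar{\mathcal V},\bar{\mathcal E})$ is a digraph with node set $\bar{\mathcal V}=\{0,1,\dots,N\}$, where node $0$ is the leader and node $i$ is the $i$-th follower. It has weighted adjacency matrix $[a_{ij}]_{i,j=0}^N$ with $a_{ii}=0$, $a_{ij}>0\Leftrightarrow(j,i)\in\bar{\mathcal E}$, and $a_{ij}=a_{ji}$ if the edge $(i,j)$ is undirected (i.e. both $(i,j),(j,i)\in\bar{\mathcal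 E}$). The neighbor set of $i$ is $\bar{\mathcal N}_i=\{j:(j,i)\in\bar{\mathcal E}\}$. **Signals in the control law.** $r_{com}\in\mathbb{Z}^+$ is the communication delay, and $$e_{vi}(t)=\sum_{j\in\bar{\mathcal N}_i}a_{ij}(y_i(t)-y_j(t)),\qquad \eta_i(t)=\sum_{j\in\bar{\mathcal N}_i}a_{ij}\big(x_i(t-r_{com})-x_j(t-r_{com})\big),\quad x_0(t):=0.$$ Under the change of variable $z_i(t)=\bar z_i(t-r_{com})$, the law is $u_i(t)=K_x\eta_i(t)+K_zz_i(t)$, $z_i(t+1)=G_1z_i(t)+G_2e_{vi}(t-r_{com})$, so it uses only delayed neighbor information. **Internal model.** $(G_1,G_2)$ is a minimal $p$-copy internal model of $S$ if $G_1=I_p\otimes\beta$ and $G_2=I_p\otimes\sigma$, where $\beta$ is a constant square matrix whose characteristic polynomial equals the minimal polynomial of $S$, and $\sigma$ is a constant column vector such that $(\beta,\sigma)$ is controllable. **Problem.** A control law solves the (discrete-time linear) cooperative robust output regulation problem if the closed-loop system satisfies: (Property 1) the nominal closed-loop system ($w=0$) is exponentially stable when $v=0$; (Property 2) there is an open neighborhood $W$ of $w=0$ such that, for every $w\in W$ and all initial conditions of the plant, controller and exosystem, $\lim_{t\to\infty}e_i(t)=0$ for $i=1,\dots,N$. Initial conditions of the delayed closed-loop states are arbitrary functions on $\{-r,\dots,0\}$, with $r=r_{com}+r_{con}$. $\sigma(S)$ denotes the spectrum of $S$; $\otimes$ is the Kronecker product. *)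

theory Defs
  imports "HOL-Analysis.Analysis" "HOL-Computational_Algebra.Polynomial"
begin

section \<open>Matrices\<close>

definition complex_matrix :: "real^'n^'m \<Rightarrow> complex^'n^'m" where
  "complex_matrix M = (\<chi> i j. complex_of_real (M $ i $ j))"

definition spectrum :: "real^'n^'n \<Rightarrow> complex set" where
  "spectrum M = {l. \<exists>v. v \<noteq> 0 \<and> complex_matrix M *v v = l *s v}"

text \<open>The library's power operation on \<^typ>\<open>real^'n^'n\<close>, where available, is entrywise; this is the power
  with respect to the matrix product.\<close>

definition matrix_power :: "real^'n^'n \<Rightarrow> nat \<Rightarrow> real^'n^'n" where
  "matrix_power M k = (((**) M) ^^ k) (mat 1)"

definition matrix_poly :: "real poly \<Rightarrow> real^'n^'n \<Rightarrow> real^'n^'n" where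
  "matrix_poly f M = (\<Sum>k\<le>degree f. coeff f k *\<^sub>R matrix_power M k)"

definition char_polynomial :: "real^'n^'n \<Rightarrow> real poly" where
  "char_polynomial M = det (\<chi> i j. (if i = j then [:0, 1:] else 0) - [:M $ i $ j:])"

definition is_minimal_polynomial :: "real^'n^'n \<Rightarrow> real poly \<Rightarrow> bool" where
  "is_minimal_polynomial M f \<longleftrightarrow>
     lead_coeff f = 1 \<and> matrix_poly f M = 0 \<and>
     (\<forall>g. g \<noteq> 0 \<and> matrix_poly g M = 0 \<longrightarrow> degree f \<le> degree g)"

text \<open>The Kronecker product; the pair index \<open>(a, b)\<close> stands for block \<open>a\<close>, position \<open>b\<close> in the block.\<close>

definition kronecker :: "real^('b::finite)^('a::finite) \<Rightarrow> real^('d::finite)^('c::finite) \<Rightarrow> real^('b \<times> 'd)^('a \<times> 'c)" where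
  "kronecker M L = (\<chi> i j. M $ fst i $ fst j * L $ snd i $ snd j)"

definition block_matrix ::
  "'f^('n::finite)^('k::finite) \<Rightarrow> 'f^('m::finite)^'k \<Rightarrow> 'f^'n^('p::finite) \<Rightarrow> 'f^'m^'p \<Rightarrow> 'f^('n + 'm)^('k + 'p)" where
  "block_matrix M11 M12 M21 M22 = (\<chi> i j.
     case i of
       Inl a \<Rightarrow> (case j of Inl b \<Rightarrow> M11 $ a $ b | Inr b \<Rightarrow> M12 $ a $ b)
     | Inr a \<Rightarrow> (case j of Inl b \<Rightarrow> M21 $ a $ b | Inr b \<Rightarrow> M22 $ a $ b))"


section \<open>Linear systems in discrete time\<close>

definition stabilizable :: "real^'n^'n \<Rightarrow> real^'m^'n \<Rightarrow> bool" where
  "stabilizable A B \<longleftrightarrow> (\<exists>K :: real^'n^'m. \<forall>l \<in> spectrum (A + B ** K). cmod l < 1)"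

text \<open>The column rank of the controllability matrix \<open>[B, A B, \<dots>, A\<^sup>n\<^sup>-\<^sup>1 B]\<close> is \<open>n\<close>.\<close>

definition controllable :: "real^'n^'n \<Rightarrow> real^'m^'n \<Rightarrow> bool" where
  "controllable A B \<longleftrightarrow>
     dim (\<Union>k<CARD('n). columns (matrix_power A k ** B)) = CARD('n)"

text \<open>\<open>Sys\<close> is the set of trajectories of a system with memory \<open>r\<close>: a trajectory \<open>X\<close> is a
  function on the integers of which only the values at times \<open>\<ge> -r\<close> matter.\<close>

definition exponentially_stable :: "nat \<Rightarrow> ((int \<Rightarrow> 'x::real_normed_vector) \<Rightarrow> bool) \<Rightarrow> bool" where
  "exponentially_stable r Sys \<longleftrightarrow>
     (\<exists>M \<rho>. 0 < M \<and> 0 < \<rho> \<and> \<rho> < 1 \<and>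
       (\<forall>X. Sys X \<longrightarrow>
         (\<forall>t::nat. norm (X (int t)) \<le> M * \<rho> ^ t * Max ((\<lambda>s. norm (X s)) ` {- int r..0}))))"


section \<open>The internal model\<close>

definition is_min_internal_model_generator ::
  "real^'q^'q \<Rightarrow> real^'k^'k \<Rightarrow> real^'k \<Rightarrow> bool" where
  "is_min_internal_model_generator S \<beta> \<sigma> \<longleftrightarrow>
     is_minimal_polynomial S (char_polynomial \<beta>) \<and>
     controllable \<beta> (columnvector \<sigma> :: real^1^'k)"

definition internal_model_G1 :: "real^('k::finite)^'k \<Rightarrow> real^('p::finite \<times> 'k)^('p \<times> 'k)" where
  "internal_model_G1 \<beta> = kronecker (mat 1 :: real^'p^'p) \<beta>"

text \<open>The second component of the column index of the Kronecker product, of the one-element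
  type \<open>1\<close>, is dropped.\<close>

definition internal_model_G2 :: "real^('k::finite) \<Rightarrow> real^('p::finite)^('p \<times> 'k)" where
  "internal_model_G2 \<sigma> =
     (\<chi> i j. kronecker (mat 1 :: real^'p^'p) (columnvector \<sigma> :: real^1^'k) $ i $ (j, 1))"

definition is_min_p_copy_internal_model ::
  "real^'q^'q \<Rightarrow> real^('p::finite \<times> 'k::finite)^('p \<times> 'k) \<Rightarrow> real^'p^('p \<times> 'k) \<Rightarrow> bool" where
  "is_min_p_copy_internal_model S G1 G2 \<longleftrightarrow>
     (\<exists>\<beta> \<sigma>. is_min_internal_model_generator S \<beta> \<sigma> \<and>
            G1 = internal_model_G1 \<beta> \<and> G2 = internal_model_G2 \<sigma>)"


section \<open>The communication graph\<close>

text \<open>With \<open>N = CARD('N)\<close> followers the nodes are the elements of \<^typ>\<open>'N option\<close>: \<open>None\<close> is the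
  leader (node 0) and \<open>Some i\<close> is follower \<open>i\<close>. A pair \<open>(j, i)\<close> is an edge from \<open>j\<close> to \<open>i\<close>.\<close>

definition weighted_adjacency :: "('v \<times> 'v) set \<Rightarrow> ('v \<Rightarrow> 'v \<Rightarrow> real) \<Rightarrow> bool" where
  "weighted_adjacency Ed a \<longleftrightarrow>
     (\<forall>i. a i i = 0) \<and>
     (\<forall>i j. a i j > 0 \<longleftrightarrow> (j, i) \<in> Ed) \<and>
     (\<forall>i j. (i, j) \<in> Ed \<and> (j, i) \<in> Ed \<longrightarrow> a i j = a j i)"

definition neighbors :: "('v \<times> 'v) set \<Rightarrow> 'v \<Rightarrow> 'v set" where
  "neighbors Ed i = {j. (j, i) \<in> Ed}"

definition is_directed_tree :: "('v \<times> 'v) set \<Rightarrow> 'v \<Rightarrow> bool" where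
  "is_directed_tree T r \<longleftrightarrow>
     (\<forall>j. (j, r) \<notin> T) \<and> (\<forall>i. i \<noteq> r \<longrightarrow> (\<exists>!j. (j, i) \<in> T)) \<and> (\<forall>i. (r, i) \<in> T\<^sup>*)"

definition contains_directed_spanning_tree :: "('v \<times> 'v) set \<Rightarrow> 'v \<Rightarrow> bool" where
  "contains_directed_spanning_tree Ed r \<longleftrightarrow> (\<exists>T. T \<subseteq> Ed \<and> is_directed_tree T r)"


section \<open>Plant, control law and closed loop\<close>

text \<open>The matrices \<open>(A, B, E, C)\<close> of one follower. As the type is a topological vector space, the
  actual matrices of follower \<open>i\<close> are \<open>P + w $ i\<close>, with \<open>P\<close> nominal and \<open>w $ i\<close> the uncertain
  parts, and the uncertainty \<open>w\<close> of all followers together ranges over a finite-dimensional space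
  with its usual topology.\<close>

type_synonym ('n, 'm, 'p, 'q) plant =
  "(real^'n^'n) \<times> (real^'m^'n) \<times> (real^'q^'n) \<times> (real^'n^'p)"

fun plant_A :: "('n, 'm, 'p, 'q) plant \<Rightarrow> real^'n^'n" where "plant_A (A, B, E, C) = A"
fun plant_B :: "('n, 'm, 'p, 'q) plant \<Rightarrow> real^'m^'n" where "plant_B (A, B, E, C) = B"
fun plant_E :: "('n, 'm, 'p, 'q) plant \<Rightarrow> real^'q^'n" where "plant_E (A, B, E, C) = E"
fun plant_C :: "('n, 'm, 'p, 'q) plant \<Rightarrow> real^'n^'p" where "plant_C (A, B, E, C) = C"

text \<open>All signals are functions on the integers; \<open>x t $ i\<close> is the state of follower \<open>i\<close> at time \<open>t\<close>.
  In the outputs \<open>y\<close>, the node \<open>None\<close> is the leader. In what follows \<open>P i\<close> are the actual matrices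
  of follower \<open>i\<close>.\<close>

definition node_output ::
  "('N \<Rightarrow> ('n, 'm, 'p, 'q) plant) \<Rightarrow> real^'q^'p \<Rightarrow> (int \<Rightarrow> real^'q) \<Rightarrow> (int \<Rightarrow> (real^'n)^'N) \<Rightarrow>
   'N option \<Rightarrow> int \<Rightarrow> real^'p" where
  "node_output P F v x j t =
     (case j of None \<Rightarrow> - (F *v v t) | Some i \<Rightarrow> plant_C (P i) *v (x t $ i))"

definition regulated_output ::
  "('N \<Rightarrow> ('n, 'm, 'p, 'q) plant) \<Rightarrow> real^'q^'p \<Rightarrow> (int \<Rightarrow> real^'q) \<Rightarrow> (int \<Rightarrow> (real^'n)^'N) \<Rightarrow>
   'N \<Rightarrow> int \<Rightarrow> real^'p" where
  "regulated_output P F v x i t = node_output P F v x (Some i) t - node_output P F v x None t"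

definition virtual_error ::
  "('N option \<times> 'N option) set \<Rightarrow> ('N option \<Rightarrow> 'N option \<Rightarrow> real) \<Rightarrow>
   ('N \<Rightarrow> ('n, 'm, 'p, 'q) plant) \<Rightarrow> real^'q^'p \<Rightarrow> (int \<Rightarrow> real^'q) \<Rightarrow> (int \<Rightarrow> (real^'n)^'N) \<Rightarrow>
   'N \<Rightarrow> int \<Rightarrow> real^'p" where
  "virtual_error Ed a P F v x i t =
     (\<Sum>j\<in>neighbors Ed (Some i).
        a (Some i) j *\<^sub>R (node_output P F v x (Some i) t - node_output P F v x j t))"

definition node_state :: "(int \<Rightarrow> (real^'n)^'N) \<Rightarrow> 'N option \<Rightarrow> int \<Rightarrow> real^'n" where
  "node_state x j t = (case j of None \<Rightarrow> 0 | Some i \<Rightarrow> x t $ i)"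

definition relative_state ::
  "('N option \<times> 'N option) set \<Rightarrow> ('N option \<Rightarrow> 'N option \<Rightarrow> real) \<Rightarrow> nat \<Rightarrow>
   (int \<Rightarrow> (real^'n)^'N) \<Rightarrow> 'N \<Rightarrow> int \<Rightarrow> real^'n" where
  "relative_state Ed a rcom x i t =
     (\<Sum>j\<in>neighbors Ed (Some i).
        a (Some i) j *\<^sub>R (node_state x (Some i) (t - int rcom) - node_state x j (t - int rcom)))"

definition control_input ::
  "('N option \<times> 'N option) set \<Rightarrow> ('N option \<Rightarrow> 'N option \<Rightarrow> real) \<Rightarrow> nat \<Rightarrow>
   real^'n^'m \<Rightarrow> real^'z^'m \<Rightarrow>
   (int \<Rightarrow> (real^'n)^'N) \<Rightarrow> (int \<Rightarrow> (real^'z)^'N) \<Rightarrow> 'N \<Rightarrow> int \<Rightarrow> real^'m" where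
  "control_input Ed a rcom Kx Kz x zb i t =
     Kx *v relative_state Ed a rcom x i t + Kz *v (zb (t - int rcom) $ i)"

text \<open>\<open>(v, x, zb)\<close> is a trajectory of the exosystem, the followers and the controllers. The equations
  are imposed at times \<open>t \<ge> 0\<close> and involve the states at times \<open>\<ge> -(rcom + rcon)\<close> only, so the
  values of \<open>x\<close> and \<open>zb\<close> on \<open>{-(rcom + rcon)..0}\<close> are free initial data.\<close>

definition closed_loop ::
  "('N option \<times> 'N option) set \<Rightarrow> ('N option \<Rightarrow> 'N option \<Rightarrow> real) \<Rightarrow> nat \<Rightarrow> nat \<Rightarrow>
   real^'q^'q \<Rightarrow> real^'q^'p \<Rightarrow> ('N \<Rightarrow> ('n, 'm, 'p, 'q) plant) \<Rightarrow>
   real^'z^'z \<Rightarrow> real^'p^'z \<Rightarrow> real^'n^'m \<Rightarrow> real^'z^'m \<Rightarrow>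
   (int \<Rightarrow> real^'q) \<Rightarrow> (int \<Rightarrow> (real^'n)^'N) \<Rightarrow> (int \<Rightarrow> (real^'z)^'N) \<Rightarrow> bool" where
  "closed_loop Ed a rcom rcon S F P G1 G2 Kx Kz v x zb \<longleftrightarrow>
     (\<forall>t\<ge>0. v (t + 1) = S *v v t \<and>
       (\<forall>i. x (t + 1) $ i =
              plant_A (P i) *v (x t $ i)
              + plant_B (P i) *v control_input Ed a rcom Kx Kz x zb i (t - int rcon)
              + plant_E (P i) *v v t \<and>
            zb (t + 1) $ i = G1 *v (zb t $ i) + G2 *v virtual_error Ed a P F v x i t))"

definition solves_cooperative_robust_output_regulation ::
  "('N::finite option \<times> 'N option) set \<Rightarrow> ('N option \<Rightarrow> 'N option \<Rightarrow> real) \<Rightarrow> nat \<Rightarrow> nat \<Rightarrow>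
   real^'q^'q \<Rightarrow> real^'q^'p \<Rightarrow> ('n, 'm, 'p, 'q) plant \<Rightarrow>
   real^'z^'z \<Rightarrow> real^'p^'z \<Rightarrow> real^'n^'m \<Rightarrow> real^'z^'m \<Rightarrow> bool" where
  "solves_cooperative_robust_output_regulation Ed a rcom rcon S F P G1 G2 Kx Kz \<longleftrightarrow>
     exponentially_stable (rcom + rcon)
       (\<lambda>X :: int \<Rightarrow> ((real^'n)^'N) \<times> ((real^'z)^'N).
          closed_loop Ed a rcom rcon S F (\<lambda>i. P) G1 G2 Kx Kz
            (\<lambda>t. 0) (\<lambda>t. fst (X t)) (\<lambda>t. snd (X t))) \<and>
     (\<exists>W :: (('n, 'm, 'p, 'q) plant ^ 'N) set. open W \<and> 0 \<in> W \<and>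
       (\<forall>w\<in>W. \<forall>v x zb.
          closed_loop Ed a rcom rcon S F (\<lambda>i. P + w $ i) G1 G2 Kx Kz v x zb \<longrightarrow>
          (\<forall>i. (\<lambda>t::nat. regulated_output (\<lambda>i. P + w $ i) F v x i (int t)) \<longlonglongrightarrow> 0)))"

end

theory Submission
  imports Defs "HOL-Computational_Algebra.Fundamental_Theorem_Algebra"
begin

text \<open>Write \<open>H\<close> for the Laplacian of the graph with the row and column of the leader deleted, \<open>r = rcom + rcon\<close> for
the total delay, and \<open>k\<close> for the size of \<open>\<beta>\<close>.

Necessity. Followers that the leader cannot reach listen only to each other. Started in one common
state they keep a common state, their relative measurements vanish, and their controllers run as free
copies of \<open>G1\<close>. Its eigenvalues lie in the spectrum of \<open>S\<close>, hence on the unit circle, so some of these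
runs do not decay (\<open>stable_loop_imp_reachable\<close>).

Sufficiency splits into stability of the nominal loop and regulation by a stable loop.

Regulation. Let \<open>f\<close> be the minimal polynomial of \<open>S\<close>, which is the characteristic polynomial of \<open>\<beta>\<close>.
Applied to a trajectory as a polynomial in the time shift it removes the exosystem signal and leaves a
trajectory of the unforced loop, which tends to zero; this survives small changes of the plants
(\<open>exponentially_stable_perturbation\<close>). One copy of the internal model obeys \<open>z(t+1) = \<beta> z(t) + e(t) \<sigma>\<close>.
Since \<open>f(\<beta>) = 0\<close>, the shifted combination of \<open>z\<close> involves only \<open>e(t), \<dots>, e(t+k-1)\<close>, and controllability
provides a functional that reads off \<open>e(t)\<close> alone (\<open>internal_model_regulates\<close>). So the virtual errors
tend to zero, and with them the regulated errors, because \<open>H\<close> is injective.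

Stability. In the coordinates \<open>\<zeta> = H\<^sup>-\<^sup>1 zb\<close> the states \<open>\<xi>\<^sub>i = (x\<^sub>i, \<zeta>\<^sub>i)\<close> obey
\<open>\<xi>\<^sub>i(t+1) = A' \<xi>\<^sub>i(t) + B' \<Sum>\<^sub>j H\<^sub>i\<^sub>j K \<xi>\<^sub>j(t-r)\<close>, where \<open>(A', B')\<close> is the plant followed by the internal model.
The rank condition makes this pair stabilizable, and the eigenvalues of \<open>A'\<close> lie in the closed unit disc
(\<open>plant_with_internal_model\<close>). Such a pair can be stabilized with as little control energy as one
likes: the eigenvalues on the circle are moved inside one after the other, each by a weak feedback
(\<open>low_energy_stabilization\<close>). The cost of that feedback yields an arbitrarily small positive definite
matrix \<open>P\<close> with \<open>A'\<^sup>T P A' \<le> P - \<epsilon> I + A'\<^sup>T P B' B'\<^sup>T P A'\<close> (\<open>low_weight_lyapunov_matrix\<close>). Take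
\<open>K = - \<mu> B'\<^sup>T P A'\<^sup>r\<^sup>+\<^sup>1\<close>, where \<open>A'\<^sup>r\<close> predicts the state across the delay. The prediction error
is of higher order in \<open>P\<close>, so for small \<open>P\<close> it does no harm (\<open>low_gain_network_stabilization\<close>). What
couples the followers is harmless for large \<open>\<mu>\<close>: a spanning tree makes \<open>H\<close> inverse positive, so there are
weights \<open>d > 0\<close> with \<open>d\<^sup>T H = (1, \<dots>, 1)\<close>, and with these weights \<open>H\<close> has a positive definite symmetric
part (\<open>laplacian_weighted_coercive\<close>).\<close>

section \<open>Polynomials of a matrix and the Cayley-Hamilton theorem\<close>

text \<open>The vector \<open>p(M) v\<close>. Iterating the product on vectors keeps clear of the entrywise power on matrices.\<close>

definition poly_act :: "'a::comm_ring_1 poly \<Rightarrow> 'a^'n^'n \<Rightarrow> 'a^'n \<Rightarrow> 'a^'n" where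
  "poly_act p M v = (\<Sum>i\<le>degree p. coeff p i *s (((*v) M ^^ i) v))"

definition charpoly :: "'a::comm_ring_1^'n^'n \<Rightarrow> 'a poly" where
  "charpoly M = det (\<chi> i j. (if i = j then [:0, 1:] else 0) - [:M $ i $ j:])"

lemma poly_act_bound:
  assumes "degree p \<le> S"
  shows "poly_act p M v = (\<Sum>i\<le>S. coeff p i *s (((*v) M ^^ i) v))"
  unfolding poly_act_def using assms
  by (intro sum.mono_neutral_left) (auto simp: coeff_eq_0)

lemma matrix_vector_mult_smult:
  fixes M :: "'a::comm_semiring_1^'n^'m"
  shows "M *v (c *s v) = c *s (M *v v)"
  by (vector matrix_vector_mult_def sum_distrib_left mult_ac)

lemma matrix_vector_mult_sum:
  fixes M :: "'a::comm_semiring_1^'n^'m"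
  shows "M *v (\<Sum>i\<in>I. g i) = (\<Sum>i\<in>I. M *v g i)"
  by (induction I rule: infinite_finite_induct) (auto simp: matrix_vector_right_distrib)

lemma mat_vector_mult: "mat c *v v = c *s (v :: 'a::semiring_1^'n)"
  by (simp add: vec_eq_iff matrix_vector_mult_def mat_def if_distrib[of "\<lambda>c. c * _"] cong: if_cong)

lemma iterate_mult_linear:
  fixes M :: "'a::comm_semiring_1^'n^'n"
  shows "((*v) M ^^ i) (u + v) = ((*v) M ^^ i) u + ((*v) M ^^ i) v"
    and "((*v) M ^^ i) (c *s v) = c *s ((*v) M ^^ i) v"
    and "((*v) M ^^ i) 0 = 0"
  by (induction i) (auto simp: matrix_vector_right_distrib matrix_vector_mult_smult)

lemma iterate_mult_diff:
  fixes M :: "'a::comm_ring_1^'n^'n"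
  shows "((*v) M ^^ i) (u - v) = ((*v) M ^^ i) u - ((*v) M ^^ i) v"
  by (induction i) (auto simp: matrix_vector_mult_diff_distrib)

text \<open>Lets a polynomial that annihilates a vector be applied one linear factor \<open>M - l\<close> at a time.\<close>

lemma poly_act_linear_factor:
  fixes M :: "'a::comm_ring_1^'n^'n"
  shows "poly_act ([:-l, 1:] * q) M v = M *v poly_act q M v - l *s poly_act q M v"
proof -
  let ?S = "degree q + 1"
  let ?p = "[:-l, 1:] * q"
  have deg: "degree ?p \<le> ?S"
    using degree_mult_le[of "[:-l, 1:]" q] by (auto simp: le_trans split: if_splits)
  have cp: "coeff ?p i = (case i of 0 \<Rightarrow> 0 | Suc j \<Rightarrow> coeff q j) - l * coeff q i" for i
    by (simp add: coeff_pCons algebra_simps split: nat.splits)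
  have "poly_act ?p M v = (\<Sum>i\<le>?S. coeff ?p i *s (((*v) M ^^ i) v))"
    by (rule poly_act_bound[OF deg])
  also have "\<dots> = (\<Sum>i\<le>Suc (degree q). (case i of 0 \<Rightarrow> 0 | Suc j \<Rightarrow> coeff q j) *s (((*v) M ^^ i) v))
      - (\<Sum>i\<le>?S. (l * coeff q i) *s (((*v) M ^^ i) v))"
    unfolding cp vector_sub_rdistrib sum_subtractf by simp
  also have "(\<Sum>i\<le>Suc (degree q). (case i of 0 \<Rightarrow> 0 | Suc j \<Rightarrow> coeff q j) *s (((*v) M ^^ i) v))
      = M *v poly_act q M v"
    unfolding sum.atMost_Suc_shift
    by (simp add: poly_act_def matrix_vector_mult_sum matrix_vector_mult_smult)
  also have "(\<Sum>i\<le>?S. (l * coeff q i) *s (((*v) M ^^ i) v)) = l *s poly_act q M v"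
    by (subst poly_act_bound[of q ?S]) (simp_all add: vec.scale_sum_right vector_smult_assoc sum_cmul vec_eq_iff sum_distrib_left mult.assoc)
  finally show ?thesis .
qed

text \<open>Cofactor expansion along row \<open>k\<close>. Writing a cofactor as the determinant with a unit vector in place of
the row keeps everything valid over commutative rings, in particular for the polynomial matrix \<open>z I - M\<close>.\<close>

lemma det_row_as_sum:
  fixes M :: "'a::comm_ring_1^'n^'n"
  shows "(\<Sum>j\<in>UNIV. c $ j * det (\<chi> r. if r = k then axis j 1 else M $ r))
    = det (\<chi> r. if r = k then c else M $ r)"
proof -
  have c: "c = (\<Sum>j\<in>UNIV. c $ j *s axis j 1)"
    by (simp add: basis_expansion)
  have "det (\<chi> r. if r = k then c else M $ r)
      = det (\<chi> r. if r = k then (\<Sum>j\<in>UNIV. c $ j *s axis j 1) else M $ r)"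
    by (simp only: c[symmetric])
  also have "\<dots> = (\<Sum>j\<in>UNIV. c $ j * det (\<chi> r. if r = k then axis j 1 else M $ r))"
    by (subst det_linear_row_sum) (simp_all add: det_row_mul)
  finally show ?thesis by simp
qed

lemma mult_adjugate:
  fixes M :: "'a::comm_ring_1^'n^'n"
  shows "(\<Sum>j\<in>UNIV. M $ i $ j * det (\<chi> r. if r = k then axis j 1 else M $ r))
    = (if i = k then det M else 0)"
proof (cases "i = k")
  case True
  then have "(\<chi> r. if r = k then M $ i else M $ r) = M" by (vector)
  then show ?thesis using True det_row_as_sum[of "M $ i" k M] by simp
next
  case False
  have "det (\<chi> r. if r = k then M $ i else M $ r) = 0"
    by (rule det_identical_rows[of i k]) (use False in \<open>auto simp: row_def vec_eq_iff\<close>)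
  then show ?thesis using False det_row_as_sum[of "M $ i" k M] by simp
qed

text \<open>If \<open>C\<^sub>s\<close> is the coefficient of \<open>z\<^sup>s\<close> in the adjugate of \<open>z I - M\<close>, then comparing coefficients in
\<open>(z I - M) adj(z I - M) = f(z) I\<close> gives \<open>C\<^sub>s\<^sub>-\<^sub>1 - M C\<^sub>s = f\<^sub>s I\<close>, and \<open>\<Sum>\<^sub>s M\<^sup>s f\<^sub>s\<close> telescopes.\<close>

theorem cayley_hamilton:
  fixes M :: "'a::comm_ring_1^'n^'n"
  shows "poly_act (charpoly M) M v = 0"
proof -
  define Z :: "'a poly^'n^'n" where "Z = (\<chi> i j. (if i = j then [:0, 1:] else 0) - [:M $ i $ j:])"
  define f where "f = charpoly M"
  have f: "f = det Z" by (simp add: f_def charpoly_def Z_def)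
  define D where "D k j = det (\<chi> r. if r = k then axis j 1 else Z $ r)" for k j
  define C :: "nat \<Rightarrow> 'a^'n^'n" where "C s = (\<chi> j k. coeff (D k j) s)" for s
  define C' :: "nat \<Rightarrow> 'a^'n^'n" where "C' s = (case s of 0 \<Rightarrow> 0 | Suc t \<Rightarrow> C t)" for s
  have adj: "(\<Sum>j\<in>UNIV. Z $ i $ j * D k j) = (if i = k then f else 0)" for i k
    unfolding D_def f by (rule mult_adjugate)
  have "pCons 0 (D k i) - (\<Sum>j\<in>UNIV. smult (M $ i $ j) (D k j)) = (if i = k then f else 0)" for i k
  proof -
    have "(\<Sum>j\<in>UNIV. Z $ i $ j * D k j)
        = (\<Sum>j\<in>UNIV. (if i = j then [:0, 1:] else 0) * D k j) - (\<Sum>j\<in>UNIV. [:M $ i $ j:] * D k j)"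
      unfolding Z_def by (simp add: left_diff_distrib sum_subtractf)
    also have "(\<Sum>j\<in>UNIV. (if i = j then [:0, 1:] else 0) * D k j) = pCons 0 (D k i)"
      by (subst sum.remove[of _ i]) auto
    finally show ?thesis using adj[of i k] by simp
  qed
  then have cf: "coeff (pCons 0 (D k i)) s - (\<Sum>j\<in>UNIV. M $ i $ j * coeff (D k j) s)
      = (if i = k then coeff f s else 0)" for i k s
    by (metis (no_types, lifting) coeff_0 coeff_diff coeff_smult coeff_sum sum.cong)
  have "C' s $ i $ k - (M ** C s) $ i $ k = (if i = k then coeff f s else 0)" for i k s
    using cf[of k i s] by (simp add: C'_def C_def matrix_matrix_mult_def coeff_pCons split: nat.splits if_splits)
  then have "C' s - M ** C s = mat (coeff f s)" for s
    by (simp add: vec_eq_iff mat_def)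
  then have rec: "coeff f s *s v = C' s *v v - M *v (C s *v v)" for s
    by (simp add: matrix_vector_mul_assoc mat_vector_mult flip: matrix_vector_mult_diff_rdistrib)
  define S where "S = Max (insert (degree f) (range (\<lambda>(k, j). degree (D k j)))) + 1"
  have fin: "finite (insert (degree f) (range (\<lambda>(k, j). degree (D k j))))" by simp
  have degf: "degree f \<le> S"
    unfolding S_def using Max_ge[OF fin, of "degree f"] by simp
  have "degree (D k j) < S" for k j
    unfolding S_def using Max_ge[OF fin, of "degree (D k j)"] by (force simp: less_Suc_eq_le)
  then have CS: "C S = 0"
    by (simp add: C_def vec_eq_iff coeff_eq_0)
  let ?it = "\<lambda>s. ((*v) M ^^ s)"
  have tele: "(\<Sum>i\<le>s. coeff f i *s ?it i v) = - ?it (Suc s) (C s *v v)" for s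
  proof (induction s)
    case 0
    show ?case using rec[of 0] by (simp add: C'_def)
  next
    case (Suc s)
    have "coeff f (Suc s) *s ?it (Suc s) v = ?it (Suc s) (coeff f (Suc s) *s v)"
      by (simp only: iterate_mult_linear)
    also have "\<dots> = ?it (Suc s) (C s *v v) - ?it (Suc s) (M *v (C (Suc s) *v v))"
      unfolding rec iterate_mult_diff by (simp add: C'_def)
    also have "?it (Suc s) (M *v (C (Suc s) *v v)) = ?it (Suc (Suc s)) (C (Suc s) *v v)"
      by (simp only: funpow_Suc_right o_apply)
    finally show ?case using Suc by simp
  qed
  have "poly_act f M v = (\<Sum>i\<le>S. coeff f i *s ?it i v)"
    by (rule poly_act_bound[OF degf])
  also have "\<dots> = 0" unfolding tele by (simp only: CS matrix_vector_mult_0 iterate_mult_linear) simp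
  finally show ?thesis by (simp add: f_def)
qed

text \<open>In the expansion of the determinant only the identity permutation picks \<open>n\<close> entries of degree one.\<close>

lemma charpoly_monic:
  fixes M :: "'a::idom^'n^'n"
  shows "degree (charpoly M) = CARD('n)" "lead_coeff (charpoly M) = 1"
proof -
  let ?e = "\<lambda>i j. (if i = j then [:0, 1:] else 0) - [:M $ i $ j:]"
  let ?P = "{p. p permutes (UNIV :: 'n set)}"
  define R where "R = (\<Sum>p\<in>?P - {id}. of_int (sign p) * (\<Prod>i\<in>UNIV. ?e i (p i)))"
  define T where "T = (\<Prod>i\<in>UNIV. ?e i i)"
  have T: "T = (\<Prod>i\<in>UNIV. [:- (M $ i $ i), 1:])"
    unfolding T_def by (intro prod.cong) auto
  have dT: "degree T = CARD('n)"
    unfolding T by (subst degree_prod_eq_sum_degree) auto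
  have lT: "lead_coeff T = 1"
    unfolding T by (simp add: lead_coeff_prod)
  have "charpoly M = T + R"
  proof -
    have "charpoly M = (\<Sum>p\<in>?P. of_int (sign p) * (\<Prod>i\<in>UNIV. ?e i (p i)))"
      unfolding charpoly_def det_def by simp
    also have "\<dots> = of_int (sign (id :: 'n \<Rightarrow> 'n)) * (\<Prod>i\<in>UNIV. ?e i (id i)) + R"
      unfolding R_def by (rule sum.remove) (auto simp: finite_permutations permutes_id)
    finally show ?thesis by (simp add: T_def)
  qed
  moreover have "degree R < CARD('n)"
    unfolding R_def
  proof (rule degree_sum_less)
    fix p assume p: "p \<in> ?P - {id}"
    then obtain i where i: "p i \<noteq> i" by (auto simp: fun_eq_iff)
    have "degree (of_int (sign p) * (\<Prod>i\<in>UNIV. ?e i (p i)) :: 'a poly) \<le> degree (\<Prod>i\<in>UNIV. ?e i (p i))"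
      by (rule order.trans[OF degree_mult_le]) simp
    also have "\<dots> \<le> (\<Sum>i\<in>UNIV. degree (?e i (p i)))"
      by (rule order.trans[OF degree_prod_sum_le]) (auto simp: o_def)
    also have "\<dots> < (\<Sum>i\<in>(UNIV :: 'n set). 1)"
      by (rule sum_strict_mono_ex1) (use i in \<open>auto intro!: exI[of _ i]\<close>)
    finally show "degree (of_int (sign p) * (\<Prod>i\<in>UNIV. ?e i (p i)) :: 'a poly) < CARD('n)" by simp
  qed simp
  ultimately show "degree (charpoly M) = CARD('n)" "lead_coeff (charpoly M) = 1"
    using dT lT degree_add_eq_left[of R T] lead_coeff_add_le[of R T]
    by (simp_all add: coeff_eq_0)
qed

section \<open>Eigenvalues\<close>

text \<open>For a subspace \<open>L\<close> this is an eigenvector of the map induced on the quotient. The linear factors of the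
characteristic polynomial, applied in turn, take \<open>w0\<close> to \<open>0\<close>; the vector on which one of them enters
\<open>L\<close> is the one sought.\<close>

lemma eigenvalue_modulo_set:
  fixes M :: "complex^'n^'n"
  assumes "w0 \<notin> L" "0 \<in> L"
  shows "\<exists>w l. w \<notin> L \<and> M *v w - l *s w \<in> L"
proof -
  have *: "\<exists>w l. w \<notin> L \<and> M *v w - l *s w \<in> L"
    if "poly_act (\<Prod>x\<leftarrow>ls. [:-x, 1:]) M w0 \<in> L" for ls
    using that
  proof (induction ls)
    case Nil
    then show ?case using assms(1) by (simp add: poly_act_def)
  next
    case (Cons l ls)
    then show ?case by (simp only: list.map prod_list.Cons poly_act_linear_factor) blast
  qed
  obtain ls where ls: "mset ls = proots (charpoly M)"
    using ex_mset by blast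
  have "charpoly M = (\<Prod>x\<in>#mset ls. [:-x, 1:])"
    using complex_poly_decompose_multiset[of "charpoly M"] by (simp only: ls charpoly_monic(2) smult_1_left)
  also have "\<dots> = (\<Prod>x\<leftarrow>ls. [:-x, 1:])"
    by (simp only: mset_map[symmetric] prod_mset_prod_list)
  finally show ?thesis
    using *[of ls] cayley_hamilton[of M w0] assms(2) by simp
qed

lemma inj_matrix_kernel:
  fixes M :: "'a::field^'n^'m"
  shows "inj ((*v) M) \<longleftrightarrow> (\<forall>v. M *v v = 0 \<longrightarrow> v = 0)"
  unfolding inj_def
  by (metis diff_self eq_iff_diff_eq_0 matrix_vector_mult_0_right matrix_vector_mult_diff_distrib)

lemma eigenvalue_iff_det:
  fixes M :: "'a::field^'n^'n"
  shows "(\<exists>v. v \<noteq> 0 \<and> M *v v = l *s v) \<longleftrightarrow> det (M - mat l) = 0"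
proof -
  have "(M - mat l) *v v = M *v v - l *s v" for v
    by (simp add: matrix_vector_mult_diff_rdistrib mat_vector_mult)
  moreover have "det (M - mat l) \<noteq> 0 \<longleftrightarrow> (\<forall>v. (M - mat l) *v v = 0 \<longrightarrow> v = 0)"
    using inj_matrix_kernel[of "M - mat l"] det_nz_iff_inj_gen[of "(*v) (M - mat l)"]
    by (simp only: matrix_of_matrix_vector_mul matrix_vector_mul_linear_gen)
  ultimately show ?thesis by auto
qed

lemma left_eigenvalue_iff:
  fixes M :: "'a::field^'n^'n"
  shows "(\<exists>v. v \<noteq> 0 \<and> v v* M = l *s v) \<longleftrightarrow> (\<exists>v. v \<noteq> 0 \<and> M *v v = l *s v)"
proof -
  have "transpose M - mat l = transpose (M - mat l)"
    by (simp add: vec_eq_iff transpose_def mat_def)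
  then have "det (transpose M - mat l) = det (M - mat l)"
    by (metis det_transpose)
  then show ?thesis
    using eigenvalue_iff_det[of M l] eigenvalue_iff_det[of "transpose M" l] by simp
qed

section \<open>Stabilization with little control energy\<close>

lemma norm_smult: "norm (c *s v) = cmod c * norm (v :: complex^'n)"
  by (simp add: norm_vec_def norm_mult L2_set_left_distrib L2_set_right_distrib)

lemma norm_scalar_product_le: "cmod (scalar_product u v) \<le> norm u * norm (v :: complex^'n)"
proof -
  have "cmod (scalar_product u v) \<le> (\<Sum>i\<in>UNIV. cmod (u $ i) * cmod (v $ i))"
    unfolding scalar_product_def using norm_sum[of "\<lambda>i. u $ i * v $ i" UNIV] by (simp only: norm_mult)
  also have "\<dots> \<le> norm u * norm v"
    using L2_set_mult_ineq[of "\<lambda>i. cmod (u $ i)" "\<lambda>i. cmod (v $ i)" UNIV]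
    by (simp only: norm_vec_def abs_norm_cancel)
  finally show ?thesis .
qed

lemma scalar_product_vector_matrix:
  fixes A :: "'a::comm_ring_1^'n^'m"
  shows "scalar_product (w v* A) x = scalar_product w (A *v x)"
  unfolding scalar_product_def vector_matrix_mult_def matrix_vector_mult_def
  by (simp add: sum_distrib_left sum_distrib_right mult_ac) (rule sum.swap)

lemma scalar_product_linear:
  fixes w :: "'a::comm_ring_1^'n"
  shows "scalar_product w (x + y) = scalar_product w x + scalar_product w y"
    "scalar_product w (c *s x) = c * scalar_product w x"
    "scalar_product (c *s w) x = c * scalar_product w x"
  by (simp_all add: scalar_product_def algebra_simps sum.distrib sum_distrib_left)

definition outer :: "'a::times^'m \<Rightarrow> 'a^'n \<Rightarrow> 'a^'n^'m" where
  "outer b w = (\<chi> i j. b $ i * w $ j)"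

lemma outer_mult:
  fixes b :: "'a::comm_ring_1^'m"
  shows "outer b w *v x = scalar_product w x *s b"
    "u v* outer b w = scalar_product u b *s w"
  by (simp_all add: vec_eq_iff outer_def matrix_vector_mult_def vector_matrix_mult_def scalar_product_def
      sum_distrib_left sum_distrib_right mult_ac)

lemma matrix_mult_outer:
  fixes b :: "'a::comm_ring_1^'m"
  shows "B ** outer b w = outer (B *v b) w"
  by (simp add: vec_eq_iff outer_def matrix_matrix_mult_def matrix_vector_mult_def sum_distrib_left sum_distrib_right mult_ac)

text \<open>A summable input leaves the state of a contraction summable, whereas a rate of decay of the input may get
worse; this is why stability is measured by summability below.\<close>

lemma summable_contraction:
  fixes n e :: "nat \<Rightarrow> real"
  assumes "\<And>t. 0 \<le> n t" "\<And>t. n (Suc t) \<le> q * n t + e t" "0 \<le> q" "q < 1" "summable e" "\<And>t. 0 \<le> e t"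
  shows "summable n"
proof (rule summableI_nonneg_bounded[OF assms(1)])
  fix T
  have "(1 - q) * (\<Sum>t<T. n t) + n T \<le> n 0 + (\<Sum>t<T. e t)"
  proof (induction T)
    case (Suc T)
    then show ?case using assms(2)[of T] by (simp add: algebra_simps)
  qed simp
  also have "\<dots> \<le> n 0 + suminf e"
    using sum_le_suminf[OF assms(5), of "{..<T}"] assms(6) by simp
  finally have "(1 - q) * (\<Sum>t<T. n t) \<le> n 0 + suminf e" using assms(1)[of T] by linarith
  then show "(\<Sum>t<T. n t) \<le> (n 0 + suminf e) / (1 - q)"
    using assms(4) by (simp add: field_simps)
qed

abbreviation left_mult :: "'a::semiring_1^'n^'n \<Rightarrow> 'a^'n \<Rightarrow> 'a^'n" where
  "left_mult A \<equiv> (\<lambda>w. w v* A)"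

text \<open>The linear functionals of the state that decay summably along every trajectory of \<open>A\<close>.\<close>

definition left_stable :: "complex^'n^'n \<Rightarrow> (complex^'n) set" where
  "left_stable A = {w. summable (\<lambda>t. norm ((left_mult A ^^ t) w))}"

lemma vector_matrix_mult_linear:
  fixes A :: "'a::comm_ring_1^'n^'m"
  shows "(u + v) v* A = u v* A + v v* A" "(c *s u) v* A = c *s (u v* A)"
    "(u - v) v* A = u v* A - v v* A"
  by (simp_all add: vec_eq_iff vector_matrix_mult_def algebra_simps sum.distrib sum_distrib_left sum_subtractf)

lemma iterate_left_mult_linear:
  fixes A :: "'a::comm_ring_1^'n^'n"
  shows "(left_mult A ^^ t) (u + v) = (left_mult A ^^ t) u + (left_mult A ^^ t) v"
    "(left_mult A ^^ t) (c *s u) = c *s (left_mult A ^^ t) u"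
    "(left_mult A ^^ t) (u - v) = (left_mult A ^^ t) u - (left_mult A ^^ t) v"
    "(left_mult A ^^ t) 0 = 0"
  by (induction t) (simp_all add: vector_matrix_mult_linear)

lemma iterate_left_mult_swap:
  fixes A :: "'a::comm_ring_1^'n^'n"
  shows "(left_mult A ^^ t) (w v* A) = ((left_mult A ^^ t) w) v* A"
  by (induction t) simp_all

lemma scalar_product_iterate:
  fixes A :: "'a::comm_ring_1^'n^'n"
  shows "scalar_product ((left_mult A ^^ t) w) x = scalar_product w (((*v) A ^^ t) x)"
  by (induction t arbitrary: x) (simp_all add: scalar_product_vector_matrix funpow_swap1)

lemma of_real_smult: "c *\<^sub>R (v :: complex^'n) = complex_of_real c *s v"
  by (simp add: vec_eq_iff scaleR_conv_of_real[where 'a = complex])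

lemma subspace_left_stable: "subspace (left_stable A)"
proof (rule subspaceI)
  show "0 \<in> left_stable A" by (simp add: left_stable_def iterate_left_mult_linear)
next
  fix x y assume xy: "x \<in> left_stable A" "y \<in> left_stable A"
  then have "summable (\<lambda>t. norm ((left_mult A ^^ t) x) + norm ((left_mult A ^^ t) y))"
    by (auto simp: left_stable_def intro: summable_add)
  then show "x + y \<in> left_stable A"
    unfolding left_stable_def iterate_left_mult_linear mem_Collect_eq
    by (rule summable_comparison_test') (simp add: norm_triangle_ineq)
next
  fix c x assume "x \<in> left_stable A"
  then show "c *\<^sub>R x \<in> left_stable A"
    by (auto simp: left_stable_def of_real_smult iterate_left_mult_linear norm_smult intro: summable_mult)
qed

lemma smult_left_stable: "x \<in> left_stable A \<Longrightarrow> c *s x \<in> left_stable A"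
  by (auto simp: left_stable_def iterate_left_mult_linear norm_smult intro: summable_mult)

lemma left_mult_left_stable: "x \<in> left_stable A \<Longrightarrow> x v* A \<in> left_stable A"
  using summable_Suc_iff[of "\<lambda>t. norm ((left_mult A ^^ t) x)"]
  by (simp add: left_stable_def iterate_left_mult_swap)

lemma iterate_left_eigenvector:
  fixes A :: "'a::comm_ring_1^'n^'n"
  shows "w v* A = l *s w \<Longrightarrow> (left_mult A ^^ t) w = l ^ t *s w"
  by (induction t) (simp_all add: vector_matrix_mult_linear vector_smult_assoc mult.commute)

lemma left_eigenvector_left_stable_iff:
  assumes "w \<noteq> 0" "w v* A = l *s w"
  shows "w \<in> left_stable A \<longleftrightarrow> cmod l < 1"
proof -
  have "w \<in> left_stable A \<longleftrightarrow> summable (\<lambda>t. norm w * cmod l ^ t)"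
    by (simp add: left_stable_def iterate_left_eigenvector[OF assms(2)] norm_smult norm_power mult.commute)
  then show ?thesis using assms(1) by (simp add: summable_cmult_iff summable_geometric_iff)
qed

text \<open>A vector that is an eigenvector modulo the stable subspace can be corrected by an element of
  that subspace, on which \<open>A - l\<close> is onto because it is injective.\<close>

lemma unstable_left_eigenvector_exists:
  fixes A :: "complex^'n^'n"
  assumes "left_stable A \<noteq> UNIV"
  obtains w l where "w \<noteq> 0" "w v* A = l *s w" "1 \<le> cmod l"
proof -
  let ?L = "left_stable A"
  obtain w0 where "w0 \<notin> ?L" using assms by blast
  from eigenvalue_modulo_set[OF this subspace_0[OF subspace_left_stable], of "transpose A"]
  obtain w l where w: "w \<notin> ?L" and d: "w v* A - l *s w \<in> ?L" by auto
  define d where "d = w v* A - l *s w"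
  have "1 \<le> cmod l"
  proof (rule ccontr)
    assume l: "\<not> 1 \<le> cmod l"
    have "(left_mult A ^^ Suc t) w = l *s (left_mult A ^^ t) w + (left_mult A ^^ t) d" for t
      by (simp add: d_def iterate_left_mult_linear iterate_left_mult_swap)
    then have "norm ((left_mult A ^^ Suc t) w) \<le> cmod l * norm ((left_mult A ^^ t) w) + norm ((left_mult A ^^ t) d)" for t
      by (metis norm_smult norm_triangle_ineq)
    then have "summable (\<lambda>t. norm ((left_mult A ^^ t) w))"
      by (rule summable_contraction[where q = "cmod l", rotated])
        (use l d in \<open>auto simp: left_stable_def d_def\<close>)
    then show False using w by (simp add: left_stable_def)
  qed
  define \<phi> where "\<phi> s = s v* A - l *s s" for s
  have lin: "linear \<phi>"
    by (rule linearI) (simp_all add: \<phi>_def of_real_smult vector_matrix_mult_linear vector_add_ldistrib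
        vector_ssub_ldistrib vector_smult_assoc mult.commute)
  have inj: "inj_on \<phi> ?L"
  proof (subst linear_inj_on_iff_eq_0[OF lin subspace_left_stable], intro ballI impI)
    fix s assume "s \<in> ?L" "\<phi> s = 0"
    then show "s = 0" using left_eigenvector_left_stable_iff[of s A l] \<open>1 \<le> cmod l\<close> by (auto simp: \<phi>_def)
  qed
  have "\<phi> ` ?L = ?L"
  proof (rule subspace_dim_equal)
    show "subspace (\<phi> ` ?L)" by (rule linear_subspace_image[OF lin subspace_left_stable])
    show "\<phi> ` ?L \<subseteq> ?L"
      by (auto simp: \<phi>_def intro!: subspace_diff[OF subspace_left_stable] smult_left_stable left_mult_left_stable)
    show "dim ?L \<le> dim (\<phi> ` ?L)"
      using dim_image_eq[OF lin, of ?L] inj by (simp add: span_eq_iff[THEN iffD2, OF subspace_left_stable])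
  qed (rule subspace_left_stable)
  then obtain s where s: "s \<in> ?L" "\<phi> s = d" using d d_def by (metis image_iff)
  show thesis
  proof
    show "w - s \<noteq> 0" using w s by auto
    show "(w - s) v* A = l *s (w - s)"
      using s by (simp add: \<phi>_def d_def vector_matrix_mult_linear vector_ssub_ldistrib algebra_simps)
  qed fact
qed

text \<open>A feedback that measures only \<open>w\<^sup>T x\<close> and shifts the eigenvalue of \<open>w\<close> into the disc leaves the other stable
functionals stable: they pick up a multiple of \<open>w\<close>, whose coefficient obeys a contraction with a summable
input. So the stable subspace grows, which is what the induction on its dimension needs.\<close>

lemma left_stable_rank_one_update:
  fixes A :: "complex^'n^'n"
  assumes w: "w \<noteq> 0" and l': "w v* (A + outer b w) = l' *s w" "cmod l' < 1"
  shows "insert w (left_stable A) \<subseteq> left_stable (A + outer b w)"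
proof safe
  let ?A = "A + outer b w"
  show "w \<in> left_stable ?A" using left_eigenvector_left_stable_iff[OF w l'(1)] l'(2) by simp
  fix s assume s: "s \<in> left_stable A"
  define e where "e t = scalar_product ((left_mult A ^^ t) s) b" for t
  define c where "c = rec_nat 0 (\<lambda>t c. l' * c + e t)"
  have c: "c 0 = 0" "c (Suc t) = l' * c t + e t" for t by (simp_all add: c_def)
  have it: "(left_mult ?A ^^ t) s = (left_mult A ^^ t) s + c t *s w" for t
  proof (induction t)
    case (Suc t)
    have "(left_mult ?A ^^ Suc t) s = ((left_mult A ^^ t) s) v* ?A + (c t *s w) v* ?A"
      by (simp add: Suc vector_matrix_mult_linear)
    also have "((left_mult A ^^ t) s) v* ?A = (left_mult A ^^ Suc t) s + e t *s w"
      by (simp add: vector_matrix_mult_add_rdistrib outer_mult e_def)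
    also have "(c t *s w) v* ?A = (l' * c t) *s w"
      by (simp add: vector_matrix_mult_linear l' vector_smult_assoc mult.commute)
    finally show ?case by (simp add: c vector_sadd_rdistrib)
  qed (simp add: c)
  have sum_e: "summable (\<lambda>t. cmod (e t))"
    by (rule summable_comparison_test'[where g = "\<lambda>t. norm ((left_mult A ^^ t) s) * norm b"])
       (use s in \<open>auto simp: left_stable_def e_def norm_scalar_product_le intro: summable_mult2\<close>)
  have "cmod (c (Suc t)) \<le> cmod l' * cmod (c t) + cmod (e t)" for t
    unfolding c by (metis norm_mult norm_triangle_ineq)
  then have "summable (\<lambda>t. cmod (c t))"
    by (rule summable_contraction[where q = "cmod l'", rotated]) (use l' sum_e in auto)
  then have "summable (\<lambda>t. norm ((left_mult A ^^ t) s) + cmod (c t) * norm w)"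
    using s by (intro summable_add summable_mult2) (auto simp: left_stable_def)
  then show "s \<in> left_stable ?A"
    unfolding left_stable_def mem_Collect_eq it
    by (rule summable_comparison_test') (simp, metis norm_smult norm_triangle_ineq)
qed

text \<open>The Popov-Belevitch-Hautus form of stabilizability.\<close>

definition hautus_stabilizable :: "complex^'n^'n \<Rightarrow> complex^'m^'n \<Rightarrow> bool" where
  "hautus_stabilizable A B \<longleftrightarrow>
     (\<forall>w l. w \<noteq> 0 \<and> w v* A = l *s w \<and> 1 \<le> cmod l \<longrightarrow> w v* B \<noteq> 0)"

definition left_spectrum_in_disc :: "complex^'n^'n \<Rightarrow> bool" where
  "left_spectrum_in_disc A \<longleftrightarrow> (\<forall>w l. w \<noteq> 0 \<and> w v* A = l *s w \<longrightarrow> cmod l \<le> 1)"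

lemma hautus_stabilizable_feedback:
  assumes "hautus_stabilizable A B"
  shows "hautus_stabilizable (A + B ** F) B"
  unfolding hautus_stabilizable_def
proof (intro allI impI notI, elim conjE)
  fix w l assume w: "w \<noteq> 0" "w v* (A + B ** F) = l *s w" "1 \<le> cmod l" and 0: "w v* B = 0"
  have "w v* (B ** F) = 0" using 0 by (simp flip: vector_matrix_mul_assoc)
  then have "w v* A = l *s w" using w by (simp add: vector_matrix_mult_add_rdistrib)
  then show False using assms w 0 by (auto simp: hautus_stabilizable_def)
qed

text \<open>An eigenvector of the updated matrix for an eigenvalue other than \<open>l\<close> and \<open>l'\<close> becomes one of \<open>A\<close> after
adding a multiple of \<open>w\<close>, so no eigenvalue leaves the disc.\<close>

lemma left_spectrum_in_disc_rank_one_update: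
  fixes A :: "complex^'n^'n"
  assumes A: "left_spectrum_in_disc A" and w: "w v* A = l *s w" "cmod l \<le> 1"
    and l': "w v* (A + outer b w) = l' *s w" "cmod l' \<le> 1"
  shows "left_spectrum_in_disc (A + outer b w)"
  unfolding left_spectrum_in_disc_def
proof (intro allI impI, elim conjE, rule ccontr)
  fix u m assume u: "u \<noteq> 0" "u v* (A + outer b w) = m *s u" and m: "\<not> cmod m \<le> 1"
  define c where "c = scalar_product u b / (l - m)"
  have lm: "l \<noteq> m" using w m by auto
  have uA: "u v* A = m *s u - scalar_product u b *s w"
    using u by (simp add: vector_matrix_mult_add_rdistrib outer_mult algebra_simps)
  have "c * l - scalar_product u b = m * c"
    using lm by (simp add: c_def field_simps)
  then have "(u + c *s w) v* A = m *s (u + c *s w)"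
    by (simp add: vector_matrix_mult_linear uA w vec_eq_iff algebra_simps)
  then have "u + c *s w = 0" using A m unfolding left_spectrum_in_disc_def by blast
  then have "u = (-c) *s w" by (simp add: vector_smult_lneg eq_neg_iff_add_eq_0)
  then have "u v* (A + outer b w) = l' *s u"
    by (simp only: vector_matrix_mult_linear l') (simp add: vector_smult_assoc mult.commute)
  then have "m = l'" using u by simp
  then show False using m l' by simp
qed

text \<open>The energy of the state of a slow contraction: of order \<open>1 / \<delta>\<close> from the initial value and \<open>1 / \<delta>\<^sup>2\<close> from the
input. A feedback of size \<open>\<delta>\<close> on that state therefore spends an energy of order \<open>\<delta>\<close> of its own.\<close>

lemma sum_square_driven_contraction:
  fixes y :: "nat \<Rightarrow> complex" and v :: "nat \<Rightarrow> real"
  assumes \<delta>: "0 < \<delta>" "\<delta> \<le> 1" and rec: "\<And>t. cmod (y (Suc t)) \<le> (1 - \<delta>) * cmod (y t) + v t"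
    and v: "\<And>t. 0 \<le> v t"
  shows "\<delta> * (\<Sum>t<T. (cmod (y t))\<^sup>2) \<le> (cmod (y 0))\<^sup>2 + 2 / \<delta> * (\<Sum>t<T. (v t)\<^sup>2)"
proof -
  have step: "(cmod (y (Suc t)))\<^sup>2 \<le> (1 - \<delta>) * (cmod (y t))\<^sup>2 + 2 / \<delta> * (v t)\<^sup>2" for t
  proof -
    let ?a = "cmod (y t)"
    have "(cmod (y (Suc t)))\<^sup>2 \<le> ((1 - \<delta>) * ?a + v t)\<^sup>2"
      by (rule power_mono[OF rec]) simp
    also have "\<dots> \<le> (1 - \<delta>) * ?a\<^sup>2 + (v t)\<^sup>2 / \<delta>"
    proof -
      \<comment> \<open>convexity of the square, with weights \<open>1 - \<delta>\<close> and \<open>\<delta>\<close>\<close>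
      have "(1 - \<delta>) * ?a\<^sup>2 + (v t)\<^sup>2 / \<delta> - ((1 - \<delta>) * ?a + v t)\<^sup>2 = (1 - \<delta>) / \<delta> * (\<delta> * ?a - v t)\<^sup>2"
        using \<delta> by (simp add: field_simps power2_eq_square)
      moreover have "\<dots> \<ge> 0" using \<delta> by simp
      ultimately show ?thesis by linarith
    qed
    also have "(v t)\<^sup>2 / \<delta> \<le> 2 / \<delta> * (v t)\<^sup>2" using \<delta> by (simp add: field_simps)
    finally show ?thesis by simp
  qed
  have "\<delta> * (\<Sum>t<T. (cmod (y t))\<^sup>2) + (cmod (y T))\<^sup>2 \<le> (cmod (y 0))\<^sup>2 + 2 / \<delta> * (\<Sum>t<T. (v t)\<^sup>2)"
  proof (induction T)
    case (Suc T)
    then show ?case using step[of T] by (simp add: algebra_simps)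
  qed simp
  then show ?thesis using zero_le_power2[of "cmod (y T)"] by linarith
qed

lemma left_stable_UNIV_square_summable:
  fixes A :: "complex^'n^'n"
  assumes "left_stable A = UNIV"
  shows "\<exists>K\<ge>0. \<forall>x T. (\<Sum>t<T. (norm (((*v) A ^^ t) x))\<^sup>2) \<le> K * (norm x)\<^sup>2"
proof -
  define a where "a t = (\<Sum>i\<in>UNIV. norm ((left_mult A ^^ t) (axis i 1)))" for t
  have a0: "0 \<le> a t" for t by (simp add: a_def sum_nonneg)
  have "summable a"
    unfolding a_def using assms by (intro summable_sum) (auto simp: left_stable_def)
  then have aS: "(\<Sum>t<T. a t) \<le> suminf a" for T
    by (rule sum_le_suminf) (auto simp: a0)
  have "norm (((*v) A ^^ t) x) \<le> a t * norm x" for t x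
  proof -
    have comp: "(((*v) A ^^ t) x) $ i = scalar_product ((left_mult A ^^ t) (axis i 1)) x" for i
      unfolding scalar_product_iterate
      by (simp add: scalar_product_def axis_def if_distrib[of "\<lambda>c. c * _"] cong: if_cong)
    have "norm (((*v) A ^^ t) x) \<le> (\<Sum>i\<in>UNIV. cmod ((((*v) A ^^ t) x) $ i))"
      unfolding norm_vec_def by (rule L2_set_le_sum) simp
    also have "\<dots> \<le> (\<Sum>i\<in>UNIV. norm ((left_mult A ^^ t) (axis i 1)) * norm x)"
      unfolding comp by (intro sum_mono norm_scalar_product_le)
    finally show ?thesis by (simp add: a_def sum_distrib_right)
  qed
  then have "(norm (((*v) A ^^ t) x))\<^sup>2 \<le> (a t)\<^sup>2 * (norm x)\<^sup>2" for t x
    by (metis norm_ge_zero power_mono power_mult_distrib)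
  then have "(\<Sum>t<T. (norm (((*v) A ^^ t) x))\<^sup>2) \<le> (\<Sum>t<T. (a t)\<^sup>2) * (norm x)\<^sup>2" for x T
    by (simp add: sum_distrib_right sum_mono)
  moreover have "(\<Sum>t<T. (a t)\<^sup>2) \<le> (suminf a)\<^sup>2" for T
  proof -
    have "(\<Sum>t<T. (a t)\<^sup>2) \<le> (\<Sum>t<T. a t * suminf a)"
    proof (rule sum_mono)
      fix t
      have "a t \<le> (\<Sum>t<Suc t. a t)" using a0 by (simp add: sum_nonneg)
      then show "(a t)\<^sup>2 \<le> a t * suminf a"
        using aS[of "Suc t"] a0[of t] by (simp add: power2_eq_square mult_left_mono)
    qed
    also have "\<dots> \<le> suminf a * suminf a"
      using aS[of T] aS[of 0] by (simp add: mult_right_mono flip: sum_distrib_right)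
    finally show ?thesis by (simp add: power2_eq_square)
  qed
  ultimately have "(\<Sum>t<T. (norm (((*v) A ^^ t) x))\<^sup>2) \<le> (suminf a)\<^sup>2 * (norm x)\<^sup>2" for x T
    by (meson mult_right_mono order_trans zero_le_power2)
  then show ?thesis by (intro exI[of _ "(suminf a)\<^sup>2"]) auto
qed

text \<open>Induction on the codimension of the stable functionals. If a functional \<open>w\<close> belongs to an eigenvalue \<open>l\<close>
on the unit circle, the feedback \<open>f w\<^sup>T x\<close> moves it to \<open>(1 - \<delta>) l\<close> at a cost of order \<open>\<delta>\<close>. What remains is
stabilized by induction with a feedback of energy \<open>\<kappa> / 12\<close>; this acts on \<open>w\<^sup>T x\<close> as a disturbance, to which
\<open>f w\<^sup>T x\<close> responds with a fixed multiple of that energy, whatever \<open>\<delta>\<close> is.\<close>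

theorem low_energy_stabilization:
  fixes A :: "complex^'n^'n" and B :: "complex^'m^'n"
  assumes "hautus_stabilizable A B" "left_spectrum_in_disc A" "0 < \<kappa>"
  shows "\<exists>F :: complex^'n^'m. left_stable (A + B ** F) = UNIV \<and>
    (\<forall>x T. (\<Sum>t<T. (norm (F *v (((*v) (A + B ** F) ^^ t) x)))\<^sup>2) \<le> \<kappa> * (norm x)\<^sup>2)"
  using assms
proof (induction "DIM(complex^'n) - dim (left_stable A)" arbitrary: A \<kappa> rule: less_induct)
  case less
  show ?case
  proof (cases "left_stable A = UNIV")
    case True
    then show ?thesis using \<open>0 < \<kappa>\<close> by (intro exI[of _ 0]) simp
  next
    case False
    then obtain w l where w0: "w \<noteq> 0" and wA: "w v* A = l *s w" and "1 \<le> cmod l"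
      by (rule unstable_left_eigenvector_exists)
    then have l1: "cmod l = 1" using less.prems(2) by (force simp: left_spectrum_in_disc_def)
    define g where "g = w v* B"
    have g0: "g \<noteq> 0"
      using less.prems(1) w0 wA \<open>1 \<le> cmod l\<close> by (auto simp: hautus_stabilizable_def g_def)
    \<comment> \<open>chosen so that the part of the energy due to the initial value is at most \<open>\<kappa> / 2\<close>\<close>
    define \<delta> where "\<delta> = min 1 (\<kappa> / (4 * (norm w)\<^sup>2 / (norm g)\<^sup>2 + 1))"
    have d4: "0 < 4 * (norm w)\<^sup>2 / (norm g)\<^sup>2 + 1"
      by (intro add_nonneg_pos) simp_all
    have \<delta>: "0 < \<delta>" "\<delta> \<le> 1" using \<open>0 < \<kappa>\<close> d4 by (simp_all add: \<delta>_def)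
    have "\<delta> * (4 * (norm w)\<^sup>2 / (norm g)\<^sup>2 + 1) \<le> \<kappa>"
      using d4 by (simp add: \<delta>_def flip: pos_le_divide_eq)
    then have \<delta>\<kappa>: "2 * \<delta> * (norm w)\<^sup>2 / (norm g)\<^sup>2 \<le> \<kappa> / 2"
      using \<delta> by (simp add: algebra_simps)
    define f where "f = (- (of_real \<delta> * l / of_real ((norm g)\<^sup>2))) *s (\<chi> i. cnj (g $ i))"
    have ncnj: "norm (\<chi> i. cnj (g $ i)) = norm g"
      by (simp add: norm_vec_def)
    have nf: "norm f = \<delta> / norm g"
      using \<delta> g0 by (simp add: f_def norm_smult ncnj norm_mult norm_divide l1 power2_eq_square)
    have "scalar_product g (\<chi> i. cnj (g $ i)) = of_real ((norm g)\<^sup>2)"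
      by (simp add: scalar_product_def norm_vec_def L2_set_def sum_nonneg complex_norm_square flip: complex_norm_square)
    then have gf: "scalar_product g f = - (of_real \<delta> * l)"
      using g0 unfolding f_def scalar_product_linear by simp
    define b where "b = B *v f"
    define A' where "A' = A + outer b w"
    have A'_eq: "A' = A + B ** outer f w" by (simp add: A'_def b_def matrix_mult_outer)
    define l' where "l' = of_real (1 - \<delta>) * l"
    have l'1: "cmod l' = 1 - \<delta>" using \<delta> by (simp add: l'_def norm_mult l1 del: of_real_diff)
    have wA': "w v* (A + outer b w) = l' *s w"
    proof -
      have "scalar_product w b = scalar_product g f"
        by (simp add: b_def g_def scalar_product_vector_matrix)
      then show ?thesis
        by (simp add: vector_matrix_mult_add_rdistrib wA outer_mult gf l'_def algebra_simps flip: vector_sadd_rdistrib)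
    qed
    have sub: "insert w (left_stable A) \<subseteq> left_stable A'"
      unfolding A'_def by (rule left_stable_rank_one_update[OF w0 wA']) (use \<delta> l'1 in simp)
    moreover have "w \<notin> left_stable A"
      using left_eigenvector_left_stable_iff[OF w0 wA] l1 by simp
    ultimately have "dim (left_stable A) < dim (left_stable A')"
      by (intro dim_psubset) (auto simp: span_eq_iff[THEN iffD2, OF subspace_left_stable])
    moreover have "dim (left_stable A') \<le> DIM(complex^'n)" by (rule dim_subset_UNIV)
    ultimately have "DIM(complex^'n) - dim (left_stable A') < DIM(complex^'n) - dim (left_stable A)" by linarith
    moreover have "hautus_stabilizable A' B"
      unfolding A'_eq by (rule hautus_stabilizable_feedback) fact
    moreover have "left_spectrum_in_disc A'"
      unfolding A'_def by (rule left_spectrum_in_disc_rank_one_update[OF less.prems(2) wA _ wA']) (use \<delta> l1 l'1 in simp_all)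
    moreover have "0 < \<kappa> / 12" using \<open>0 < \<kappa>\<close> by simp
    ultimately obtain F' :: "complex^'n^'m" where F': "left_stable (A' + B ** F') = UNIV"
      and en: "\<And>x T. (\<Sum>t<T. (norm (F' *v (((*v) (A' + B ** F') ^^ t) x)))\<^sup>2) \<le> \<kappa> / 12 * (norm x)\<^sup>2"
      using less.hyps by blast
    define F where "F = outer f w + F'"
    have AF: "A + B ** F = A' + B ** F'" by (simp add: F_def A'_eq matrix_add_ldistrib)
    have "(\<Sum>t<T. (norm (F *v (((*v) (A + B ** F) ^^ t) x)))\<^sup>2) \<le> \<kappa> * (norm x)\<^sup>2" for x T
    proof -
      define X where "X t = ((*v) (A + B ** F) ^^ t) x" for t
      define y where "y t = scalar_product w (X t)" for t
      define v where "v t = norm (F' *v X t)" for t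
      have y_rec: "y (Suc t) = l' * y t + scalar_product g (F' *v X t)" for t
      proof -
        have "y (Suc t) = scalar_product w (A' *v X t) + scalar_product w (B *v (F' *v X t))"
          by (simp add: y_def X_def AF matrix_vector_mult_add_rdistrib scalar_product_linear matrix_vector_mul_assoc)
        also have "scalar_product w (A' *v X t) = l' * y t"
          using wA' by (simp add: y_def A'_def scalar_product_linear flip: scalar_product_vector_matrix)
        finally show ?thesis by (simp add: g_def scalar_product_vector_matrix)
      qed
      have vS: "(\<Sum>t<T. (v t)\<^sup>2) \<le> \<kappa> / 12 * (norm x)\<^sup>2"
        unfolding v_def X_def AF by (rule en)
      have "\<delta> * (\<Sum>t<T. (cmod (y t))\<^sup>2) \<le> (cmod (y 0))\<^sup>2 + 2 / \<delta> * (\<Sum>t<T. (norm g * v t)\<^sup>2)"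
      proof (rule sum_square_driven_contraction[OF \<delta>])
        fix t
        show "cmod (y (Suc t)) \<le> (1 - \<delta>) * cmod (y t) + norm g * v t"
          unfolding y_rec v_def using norm_scalar_product_le[of g "F' *v X t"]
          by (intro order.trans[OF norm_triangle_ineq] add_mono) (simp_all add: norm_mult l'1)
      qed (simp add: v_def)
      also have "\<dots> \<le> (norm w * norm x)\<^sup>2 + 2 / \<delta> * ((norm g)\<^sup>2 * (\<kappa> / 12 * (norm x)\<^sup>2))"
      proof (intro add_mono power_mono mult_left_mono)
        show "cmod (y 0) \<le> norm w * norm x" by (simp add: y_def X_def norm_scalar_product_le)
        show "(\<Sum>t<T. (norm g * v t)\<^sup>2) \<le> (norm g)\<^sup>2 * (\<kappa> / 12 * (norm x)\<^sup>2)"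
          unfolding power_mult_distrib sum_distrib_left[symmetric] by (intro mult_left_mono vS) simp
      qed (use \<delta> in auto)
      finally have yS: "\<delta> * (\<Sum>t<T. (cmod (y t))\<^sup>2) \<le> \<dots>" .
      have "norm (F *v X t) \<le> norm f * cmod (y t) + v t" for t
        unfolding F_def matrix_vector_mult_add_rdistrib outer_mult v_def y_def
        by (rule order.trans[OF norm_triangle_ineq]) (simp add: norm_smult mult.commute)
      then have "(norm (F *v X t))\<^sup>2 \<le> (norm f * cmod (y t) + v t)\<^sup>2" for t
        by (intro power_mono) auto
      moreover have "(norm f * cmod (y t) + v t)\<^sup>2 \<le> 2 * (norm f)\<^sup>2 * (cmod (y t))\<^sup>2 + 2 * (v t)\<^sup>2" for t
        using zero_le_power2[of "norm f * cmod (y t) - v t"] by (simp add: power2_eq_square algebra_simps)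
      ultimately have "(norm (F *v X t))\<^sup>2 \<le> 2 * (norm f)\<^sup>2 * (cmod (y t))\<^sup>2 + 2 * (v t)\<^sup>2" for t
        using order.trans by blast
      then have "(\<Sum>t<T. (norm (F *v X t))\<^sup>2) \<le> 2 * (norm f)\<^sup>2 * (\<Sum>t<T. (cmod (y t))\<^sup>2) + 2 * (\<Sum>t<T. (v t)\<^sup>2)"
        unfolding sum_distrib_left sum.distrib[symmetric] by (intro sum_mono)
      also have "2 * (norm f)\<^sup>2 * (\<Sum>t<T. (cmod (y t))\<^sup>2) = 2 * \<delta> / (norm g)\<^sup>2 * (\<delta> * (\<Sum>t<T. (cmod (y t))\<^sup>2))"
        by (simp add: nf power2_eq_square)
      also have "\<dots> \<le> 2 * \<delta> / (norm g)\<^sup>2 * ((norm w * norm x)\<^sup>2 + 2 / \<delta> * ((norm g)\<^sup>2 * (\<kappa> / 12 * (norm x)\<^sup>2)))"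
        using \<delta> by (intro mult_left_mono yS) simp
      also have "\<dots> = (2 * \<delta> * (norm w)\<^sup>2 / (norm g)\<^sup>2) * (norm x)\<^sup>2 + \<kappa> / 3 * (norm x)\<^sup>2"
        using \<delta> g0 by (simp add: field_simps)
      also have "\<dots> \<le> \<kappa> / 2 * (norm x)\<^sup>2 + \<kappa> / 3 * (norm x)\<^sup>2"
        by (intro add_mono mult_right_mono \<delta>\<kappa>) simp_all
      finally have "(\<Sum>t<T. (norm (F *v X t))\<^sup>2) \<le> \<kappa> / 2 * (norm x)\<^sup>2 + \<kappa> / 3 * (norm x)\<^sup>2 + 2 * (\<kappa> / 12 * (norm x)\<^sup>2)"
        using vS by linarith
      then show ?thesis by (simp add: X_def algebra_simps)
    qed
    then show ?thesis using F' AF by metis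
  qed
qed

section \<open>A real Lyapunov form with little weight\<close>

text \<open>The infimum of a positive definite form over the fibres of a linear map is attained and again a
quadratic form. If \<open>\<Phi>\<close> represents \<open>\<phi>\<close>, its matrix is \<open>(\<pi> \<Phi>\<^sup>-\<^sup>1 \<pi>\<^sup>*)\<^sup>-\<^sup>1\<close>, and the minimizers are orthogonal to the
kernel of \<open>\<pi>\<close>.\<close>

lemma bilinear_form_pushforward:
  fixes \<phi> :: "'x::euclidean_space \<Rightarrow> 'x \<Rightarrow> real" and \<pi> :: "'x \<Rightarrow> 'y::euclidean_space"
  assumes \<phi>: "bilinear \<phi>" "\<And>x y. \<phi> x y = \<phi> y x" "\<And>x. x \<noteq> 0 \<Longrightarrow> 0 < \<phi> x x"
    and \<pi>: "linear \<pi>" "surj \<pi>"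
  shows "\<exists>T. linear T \<and> (\<forall>a b. a \<bullet> T b = T a \<bullet> b) \<and>
    (\<forall>X. \<pi> X \<bullet> T (\<pi> X) \<le> \<phi> X X) \<and> (\<forall>a. \<exists>X. \<pi> X = a \<and> a \<bullet> T a = \<phi> X X)"
proof -
  have linl: "linear (\<lambda>x. \<phi> x y)" and linr: "linear (\<lambda>y. \<phi> x y)" for x y
    using \<phi>(1) by (auto simp: bilinear_def)
  define \<Phi> where "\<Phi> X = (\<Sum>b\<in>Basis. \<phi> X b *\<^sub>R b)" for X
  have \<Phi>: "\<Phi> X \<bullet> Y = \<phi> X Y" for X Y
  proof -
    have "\<phi> X Y = \<phi> X (\<Sum>b\<in>Basis. (Y \<bullet> b) *\<^sub>R b)" by (simp add: euclidean_representation)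
    also have "\<dots> = (\<Sum>b\<in>Basis. (Y \<bullet> b) * \<phi> X b)"
      using linr[of X] by (simp add: linear_sum linear_cmul)
    finally show ?thesis
      by (simp add: \<Phi>_def inner_sum_left inner_commute[of Y] mult.commute)
  qed
  have lin\<Phi>: "linear \<Phi>"
    using linl by (intro linearI) (simp_all add: \<Phi>_def linear_add[OF linl] linear_cmul[OF linl] scaleR_add_left sum.distrib scaleR_sum_right)
  have inj\<Phi>: "inj \<Phi>"
  proof (subst linear_injective_0[OF lin\<Phi>], intro allI impI)
    fix x assume "\<Phi> x = 0"
    then have "\<phi> x x = 0" using \<Phi>[of x x] by simp
    then show "x = 0" using \<phi>(3)[of x] by force
  qed
  obtain \<Psi> where \<Psi>: "linear \<Psi>" "\<And>x. \<Psi> (\<Phi> x) = x" "\<And>x. \<Phi> (\<Psi> x) = x"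
    using linear_injective_isomorphism[OF lin\<Phi> inj\<Phi>] by blast
  let ?\<pi>' = "adjoint \<pi>"
  have lin\<pi>': "linear ?\<pi>'" by (rule adjoint_linear[OF \<pi>(1)])
  define S where "S y = \<pi> (\<Psi> (?\<pi>' y))" for y
  have linS: "linear S"
    using linear_compose[OF lin\<pi>' linear_compose[OF \<Psi>(1) \<pi>(1)]] by (simp add: S_def[abs_def] o_def)
  have yS: "z \<bullet> S y = \<phi> (\<Psi> (?\<pi>' z)) (\<Psi> (?\<pi>' y))" for y z
    by (metis S_def \<Phi> \<Psi>(3) adjoint_works[OF \<pi>(1)] inner_commute)
  have injS: "inj S"
  proof (subst linear_injective_0[OF linS], intro allI impI)
    fix y assume "S y = 0"
    then have "\<Psi> (?\<pi>' y) = 0" using yS[of y y] \<phi>(3)[of "\<Psi> (?\<pi>' y)"] by force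
    then have *: "?\<pi>' y = 0" using \<Psi>(3) by (metis lin\<Phi> linear_0)
    obtain x where "\<pi> x = y" using \<pi>(2) by (metis surjD)
    then have "y \<bullet> y = 0" using adjoint_works[OF \<pi>(1), of x y] * by (simp add: inner_commute)
    then show "y = 0" by simp
  qed
  obtain T where T: "linear T" "\<And>x. T (S x) = x" "\<And>x. S (T x) = x"
    using linear_injective_isomorphism[OF linS injS] by blast
  define G where "G a = \<Psi> (?\<pi>' (T a))" for a
  have \<pi>G: "\<pi> (G a) = a" for a using T(3)[of a] by (simp add: G_def S_def)
  have GY: "\<phi> (G a) Y = T a \<bullet> \<pi> Y" for a Y
  proof -
    have "\<phi> (G a) Y = ?\<pi>' (T a) \<bullet> Y" by (simp add: G_def \<Psi>(3) flip: \<Phi>)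
    then show ?thesis by (simp add: adjoint_works[OF \<pi>(1)] inner_commute)
  qed
  show ?thesis
  proof (intro exI conjI allI)
    show "linear T" by fact
    show "a \<bullet> T b = T a \<bullet> b" for a b
      using GY[of a "G b"] GY[of b "G a"] \<phi>(2)[of "G a" "G b"] by (simp add: \<pi>G inner_commute)
    show "\<pi> (G a) = a" for a by (rule \<pi>G)
    show "a \<bullet> T a = \<phi> (G a) (G a)" for a by (simp add: GY \<pi>G inner_commute)
    fix X
    define N where "N = X - G (\<pi> X)"
    have X: "X = G (\<pi> X) + N" by (simp add: N_def)
    have "\<pi> N = 0" by (simp add: N_def linear_diff[OF \<pi>(1)] \<pi>G)
    then have 0: "\<phi> (G (\<pi> X)) N = 0" by (simp add: GY)
    have "\<phi> X X = \<phi> (G (\<pi> X)) (G (\<pi> X)) + \<phi> N N"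
      by (subst (1 2) X) (simp add: bilinear_ladd[OF \<phi>(1)] bilinear_radd[OF \<phi>(1)] 0 \<phi>(2)[of N "G (\<pi> X)"])
    moreover have "0 \<le> \<phi> N N" using \<phi>(3)[of N] bilinear_lzero[OF \<phi>(1)] by (cases "N = 0") force+
    ultimately show "\<pi> X \<bullet> T (\<pi> X) \<le> \<phi> X X" by (simp add: GY \<pi>G inner_commute)
  qed
qed

lemma summable_inner_of_squares:
  fixes f g :: "nat \<Rightarrow> 'a::real_inner"
  assumes "summable (\<lambda>t. (norm (f t))\<^sup>2)" "summable (\<lambda>t. (norm (g t))\<^sup>2)"
  shows "summable (\<lambda>t. f t \<bullet> g t)"
proof (rule summable_comparison_test')
  show "summable (\<lambda>t. (norm (f t))\<^sup>2 + (norm (g t))\<^sup>2)" using assms by (rule summable_add)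
  fix t
  have "\<bar>f t \<bullet> g t\<bar> \<le> norm (f t) * norm (g t)" by (rule Cauchy_Schwarz_ineq2)
  also have "\<dots> \<le> (norm (f t))\<^sup>2 + (norm (g t))\<^sup>2"
    using sum_squares_bound[of "norm (f t)" "norm (g t)"] zero_le_power2[of "norm (f t)"] zero_le_power2[of "norm (g t)"]
    by linarith
  finally show "norm (f t \<bullet> g t) \<le> (norm (f t))\<^sup>2 + (norm (g t))\<^sup>2" by simp
qed

definition complex_vector :: "real^'n \<Rightarrow> complex^'n" where
  "complex_vector a = (\<chi> i. complex_of_real (a $ i))"

definition Re_vector :: "complex^'n \<Rightarrow> real^'n" where
  "Re_vector X = (\<chi> i. Re (X $ i))"

definition Im_vector :: "complex^'n \<Rightarrow> real^'n" where
  "Im_vector X = (\<chi> i. Im (X $ i))"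

lemma Re_Im_complex_matrix_mult:
  "Re_vector (complex_matrix M *v X) = M *v Re_vector X"
  "Im_vector (complex_matrix M *v X) = M *v Im_vector X"
  "Re_vector (Y v* complex_matrix M) = Re_vector Y v* M"
  "Im_vector (Y v* complex_matrix M) = Im_vector Y v* M"
  by (simp_all add: Re_vector_def Im_vector_def complex_matrix_def matrix_vector_mult_def vector_matrix_mult_def vec_eq_iff)

lemma iterate_complex_matrix:
  fixes M :: "real^'n^'n"
  shows "Re_vector (((*v) (complex_matrix M) ^^ i) X) = ((*v) M ^^ i) (Re_vector X)"
  "Im_vector (((*v) (complex_matrix M) ^^ i) X) = ((*v) M ^^ i) (Im_vector X)"
  by (induction i) (simp_all add: Re_Im_complex_matrix_mult)

lemma linear_Re_vector: "linear Re_vector"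
  by (rule linearI) (simp_all add: Re_vector_def vec_eq_iff)

lemma norm_Re_vector_le: "norm (Re_vector X) \<le> norm X"
  unfolding norm_vec_def Re_vector_def
  by (rule L2_set_mono) (simp_all add: abs_Re_le_cmod)

lemma norm_complex_vector: "norm (complex_vector a) = norm a"
  by (simp add: norm_vec_def complex_vector_def)

lemma Re_complex_vector: "Re_vector (complex_vector a) = a"
  by (simp add: Re_vector_def complex_vector_def vec_eq_iff)

text \<open>The low-energy feedback is complex, because it moves single eigenvalues. Its cost, the control energy plus a
small multiple of the state energy, is a form \<open>\<phi>\<close> on the complex states that satisfies a Bellman equation. The
least cost among the complex states with a given real part inherits it as an inequality, with the real
part of the control as a real control, as \<open>A\<close> and \<open>B\<close> are real. Bounding the best real control from below by
completing the square turns it into the inequality for \<open>P\<close>.\<close>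

theorem low_weight_lyapunov_matrix:
  fixes A :: "real^'n^'n" and B :: "real^'m^'n"
  assumes pbh: "hautus_stabilizable (complex_matrix A) (complex_matrix B)"
    and disc: "left_spectrum_in_disc (complex_matrix A)" and \<kappa>: "0 < \<kappa>"
  shows "\<exists>P \<epsilon>. 0 < \<epsilon> \<and> transpose P = P \<and>
    (\<forall>x. \<epsilon> * (norm x)\<^sup>2 \<le> x \<bullet> (P *v x) \<and> x \<bullet> (P *v x) \<le> \<kappa> * (norm x)\<^sup>2 \<and>
      (A *v x) \<bullet> (P *v (A *v x)) \<le> x \<bullet> (P *v x) - \<epsilon> * (norm x)\<^sup>2 + (norm (transpose B *v (P *v (A *v x))))\<^sup>2)"
proof -
  let ?A = "complex_matrix A" and ?B = "complex_matrix B"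
  obtain F :: "complex^'n^'m" where F: "left_stable (?A + ?B ** F) = UNIV"
    and en: "\<And>x T. (\<Sum>t<T. (norm (F *v (((*v) (?A + ?B ** F) ^^ t) x)))\<^sup>2) \<le> \<kappa> / 2 * (norm x)\<^sup>2"
    using low_energy_stabilization[OF pbh disc, of "\<kappa> / 2"] \<kappa> by auto
  define Ac where "Ac = ?A + ?B ** F"
  obtain K where K: "0 \<le> K" "\<And>x T. (\<Sum>t<T. (norm (((*v) Ac ^^ t) x))\<^sup>2) \<le> K * (norm x)\<^sup>2"
    using left_stable_UNIV_square_summable[OF F] unfolding Ac_def by blast
  define \<epsilon> where "\<epsilon> = \<kappa> / (2 * (K + 1))"
  have \<epsilon>: "0 < \<epsilon>" "\<epsilon> * K \<le> \<kappa> / 2"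
    using \<kappa> K(1) by (simp_all add: \<epsilon>_def field_simps)
  define x where "x t X = ((*v) Ac ^^ t) X" for t X
  define u where "u t X = F *v x t X" for t X
  have linx: "linear (x t)" for t
    by (rule linearI) (simp_all add: x_def of_real_smult iterate_mult_linear)
  have linu: "linear (u t)" for t
    using linear_compose[OF linx[of t] matrix_vector_mul_linear[of F]] by (simp add: u_def[abs_def] o_def)
  have sx: "summable (\<lambda>t. (norm (x t X))\<^sup>2)" for X
    by (rule summableI_nonneg_bounded[of _ "K * (norm X)\<^sup>2"]) (use K in \<open>auto simp: x_def\<close>)
  have su: "summable (\<lambda>t. (norm (u t X))\<^sup>2)" for X
    by (rule summableI_nonneg_bounded[of _ "\<kappa> / 2 * (norm X)\<^sup>2"]) (use en in \<open>auto simp: u_def x_def Ac_def\<close>)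
  define \<phi> where "\<phi> X Y = (\<Sum>t. u t X \<bullet> u t Y) + \<epsilon> * (\<Sum>t. x t X \<bullet> x t Y)" for X Y
  have six: "summable (\<lambda>t. x t X \<bullet> x t Y)" and siu: "summable (\<lambda>t. u t X \<bullet> u t Y)" for X Y
    by (rule summable_inner_of_squares[OF sx sx], rule summable_inner_of_squares[OF su su])
  have bil: "bilinear \<phi>"
    unfolding bilinear_def
  proof safe
    show "linear (\<phi> X)" for X
      unfolding \<phi>_def
      by (rule linearI)
        (simp_all add: linear_add[OF linx] linear_add[OF linu] linear_cmul[OF linx] linear_cmul[OF linu]
          inner_right_distrib six siu suminf_add[symmetric] suminf_mult algebra_simps)
    show "linear (\<lambda>X. \<phi> X Y)" for Y
      unfolding \<phi>_def
      by (rule linearI)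
        (simp_all add: linear_add[OF linx] linear_add[OF linu] linear_cmul[OF linx] linear_cmul[OF linu]
          inner_left_distrib six siu suminf_add[symmetric] suminf_mult algebra_simps)
  qed
  have sym: "\<phi> X Y = \<phi> Y X" for X Y by (simp add: \<phi>_def inner_commute)
  have bellman: "\<phi> X X = (norm (F *v X))\<^sup>2 + \<epsilon> * (norm X)\<^sup>2 + \<phi> (Ac *v X) (Ac *v X)" for X
  proof -
    have sh: "x (Suc t) X = x t (Ac *v X)" "u (Suc t) X = u t (Ac *v X)" for t
      by (simp_all add: u_def x_def funpow_swap1)
    have "(\<Sum>t. x t X \<bullet> x t X) = x 0 X \<bullet> x 0 X + (\<Sum>t. x (Suc t) X \<bullet> x (Suc t) X)"
      using suminf_split_head[OF six[of X X]] by simp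
    moreover have "(\<Sum>t. u t X \<bullet> u t X) = u 0 X \<bullet> u 0 X + (\<Sum>t. u (Suc t) X \<bullet> u (Suc t) X)"
      using suminf_split_head[OF siu[of X X]] by simp
    ultimately have "\<phi> X X = u 0 X \<bullet> u 0 X + \<epsilon> * (x 0 X \<bullet> x 0 X) + \<phi> (Ac *v X) (Ac *v X)"
      by (simp add: \<phi>_def sh algebra_simps)
    then show ?thesis by (simp add: u_def x_def power2_norm_eq_inner)
  qed
  have \<phi>0: "0 \<le> \<phi> X X" for X
    unfolding \<phi>_def using \<epsilon> by (intro add_nonneg_nonneg mult_nonneg_nonneg suminf_nonneg six siu) auto
  have low: "\<epsilon> * (norm X)\<^sup>2 \<le> \<phi> X X" for X
    using bellman[of X] \<phi>0[of "Ac *v X"] by simp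
  have up: "\<phi> X X \<le> \<kappa> * (norm X)\<^sup>2" for X
  proof -
    have "(\<Sum>t. u t X \<bullet> u t X) \<le> \<kappa> / 2 * (norm X)\<^sup>2"
      by (rule suminf_le_const[OF siu]) (use en in \<open>simp add: u_def x_def Ac_def power2_norm_eq_inner\<close>)
    moreover have "(\<Sum>t. x t X \<bullet> x t X) \<le> K * (norm X)\<^sup>2"
      by (rule suminf_le_const[OF six]) (use K in \<open>simp add: x_def power2_norm_eq_inner\<close>)
    then have "\<epsilon> * (\<Sum>t. x t X \<bullet> x t X) \<le> \<epsilon> * (K * (norm X)\<^sup>2)"
      using \<epsilon> by (intro mult_left_mono) auto
    moreover have "\<epsilon> * (K * (norm X)\<^sup>2) \<le> \<kappa> / 2 * (norm X)\<^sup>2"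
      using mult_right_mono[OF \<epsilon>(2), of "(norm X)\<^sup>2"] by (simp add: mult.assoc)
    ultimately show ?thesis by (simp add: \<phi>_def algebra_simps)
  qed
  have surj: "surj (Re_vector :: complex^'n \<Rightarrow> real^'n)"
    using Re_complex_vector by (metis surjI)
  have pos: "0 < \<phi> X X" if "X \<noteq> 0" for X
    using low[of X] \<epsilon> that by (smt (verit) mult_pos_pos zero_less_norm_iff zero_less_power)
  obtain T :: "real^'n \<Rightarrow> real^'n" where T: "linear T" "\<And>a b. a \<bullet> T b = T a \<bullet> b"
      "\<And>X. Re_vector X \<bullet> T (Re_vector X) \<le> \<phi> X X" "\<And>a. \<exists>X. Re_vector X = a \<and> a \<bullet> T a = \<phi> X X"
    using bilinear_form_pushforward[OF bil sym pos linear_Re_vector surj] by metis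
  define P where "P = matrix T"
  have P: "P *v a = T a" for a
    using T(1) by (simp add: P_def matrix_works)
  have "transpose P = P"
  proof -
    have "(P *v a) \<bullet> b = (transpose P *v a) \<bullet> b" for a b
      using T(2)[of a b] by (simp add: P dot_lmul_matrix)
    then have "P *v a = transpose P *v a" for a
      by (metis inner_commute vector_eq_rdot)
    then show ?thesis by (metis matrix_eq)
  qed
  moreover have "\<epsilon> * (norm a)\<^sup>2 \<le> a \<bullet> (P *v a)" for a
  proof -
    obtain X where X: "Re_vector X = a" "a \<bullet> T a = \<phi> X X" using T(4) by blast
    have "(norm a)\<^sup>2 \<le> (norm X)\<^sup>2" using norm_Re_vector_le[of X] X by (auto intro: power_mono)
    then have "\<epsilon> * (norm a)\<^sup>2 \<le> \<epsilon> * (norm X)\<^sup>2" using \<epsilon> by simp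
    then show ?thesis using X low[of X] by (simp add: P)
  qed
  moreover have "a \<bullet> (P *v a) \<le> \<kappa> * (norm a)\<^sup>2" for a
    using T(3)[of "complex_vector a"] up[of "complex_vector a"]
    by (simp add: P Re_complex_vector norm_complex_vector)
  moreover have "(A *v a) \<bullet> (P *v (A *v a)) \<le> a \<bullet> (P *v a) - \<epsilon> * (norm a)\<^sup>2 + (norm (transpose B *v (P *v (A *v a))))\<^sup>2" for a
  proof -
    obtain X where X: "Re_vector X = a" "a \<bullet> T a = \<phi> X X" using T(4) by blast
    define v where "v = Re_vector (F *v X)"
    define z where "z = A *v a"
    define b where "b = B *v v"
    define q where "q = transpose B *v (P *v z)"
    have "Re_vector (Ac *v X) = z + b"
      by (simp add: Ac_def matrix_vector_mult_add_rdistrib linear_add[OF linear_Re_vector]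
          matrix_vector_mul_assoc[symmetric] Re_Im_complex_matrix_mult X z_def b_def v_def)
    then have 1: "(z + b) \<bullet> T (z + b) \<le> \<phi> (Ac *v X) (Ac *v X)" using T(3)[of "Ac *v X"] by simp
    have "norm v \<le> norm (F *v X)" by (simp add: v_def norm_Re_vector_le)
    then have 2: "(norm v)\<^sup>2 \<le> (norm (F *v X))\<^sup>2" by (intro power_mono) auto
    have "(norm a)\<^sup>2 \<le> (norm X)\<^sup>2" using norm_Re_vector_le[of X] X by (auto intro: power_mono)
    then have 3: "\<epsilon> * (norm a)\<^sup>2 \<le> \<epsilon> * (norm X)\<^sup>2" using \<epsilon> by simp
    have "0 \<le> b \<bullet> T b" using T(4)[of b] \<phi>0 by metis
    moreover have "(z + b) \<bullet> T (z + b) = z \<bullet> T z + 2 * (b \<bullet> T z) + b \<bullet> T b"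
      using T(2)[of b z] by (simp add: linear_add[OF T(1)] inner_left_distrib inner_right_distrib inner_commute)
    moreover have "b \<bullet> T z = v \<bullet> q"
      using dot_lmul_matrix[of "T z" B v] by (simp add: b_def q_def P inner_commute)
    moreover have "0 \<le> (norm (v + q))\<^sup>2" by simp
    then have "- (norm q)\<^sup>2 \<le> (norm v)\<^sup>2 + 2 * (v \<bullet> q)"
      by (simp add: power2_norm_eq_inner inner_left_distrib inner_right_distrib inner_commute)
    ultimately have "z \<bullet> T z - (norm q)\<^sup>2 \<le> a \<bullet> T a - \<epsilon> * (norm a)\<^sup>2"
      using 1 2 3 bellman[of X] X by linarith
    then show ?thesis by (simp add: P z_def q_def)
  qed
  ultimately show ?thesis using \<epsilon>(1) by blast
qed

section \<open>The leader-follower Laplacian\<close>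

text \<open>The Laplacian of the graph without the row and the column of the leader; the degrees still count the
edges from the leader.\<close>

definition leader_laplacian :: "('N::finite option \<times> 'N option) set \<Rightarrow> ('N option \<Rightarrow> 'N option \<Rightarrow> real) \<Rightarrow> real^'N^'N" where
  "leader_laplacian Ed a = (\<chi> i j.
     (if i = j then \<Sum>k\<in>neighbors Ed (Some i). a (Some i) k else 0)
     - (if Some j \<in> neighbors Ed (Some i) then a (Some i) (Some j) else 0))"

text \<open>The leader does not appear on the right because its value is normalized to zero; this is the form of
both sums over neighbors in the closed loop.\<close>

lemma sum_neighbors_eq_laplacian:
  fixes g :: "'N::finite option \<Rightarrow> 'v::real_vector"
  assumes "g None = 0"
  shows "(\<Sum>k\<in>neighbors Ed (Some i). a (Some i) k *\<^sub>R (g (Some i) - g k))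
    = (\<Sum>j\<in>UNIV. leader_laplacian Ed a $ i $ j *\<^sub>R g (Some j))"
proof -
  let ?n = "neighbors Ed (Some i)" and ?a = "a (Some i)"
  have "(\<Sum>k\<in>?n. ?a k *\<^sub>R g k) = (\<Sum>k\<in>UNIV. if k \<in> ?n then ?a k *\<^sub>R g k else 0)"
    by (simp add: sum.If_cases)
  also have "\<dots> = (\<Sum>j\<in>UNIV. if Some j \<in> ?n then ?a (Some j) *\<^sub>R g (Some j) else 0)"
    using assms by (simp add: UNIV_option_conv sum.reindex)
  finally have "(\<Sum>k\<in>?n. ?a k *\<^sub>R g k) = (\<Sum>j\<in>UNIV. (if Some j \<in> ?n then ?a (Some j) else 0) *\<^sub>R g (Some j))"
    by (simp add: if_distrib[of "\<lambda>c. c *\<^sub>R _"] cong: if_cong)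
  moreover have "(\<Sum>j\<in>UNIV. (if i = j then \<Sum>k\<in>?n. ?a k else 0) *\<^sub>R g (Some j)) = (\<Sum>k\<in>?n. ?a k *\<^sub>R g (Some i))"
    by (simp add: if_distrib[of "\<lambda>c. c *\<^sub>R _"] scaleR_sum_left cong: if_cong)
  ultimately show ?thesis
    by (simp add: leader_laplacian_def scaleR_diff_left scaleR_diff_right sum_subtractf)
qed

lemma neighbor_weight_pos:
  "weighted_adjacency Ed a \<Longrightarrow> k \<in> neighbors Ed i \<Longrightarrow> 0 < a i k"
  by (simp add: weighted_adjacency_def neighbors_def)

lemma laplacian_minimum_principle:
  fixes x :: "real^'N::finite"
  assumes adj: "weighted_adjacency Ed a" and reach: "\<And>v. (None, v) \<in> Ed\<^sup>*"
    and nonneg: "\<And>i. 0 \<le> (leader_laplacian Ed a *v x) $ i"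
  shows "0 \<le> x $ i"
proof -
  define g where "g v = (case v of None \<Rightarrow> 0 | Some i \<Rightarrow> x $ i)" for v
  define m where "m = Min (range g)"
  have m: "m \<le> g v" for v by (simp add: m_def)
  have "0 \<le> m"
  proof (rule ccontr)
    assume neg: "\<not> 0 \<le> m"
    \<comment> \<open>a negative minimum spreads backwards along the edges, up to the leader\<close>
    have backwards: "g u = m" if e: "(u, v) \<in> Ed" and v: "g v = m" for u v
    proof -
      obtain i where i: "v = Some i" using v neg by (cases v) (auto simp: g_def)
      have "(\<Sum>k\<in>neighbors Ed (Some i). a (Some i) k * (g k - m))
          = - (\<Sum>k\<in>neighbors Ed (Some i). a (Some i) k *\<^sub>R (g (Some i) - g k))"
        using v by (simp add: i algebra_simps sum_subtractf)
      also have "\<dots> = - (leader_laplacian Ed a *v x) $ i"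
        by (subst sum_neighbors_eq_laplacian) (simp_all add: g_def matrix_vector_mult_def)
      finally have "(\<Sum>k\<in>neighbors Ed (Some i). a (Some i) k * (g k - m)) = - (leader_laplacian Ed a *v x) $ i" .
      then have "(\<Sum>k\<in>neighbors Ed (Some i). a (Some i) k * (g k - m)) \<le> 0" using nonneg[of i] by simp
      moreover have nn: "0 \<le> a (Some i) k * (g k - m)" if "k \<in> neighbors Ed (Some i)" for k
        using m[of k] neighbor_weight_pos[OF adj that] by simp
      ultimately have "(\<Sum>k\<in>neighbors Ed (Some i). a (Some i) k * (g k - m)) = 0"
        by (meson antisym sum_nonneg)
      moreover have u: "u \<in> neighbors Ed (Some i)" using e by (simp add: i neighbors_def)
      ultimately have "a (Some i) u * (g u - m) = 0"
        using nn by (subst (asm) sum_nonneg_eq_0_iff) auto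
      then show ?thesis using neighbor_weight_pos[OF adj u] by simp
    qed
    have "m \<in> range g" unfolding m_def by (rule Min_in) auto
    then obtain v where "g v = m" by auto
    with reach[of v] have "g None = m"
      by (induction rule: rtrancl_induct) (use backwards in auto)
    then show False using neg by (simp add: g_def)
  qed
  then show ?thesis using m[of "Some i"] by (simp add: g_def)
qed

lemma laplacian_invertible:
  assumes "weighted_adjacency Ed a" "\<And>v. (None, v) \<in> Ed\<^sup>*"
  shows "invertible (leader_laplacian Ed a)"
proof -
  have "x = 0" if "leader_laplacian Ed a *v x = 0" for x
  proof -
    have "leader_laplacian Ed a *v (- x) = 0"
      using that matrix_vector_mult_diff_distrib[of "leader_laplacian Ed a" 0 x] by simp
    then have "0 \<le> x $ i \<and> 0 \<le> (- x) $ i" for i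
      using laplacian_minimum_principle[OF assms, of x i] laplacian_minimum_principle[OF assms, of "- x" i] that
      by simp
    then show ?thesis by (simp add: vec_eq_iff antisym)
  qed
  then show ?thesis
    by (simp add: invertible_left_inverse matrix_left_invertible_ker)
qed

text \<open>By the minimum principle the inverse of the Laplacian is nonnegative, and \<open>d $ j\<close> is its \<open>j\<close>-th column sum.\<close>

lemma laplacian_positive_weights:
  assumes "weighted_adjacency Ed a" "\<And>v. (None, v) \<in> Ed\<^sup>*"
  obtains d where "d v* leader_laplacian Ed a = vec 1" "\<And>i. 0 < d $ i"
proof -
  let ?H = "leader_laplacian Ed a"
  from laplacian_invertible[OF assms] obtain J where J: "?H ** J = mat 1" "J ** ?H = mat 1"
    unfolding invertible_def by blast
  define d where "d = vec 1 v* J"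
  have d: "d v* ?H = vec 1" by (simp add: d_def vector_matrix_mul_assoc J)
  have "0 < d $ j" for j
  proof -
    define x where "x = J *v axis j 1"
    have Hx: "?H *v x = axis j 1" by (simp add: x_def matrix_vector_mul_assoc J)
    have x0: "0 \<le> x $ i" for i
      by (rule laplacian_minimum_principle[OF assms]) (simp add: Hx axis_def)
    have "x \<noteq> 0" using Hx by auto
    then obtain i where "0 < x $ i" using x0 by (metis less_eq_real_def vec_eq_iff zero_index)
    then have "0 < (\<Sum>i\<in>UNIV. x $ i)" by (intro sum_pos2[of _ i]) (use x0 in auto)
    also have "(\<Sum>i\<in>UNIV. x $ i) = (d v* ?H) \<bullet> x" by (simp add: d inner_vec_def)
    also have "\<dots> = d $ j" by (simp add: dot_lmul_matrix Hx inner_axis)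
    finally show ?thesis .
  qed
  then show thesis using d that by blast
qed

text \<open>Along each edge \<open>q\<^sub>i \<bullet> (q\<^sub>i - q\<^sub>k)\<close> is at least half of \<open>\<bar>q\<^sub>i\<bar>\<^sup>2 - \<bar>q\<^sub>k\<bar>\<^sup>2\<close>. So the sum dominates half of
\<open>d\<^sup>T H\<close> applied to the squares, and \<open>d\<close> was chosen to make \<open>d\<^sup>T H\<close> constant.\<close>

lemma laplacian_weighted_coercive:
  fixes q :: "'N::finite \<Rightarrow> 'v::real_inner"
  assumes adj: "weighted_adjacency Ed a" and d: "d v* leader_laplacian Ed a = vec 1" "\<And>i. 0 < d $ i"
  shows "(\<Sum>i\<in>UNIV. (norm (q i))\<^sup>2) / 2
    \<le> (\<Sum>i\<in>UNIV. d $ i * (q i \<bullet> (\<Sum>j\<in>UNIV. leader_laplacian Ed a $ i $ j *\<^sub>R q j)))"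
proof -
  let ?H = "leader_laplacian Ed a"
  define g where "g v = (case v of None \<Rightarrow> 0 | Some i \<Rightarrow> q i)" for v
  have "(\<Sum>j\<in>UNIV. ?H $ i $ j * (norm (q j))\<^sup>2) / 2 \<le> q i \<bullet> (\<Sum>j\<in>UNIV. ?H $ i $ j *\<^sub>R q j)" for i
  proof -
    let ?n = "neighbors Ed (Some i)"
    have "(\<Sum>j\<in>UNIV. ?H $ i $ j * (norm (q j))\<^sup>2) / 2
        = (\<Sum>k\<in>?n. a (Some i) k * (((norm (q i))\<^sup>2 - (norm (g k))\<^sup>2) / 2))"
      using sum_neighbors_eq_laplacian[where g = "\<lambda>v. (norm (g v))\<^sup>2" and Ed = Ed and a = a and i = i] by (simp add: g_def flip: sum_divide_distrib)
    also have "\<dots> \<le> (\<Sum>k\<in>?n. a (Some i) k * (q i \<bullet> (q i - g k)))"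
    proof (intro sum_mono mult_left_mono)
      fix k assume "k \<in> ?n"
      then show "0 \<le> a (Some i) k" using neighbor_weight_pos[OF adj] by force
      show "((norm (q i))\<^sup>2 - (norm (g k))\<^sup>2) / 2 \<le> q i \<bullet> (q i - g k)"
        using inner_ge_zero[of "q i - g k"]
        by (simp add: power2_norm_eq_inner inner_diff_left inner_diff_right inner_commute)
    qed
    also have "\<dots> = q i \<bullet> (\<Sum>k\<in>?n. a (Some i) k *\<^sub>R (g (Some i) - g k))"
      by (simp add: inner_sum_right g_def)
    also have "\<dots> = q i \<bullet> (\<Sum>j\<in>UNIV. ?H $ i $ j *\<^sub>R q j)"
      by (subst sum_neighbors_eq_laplacian) (simp_all add: g_def)
    finally show ?thesis .
  qed
  then have "(\<Sum>i\<in>UNIV. d $ i * ((\<Sum>j\<in>UNIV. ?H $ i $ j * (norm (q j))\<^sup>2) / 2))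
      \<le> (\<Sum>i\<in>UNIV. d $ i * (q i \<bullet> (\<Sum>j\<in>UNIV. ?H $ i $ j *\<^sub>R q j)))"
    using d(2) by (intro sum_mono mult_left_mono) (auto intro: less_imp_le)
  moreover have "(\<Sum>i\<in>UNIV. d $ i * ((\<Sum>j\<in>UNIV. ?H $ i $ j * (norm (q j))\<^sup>2) / 2))
      = (\<Sum>j\<in>UNIV. (d v* ?H) $ j * (norm (q j))\<^sup>2) / 2"
    by (simp add: vector_matrix_mult_def sum_divide_distrib sum_distrib_left sum_distrib_right mult_ac)
       (rule sum.swap)
  ultimately show ?thesis by (simp add: d)
qed

section \<open>Low gain tolerates delay\<close>

text \<open>A Lyapunov-Krasovskii argument: past values of \<open>Q\<close> are charged to \<open>V\<close> with weights \<open>g s\<close> that satisfy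
\<open>\<theta> + g (s + 1) = g s / 2\<close> and vanish at \<open>s = r\<close>; the smallness of \<open>\<theta>\<close> keeps the first weight below one.\<close>

lemma delayed_decay:
  fixes V Q :: "nat \<Rightarrow> real"
  assumes V: "\<And>t. 0 \<le> V t" and Q: "\<And>t. 0 \<le> Q t"
    and step: "\<And>t. r \<le> t \<Longrightarrow> V (Suc t) \<le> \<rho> * V t - Q t + \<theta> * (\<Sum>s<r. Q (t - Suc s))"
    and \<rho>: "1 / 2 \<le> \<rho>" and \<theta>: "0 \<le> \<theta>" "\<theta> * 2 ^ Suc r \<le> 1" and t: "r \<le> t"
  shows "V t \<le> \<rho> ^ (t - r) * (V r + (\<Sum>s<r. Q (r - Suc s)))"
proof -
  define g where "g s = 2 * \<theta> * (2 ^ (r - s) - 1)" for s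
  define W where "W t = V t + (\<Sum>s<r. g s * Q (t - Suc s))" for t
  have g0: "0 \<le> g s" for s using \<theta>(1) by (simp add: g_def)
  have g1: "g s \<le> 1" for s
  proof -
    have "g s \<le> 2 * \<theta> * 2 ^ r"
      unfolding g_def using \<theta>(1) power_increasing[of "r - s" r "2::real"]
      by (intro mult_left_mono) (linarith | simp)+
    then show ?thesis using \<theta>(2) by simp
  qed
  have g_rec: "\<theta> + g (Suc s) \<le> \<rho> * g s" if "s < r" for s
  proof -
    have "(2::real) ^ (r - s) = 2 * 2 ^ (r - Suc s)"
      using that by (metis Suc_diff_Suc power_Suc)
    then have "\<theta> + g (Suc s) = 1 / 2 * g s" by (simp add: g_def algebra_simps)
    also have "\<dots> \<le> \<rho> * g s" by (rule mult_right_mono[OF \<rho> g0])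
    finally show ?thesis .
  qed
  have W_step: "W (Suc t) \<le> \<rho> * W t" if "r \<le> t" for t
  proof -
    have "(\<Sum>s<r. g s * Q (t - s)) = (\<Sum>s<Suc r. g s * Q (t - s))" by (simp add: g_def)
    also have "\<dots> = g 0 * Q t + (\<Sum>s<r. g (Suc s) * Q (t - Suc s))"
      by (subst sum.lessThan_Suc_shift) simp
    finally have "W (Suc t) = V (Suc t) + g 0 * Q t + (\<Sum>s<r. g (Suc s) * Q (t - Suc s))"
      by (simp add: W_def)
    also have "\<dots> \<le> \<rho> * V t - Q t + \<theta> * (\<Sum>s<r. Q (t - Suc s)) + 1 * Q t + (\<Sum>s<r. g (Suc s) * Q (t - Suc s))"
      by (intro add_mono step that mult_right_mono g1 Q order_refl)
    also have "\<dots> = \<rho> * V t + (\<Sum>s<r. (\<theta> + g (Suc s)) * Q (t - Suc s))"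
      by (simp add: sum_distrib_left sum.distrib algebra_simps)
    also have "\<dots> \<le> \<rho> * V t + (\<Sum>s<r. (\<rho> * g s) * Q (t - Suc s))"
      by (intro add_left_mono sum_mono mult_right_mono g_rec Q) simp
    also have "\<dots> = \<rho> * W t" by (simp add: W_def sum_distrib_left algebra_simps)
    finally show ?thesis .
  qed
  have "W t \<le> \<rho> ^ (t - r) * W r"
    using t
  proof (induction t rule: dec_induct)
    case (step n)
    have "W (Suc n) \<le> \<rho> * W n" by (rule W_step) fact
    also have "\<dots> \<le> \<rho> * (\<rho> ^ (n - r) * W r)" using step \<rho> by (intro mult_left_mono) auto
    finally show ?case using step by (simp add: Suc_diff_le)
  qed simp
  moreover have "V t \<le> W t" by (simp add: W_def sum_nonneg g0 Q)
  moreover have "W r \<le> V r + (\<Sum>s<r. 1 * Q (r - Suc s))"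
    unfolding W_def by (intro add_left_mono sum_mono mult_right_mono g1 Q)
  then have "\<rho> ^ (t - r) * W r \<le> \<rho> ^ (t - r) * (V r + (\<Sum>s<r. Q (r - Suc s)))"
    using \<rho> by (intro mult_left_mono) auto
  ultimately show ?thesis by linarith
qed

lemma delay_growth_bound:
  fixes e :: "int \<Rightarrow> real"
  assumes e: "\<And>t. 0 \<le> e t" and step: "\<And>t. 0 \<le> t \<Longrightarrow> e (t + 1) \<le> G * (e t + e (t - int r))"
    and G: "1 \<le> G" and s: "- int r \<le> s" "s \<le> int n"
  shows "e s \<le> (2 * G) ^ n * (\<Sum>u\<in>{- int r..0}. e u)"
  using s
proof (induction n arbitrary: s)
  case 0
  have "e s \<le> (\<Sum>u\<in>{- int r..0}. e u)"
    by (rule member_le_sum) (use 0 e in auto)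
  then show ?case by simp
next
  case (Suc n)
  let ?h = "\<Sum>u\<in>{- int r..0}. e u"
  have h: "0 \<le> (2 * G) ^ n * ?h" using G e by (simp add: sum_nonneg)
  show ?case
  proof (cases "s \<le> int n")
    case True
    then have "e s \<le> (2 * G) ^ n * ?h" using Suc by blast
    also have "\<dots> \<le> (2 * G) * ((2 * G) ^ n * ?h)" using mult_right_mono[OF _ h, of 1 "2 * G"] G by simp
    finally show ?thesis by (simp add: mult.assoc)
  next
    case False
    then have s: "s = int n + 1" using Suc.prems by simp
    have "e s \<le> G * (e (int n) + e (int n - int r))" unfolding s by (rule step) simp
    also have "\<dots> \<le> G * ((2 * G) ^ n * ?h + (2 * G) ^ n * ?h)"
      using G by (intro mult_left_mono add_mono Suc.IH) auto
    finally show ?thesis by (simp add: algebra_simps)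
  qed
qed

lemma matrix_vector_bound:
  fixes M :: "real^'n^'m"
  obtains b where "0 < b" "\<And>x. norm (M *v x) \<le> b * norm x"
  using linear_bounded_pos[OF matrix_vector_mul_linear[of M]] by metis

text \<open>Polarization: the form is evaluated at \<open>x \<plusminus> y\<close> for the multiple \<open>y\<close> of \<open>P x\<close> with the norm of \<open>x\<close>.\<close>

lemma norm_symmetric_form_bound:
  fixes P :: "real^'n^'n"
  assumes sym: "transpose P = P" and P: "\<And>x. 0 \<le> x \<bullet> (P *v x)" "\<And>x. x \<bullet> (P *v x) \<le> \<kappa> * (norm x)\<^sup>2"
  shows "norm (P *v x) \<le> \<kappa> * norm x"
proof (cases "P *v x = 0 \<or> x = 0")
  case True
  have "0 \<le> \<kappa> * norm x"
  proof (cases "x = 0")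
    case False
    then have "0 \<le> \<kappa> * (norm x)\<^sup>2" using P[of x] by linarith
    then show ?thesis using False by (simp add: zero_le_mult_iff)
  qed simp
  then show ?thesis using True by auto
next
  case False
  define c where "c = norm x / norm (P *v x)"
  define y where "y = c *\<^sub>R (P *v x)"
  have ny: "norm y = norm x" using False by (simp add: y_def c_def)
  have xPy: "x \<bullet> (P *v y) = y \<bullet> (P *v x)"
    using dot_lmul_matrix[of x P y] sym by (metis inner_commute transpose_matrix_vector)
  have "4 * (y \<bullet> (P *v x)) = (x + y) \<bullet> (P *v (x + y)) - (x - y) \<bullet> (P *v (x - y))"
    by (simp add: matrix_vector_right_distrib matrix_vector_mult_diff_distrib inner_left_distrib inner_right_distrib
        inner_diff_left inner_diff_right xPy)
  also have "\<dots> \<le> \<kappa> * (norm (x + y))\<^sup>2 - 0"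
    by (intro diff_mono P)
  also have "\<dots> \<le> \<kappa> * (norm x + norm y)\<^sup>2"
  proof -
    have "0 < (norm x)\<^sup>2" using False by simp
    moreover have "0 \<le> \<kappa> * (norm x)\<^sup>2" using P[of x] by linarith
    ultimately have "0 \<le> \<kappa>" by (simp add: zero_le_mult_iff)
    then show ?thesis by (auto intro!: mult_left_mono power_mono norm_triangle_ineq)
  qed
  also have "\<dots> = 4 * (\<kappa> * norm x * norm x)" by (simp add: ny power2_eq_square algebra_simps)
  also have "y \<bullet> (P *v x) = norm x * norm (P *v x)"
    using False by (simp add: y_def c_def power2_norm_eq_inner[symmetric] power2_eq_square)
  finally have "norm x * norm (P *v x) \<le> norm x * (\<kappa> * norm x)" by (simp add: mult_ac)
  then show ?thesis using False by simp
qed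

lemma variation_of_constants:
  fixes A :: "real^'s^'s" and \<xi> :: "int \<Rightarrow> real^'s"
  assumes "\<And>t. 0 \<le> t \<Longrightarrow> \<xi> (t + 1) = A *v \<xi> t + w t" "int n \<le> t"
  shows "\<xi> t = ((*v) A ^^ n) (\<xi> (t - int n)) + (\<Sum>s<n. ((*v) A ^^ s) (w (t - 1 - int s)))"
  using assms(2)
proof (induction n)
  case (Suc n)
  let ?it = "\<lambda>n. ((*v) A ^^ n)"
  have "\<xi> (t - int n) = A *v \<xi> (t - 1 - int n) + w (t - 1 - int n)"
    using assms(1)[of "t - 1 - int n"] Suc.prems by (simp add: algebra_simps)
  then have "?it n (\<xi> (t - int n)) = ?it (Suc n) (\<xi> (t - int (Suc n))) + ?it n (w (t - 1 - int n))"
    by (simp add: iterate_mult_linear funpow_swap1 algebra_simps)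
  then show ?case using Suc by simp
qed simp

lemma norm_iterate_bound:
  fixes A :: "real^'s^'s"
  assumes "\<And>x. norm (A *v x) \<le> c * norm x" "0 \<le> c"
  shows "norm (((*v) A ^^ n) x) \<le> c ^ n * norm x"
proof (induction n)
  case (Suc n)
  have "norm (((*v) A ^^ Suc n) x) \<le> c * norm (((*v) A ^^ n) x)" using assms(1) by simp
  also have "\<dots> \<le> c * (c ^ n * norm x)" by (intro mult_left_mono Suc assms)
  finally show ?case by (simp add: mult.assoc)
qed simp

lemma norm_sum_squared_le:
  fixes f :: "nat \<Rightarrow> 'v::real_normed_vector"
  shows "(norm (\<Sum>s<r. f s))\<^sup>2 \<le> real r * (\<Sum>s<r. (norm (f s))\<^sup>2)"
proof -
  have "(norm (\<Sum>s<r. f s))\<^sup>2 \<le> (\<Sum>s<r. norm (f s))\<^sup>2"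
    by (intro power_mono norm_sum) simp
  also have "\<dots> \<le> (\<Sum>s<r. (norm (f s))\<^sup>2) * real (card {..<r})"
    by (rule sum_squared_le_sum_of_squares)
  finally show ?thesis by (simp add: mult.commute)
qed

lemma sum_norm_squared_mix_le:
  fixes H :: "real^'N^'N" and z :: "'N::finite \<Rightarrow> 'v::real_normed_vector"
  shows "(\<Sum>i\<in>UNIV. (norm (\<Sum>j\<in>UNIV. H $ i $ j *\<^sub>R z j))\<^sup>2)
    \<le> (\<Sum>i\<in>UNIV. \<Sum>j\<in>UNIV. (H $ i $ j)\<^sup>2) * (\<Sum>j\<in>UNIV. (norm (z j))\<^sup>2)"
  unfolding sum_distrib_right[of _ UNIV]
proof (rule sum_mono)
  fix i
  have "(norm (\<Sum>j\<in>UNIV. H $ i $ j *\<^sub>R z j))\<^sup>2 \<le> (\<Sum>j\<in>UNIV. \<bar>H $ i $ j\<bar> * norm (z j))\<^sup>2"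
    by (intro power_mono order.trans[OF norm_sum]) simp_all
  also have "\<dots> \<le> (\<Sum>j\<in>UNIV. \<bar>H $ i $ j\<bar>\<^sup>2) * (\<Sum>j\<in>UNIV. (norm (z j))\<^sup>2)"
    by (rule Cauchy_Schwarz_ineq_sum)
  finally show "(norm (\<Sum>j\<in>UNIV. H $ i $ j *\<^sub>R z j))\<^sup>2 \<le> (\<Sum>j\<in>UNIV. (H $ i $ j)\<^sup>2 * (\<Sum>j\<in>UNIV. (norm (z j))\<^sup>2))"
    by (simp add: sum_distrib_right)
qed

text \<open>The gain \<open>\<mu>\<close> is large enough for the coupling through \<open>H\<close> to outweigh the indefinite term \<open>\<bar>q\<bar>\<^sup>2\<close> of the
Lyapunov inequality, with \<open>2 \<bar>qh\<bar>\<^sup>2\<close> to spare. The vector \<open>\<delta>\<close> is the part of \<open>q\<close> that the input misses; it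
enters only through its norm.\<close>

lemma high_gain_coupling_estimate:
  fixes H :: "real^'N^'N" and d :: "real^'N" and qh \<delta> :: "'N::finite \<Rightarrow> 'v::real_inner"
  assumes d0: "\<And>i. 0 \<le> d $ i" and dD: "\<And>i. d $ i \<le> D" and D0: "0 \<le> D"
    and coercive: "(\<Sum>i\<in>UNIV. (norm (qh i))\<^sup>2) / 2
      \<le> (\<Sum>i\<in>UNIV. d $ i * (qh i \<bullet> (\<Sum>j\<in>UNIV. H $ i $ j *\<^sub>R qh j)))"
  defines "\<mu> \<equiv> 2 * D + 3" and "cH \<equiv> \<Sum>i\<in>UNIV. \<Sum>j\<in>UNIV. (H $ i $ j)\<^sup>2"
  shows "(\<Sum>i\<in>UNIV. d $ i * (norm (qh i + \<delta> i))\<^sup>2)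
      + 2 * (\<Sum>i\<in>UNIV. d $ i * ((- \<mu> *\<^sub>R (\<Sum>j\<in>UNIV. H $ i $ j *\<^sub>R qh j)) \<bullet> (qh i + \<delta> i)))
    \<le> - 2 * (\<Sum>i\<in>UNIV. (norm (qh i))\<^sup>2) + (2 * D + \<mu>\<^sup>2 * D\<^sup>2 * cH) * (\<Sum>i\<in>UNIV. (norm (\<delta> i))\<^sup>2)"
proof -
  define q where "q i = qh i + \<delta> i" for i
  define z where "z i = (\<Sum>j\<in>UNIV. H $ i $ j *\<^sub>R qh j)" for i
  define U where "U i = - \<mu> *\<^sub>R z i" for i
  define Q where "Q = (\<Sum>i\<in>UNIV. (norm (qh i))\<^sup>2)"
  define \<Delta> where "\<Delta> = (\<Sum>i\<in>UNIV. (norm (\<delta> i))\<^sup>2)"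
  have \<mu>0: "0 \<le> \<mu>" using D0 by (simp add: \<mu>_def)
  have cH0: "0 \<le> cH" by (simp add: cH_def sum_nonneg)
  have Q0: "0 \<le> Q" by (simp add: Q_def sum_nonneg)
  have zQ: "(\<Sum>i\<in>UNIV. (norm (z i))\<^sup>2) \<le> cH * Q"
    unfolding z_def Q_def cH_def by (rule sum_norm_squared_mix_le)
  have T2: "(\<Sum>i\<in>UNIV. d $ i * (norm (q i))\<^sup>2) \<le> 2 * D * Q + 2 * D * \<Delta>"
  proof -
    have "d $ i * (norm (q i))\<^sup>2 \<le> D * (2 * (norm (qh i))\<^sup>2 + 2 * (norm (\<delta> i))\<^sup>2)" for i
    proof (intro mult_mono dD)
      have "norm (q i) \<le> norm (qh i) + norm (\<delta> i)"
        unfolding q_def by (rule norm_triangle_ineq)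
      then have "(norm (q i))\<^sup>2 \<le> (norm (qh i) + norm (\<delta> i))\<^sup>2" by (intro power_mono) auto
      also have "\<dots> \<le> 2 * (norm (qh i))\<^sup>2 + 2 * (norm (\<delta> i))\<^sup>2"
        using zero_le_power2[of "norm (qh i) - norm (\<delta> i)"] by (simp add: power2_eq_square algebra_simps)
      finally show "(norm (q i))\<^sup>2 \<le> \<dots>" .
    qed (use D0 in auto)
    then have "(\<Sum>i\<in>UNIV. d $ i * (norm (q i))\<^sup>2) \<le> (\<Sum>i\<in>UNIV. D * (2 * (norm (qh i))\<^sup>2 + 2 * (norm (\<delta> i))\<^sup>2))"
      by (rule sum_mono)
    also have "\<dots> = 2 * D * Q + 2 * D * \<Delta>"
      by (simp add: Q_def \<Delta>_def sum.distrib sum_distrib_left algebra_simps)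
    finally show ?thesis .
  qed
  have T3: "2 * (\<Sum>i\<in>UNIV. d $ i * (U i \<bullet> q i)) \<le> - \<mu> * Q + Q + \<mu>\<^sup>2 * D\<^sup>2 * cH * \<Delta>"
  proof -
    have "(\<Sum>i\<in>UNIV. d $ i * (U i \<bullet> q i))
        = - \<mu> * (\<Sum>i\<in>UNIV. d $ i * (qh i \<bullet> z i)) - \<mu> * (\<Sum>i\<in>UNIV. d $ i * (z i \<bullet> \<delta> i))"
      by (simp add: U_def q_def inner_add_right inner_commute[of "qh _"] sum_distrib_left sum.distrib
          sum_subtractf sum_negf algebra_simps)
    moreover have "Q / 2 \<le> (\<Sum>i\<in>UNIV. d $ i * (qh i \<bullet> z i))"
      unfolding Q_def z_def by (rule coercive)
    then have "\<mu> * (Q / 2) \<le> \<mu> * (\<Sum>i\<in>UNIV. d $ i * (qh i \<bullet> z i))"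
      using \<mu>0 by (intro mult_left_mono) auto
    \<comment> \<open>Young's inequality with the weight \<open>cH\<close>, as \<open>\<bar>z\<bar>\<^sup>2 \<le> cH Q\<close>\<close>
    moreover have "- 2 * \<mu> * (\<Sum>i\<in>UNIV. d $ i * (z i \<bullet> \<delta> i)) \<le> Q + \<mu>\<^sup>2 * D\<^sup>2 * cH * \<Delta>"
    proof (cases "cH = 0")
      case True
      have "(\<Sum>i\<in>UNIV. (norm (z i))\<^sup>2) \<le> 0" using zQ True by simp
      then have "(\<Sum>i\<in>UNIV. (norm (z i))\<^sup>2) = 0" by (simp add: antisym sum_nonneg)
      then have "z i = 0" for i by (simp add: sum_nonneg_eq_0_iff)
      then show ?thesis using True Q0 by simp
    next
      case False
      then have cH: "0 < cH" using cH0 by simp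
      have "- 2 * \<mu> * (d $ i * (z i \<bullet> \<delta> i)) \<le> (norm (z i))\<^sup>2 / cH + \<mu>\<^sup>2 * D\<^sup>2 * cH * (norm (\<delta> i))\<^sup>2" for i
      proof -
        have "- (z i \<bullet> \<delta> i) \<le> norm (z i) * norm (\<delta> i)"
          using norm_cauchy_schwarz[of "z i" "- \<delta> i"] by simp
        then have "d $ i * (- (z i \<bullet> \<delta> i)) \<le> D * (norm (z i) * norm (\<delta> i))"
          using d0[of i] dD[of i] by (meson mult_left_mono mult_nonneg_nonneg mult_right_mono norm_ge_zero order_trans)
        then have "2 * \<mu> * (d $ i * (- (z i \<bullet> \<delta> i))) \<le> 2 * \<mu> * (D * (norm (z i) * norm (\<delta> i)))"
          using \<mu>0 by (intro mult_left_mono) auto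
        also have "\<dots> \<le> (norm (z i))\<^sup>2 / cH + \<mu>\<^sup>2 * D\<^sup>2 * cH * (norm (\<delta> i))\<^sup>2"
        proof -
          have "(norm (z i))\<^sup>2 / cH + \<mu>\<^sup>2 * D\<^sup>2 * cH * (norm (\<delta> i))\<^sup>2 - 2 * \<mu> * (D * (norm (z i) * norm (\<delta> i)))
              = (norm (z i) - \<mu> * D * cH * norm (\<delta> i))\<^sup>2 / cH"
            using cH by (simp add: power2_eq_square field_simps)
          moreover have "\<dots> \<ge> 0" using cH by simp
          ultimately show ?thesis by linarith
        qed
        finally show ?thesis by (simp add: mult_ac)
      qed
      then have "(\<Sum>i\<in>UNIV. - 2 * \<mu> * (d $ i * (z i \<bullet> \<delta> i)))
          \<le> (\<Sum>i\<in>UNIV. (norm (z i))\<^sup>2 / cH + \<mu>\<^sup>2 * D\<^sup>2 * cH * (norm (\<delta> i))\<^sup>2)"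
        by (rule sum_mono)
      then have "- 2 * \<mu> * (\<Sum>i\<in>UNIV. d $ i * (z i \<bullet> \<delta> i))
          \<le> (\<Sum>i\<in>UNIV. (norm (z i))\<^sup>2) / cH + \<mu>\<^sup>2 * D\<^sup>2 * cH * \<Delta>"
        by (simp only: sum_distrib_left \<Delta>_def sum.distrib sum_divide_distrib)
      moreover have "(\<Sum>i\<in>UNIV. (norm (z i))\<^sup>2) / cH \<le> Q"
        using zQ cH by (simp add: field_simps)
      ultimately show ?thesis by linarith
    qed
    ultimately show ?thesis by linarith
  qed
  have "2 * D * Q + (- \<mu> * Q + Q) = - 2 * Q" by (simp add: \<mu>_def algebra_simps)
  moreover have "2 * D * \<Delta> + \<mu>\<^sup>2 * D\<^sup>2 * cH * \<Delta> = (2 * D + \<mu>\<^sup>2 * D\<^sup>2 * cH) * \<Delta>" by (simp add: algebra_simps)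
  ultimately show ?thesis using T2 T3 unfolding q_def U_def z_def Q_def \<Delta>_def by linarith
qed

text \<open>The Lyapunov function is \<open>V = \<Sum>\<^sub>i d\<^sub>i \<xi>\<^sub>i\<^sup>T P \<xi>\<^sub>i\<close>. Let \<open>q\<^sub>i = B\<^sup>T P A \<xi>\<^sub>i(t)\<close>, and let \<open>qh\<^sub>i\<close> be the same with
\<open>\<xi>\<^sub>i(t)\<close> replaced by the prediction \<open>A\<^sup>r \<xi>\<^sub>i(t - r)\<close>, so that the inputs are \<open>- \<mu> H qh\<close>. Along a trajectory \<open>V\<close>
changes by at most \<open>- \<epsilon> \<bar>\<xi>\<bar>\<^sup>2 + \<bar>q\<bar>\<^sup>2 - \<mu> \<bar>qh\<bar>\<^sup>2\<close>, with the weights \<open>d\<close> suppressed, up to terms that are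
small with \<open>P\<close>: the quadratic term in the input, and the prediction error \<open>\<delta> = q - qh\<close>, which is a
combination of the inputs over the last \<open>r\<close> steps with coefficients of order \<open>\<kappa>\<close>. So \<open>\<mu>\<close> is fixed first,
large against the weights, and then \<open>\<kappa>\<close>, small against everything else.\<close>

theorem low_gain_network_stabilization:
  fixes A :: "real^'s^'s" and B :: "real^'m^'s" and H :: "real^'N^'N" and d :: "real^'N" and r :: nat
  assumes pbh: "hautus_stabilizable (complex_matrix A) (complex_matrix B)"
    and disc: "left_spectrum_in_disc (complex_matrix A)"
    and d: "\<And>i. 0 < d $ i"
    and coercive: "\<And>q :: 'N \<Rightarrow> real^'m. (\<Sum>i\<in>UNIV. (norm (q i))\<^sup>2) / 2
      \<le> (\<Sum>i\<in>UNIV. d $ i * (q i \<bullet> (\<Sum>j\<in>UNIV. H $ i $ j *\<^sub>R q j)))"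
  shows "\<exists>(K :: real^'s^'m) M \<rho>. 0 < M \<and> 0 < \<rho> \<and> \<rho> < 1 \<and>
    (\<forall>\<xi> :: int \<Rightarrow> 'N \<Rightarrow> real^'s.
      (\<forall>t\<ge>0. \<forall>i. \<xi> (t + 1) i = A *v \<xi> t i + B *v (\<Sum>j\<in>UNIV. H $ i $ j *\<^sub>R (K *v \<xi> (t - int r) j))) \<longrightarrow>
      (\<forall>t :: nat. (\<Sum>i\<in>UNIV. (norm (\<xi> (int t) i))\<^sup>2)
        \<le> M * \<rho> ^ t * (\<Sum>s\<in>{- int r..0}. \<Sum>i\<in>UNIV. (norm (\<xi> s i))\<^sup>2)))"
proof -
  obtain b1 where b1: "0 < b1" "\<And>x. norm (B *v x) \<le> b1 * norm x" by (rule matrix_vector_bound[of B]) blast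
  obtain b2 where b2: "0 < b2" "\<And>x. norm (transpose B *v x) \<le> b2 * norm x" by (rule matrix_vector_bound[of "transpose B"]) blast
  obtain c0 where c0: "0 < c0" "\<And>x. norm (A *v x) \<le> c0 * norm x" by (rule matrix_vector_bound[of A]) blast
  define c where "c = max 1 c0"
  have c: "1 \<le> c" "norm (A *v x) \<le> c * norm x" for x
    using c0(2)[of x] mult_right_mono[of c0 c "norm x"] by (auto simp: c_def)
  define \<alpha> where "\<alpha> = c ^ Suc r"
  have \<alpha>: "norm (((*v) A ^^ n) x) \<le> \<alpha> * norm x" if "n \<le> Suc r" for n x
  proof -
    have "norm (((*v) A ^^ n) x) \<le> c ^ n * norm x" by (rule norm_iterate_bound) (use c in auto)
    also have "\<dots> \<le> \<alpha> * norm x" unfolding \<alpha>_def using that c by (intro mult_right_mono power_increasing) auto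
    finally show ?thesis .
  qed
  have \<alpha>1: "1 \<le> \<alpha>" using c by (simp add: \<alpha>_def one_le_power del: power_Suc)
  define D where "D = (\<Sum>i\<in>UNIV. d $ i)"
  have dD: "d $ i \<le> D" for i unfolding D_def by (rule member_le_sum) (use d in \<open>auto intro: less_imp_le\<close>)
  have D0: "0 < D" using d dD by (meson less_le_trans)
  define dm where "dm = Min (range (($) d))"
  have dm: "dm \<le> d $ i" for i by (simp add: dm_def)
  have dm0: "0 < dm" using d by (simp add: dm_def)
  define cH where "cH = (\<Sum>i\<in>UNIV. \<Sum>j\<in>UNIV. (H $ i $ j)\<^sup>2)"
  have cH0: "0 \<le> cH" by (simp add: cH_def sum_nonneg)
  define \<mu> where "\<mu> = 2 * D + 3"
  define C0 where "C0 = b1\<^sup>2 * D * \<mu>\<^sup>2 * cH"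
  define C1 where "C1 = 2 * D + \<mu>\<^sup>2 * D\<^sup>2 * cH"
  define C2 where "C2 = real r * (b2 * \<alpha> * b1)\<^sup>2 * (\<mu>\<^sup>2 * cH)"
  have C: "0 \<le> C0" "0 \<le> C1" "0 \<le> C2" using D0 cH0 by (simp_all add: C0_def C1_def C2_def)
  define C3 where "C3 = C0 + C1 * C2 * 2 ^ Suc r + 1"
  have C3: "1 \<le> C3" "C0 \<le> C3" "C1 * C2 * 2 ^ Suc r \<le> C3"
    using C by (simp_all add: C3_def del: power_Suc)
  define \<kappa> where "\<kappa> = 1 / C3"
  have \<kappa>: "0 < \<kappa>" "\<kappa> \<le> 1" "\<kappa> * C0 \<le> 1" "\<kappa> * (C1 * C2 * 2 ^ Suc r) \<le> 1"
    using C3 by (simp_all add: \<kappa>_def field_simps del: power_Suc)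
  obtain P \<epsilon> where \<epsilon>: "0 < \<epsilon>" and symP: "transpose P = P"
    and P_low: "\<And>x. \<epsilon> * (norm x)\<^sup>2 \<le> x \<bullet> (P *v x)" and P_up: "\<And>x. x \<bullet> (P *v x) \<le> \<kappa> * (norm x)\<^sup>2"
    and P_A: "\<And>x. (A *v x) \<bullet> (P *v (A *v x)) \<le> x \<bullet> (P *v x) - \<epsilon> * (norm x)\<^sup>2
      + (norm (transpose B *v (P *v (A *v x))))\<^sup>2"
    using low_weight_lyapunov_matrix[OF pbh disc \<kappa>(1)] by metis
  have P0: "0 \<le> x \<bullet> (P *v x)" for x
    using P_low[of x] \<epsilon> by (smt (verit) mult_nonneg_nonneg zero_le_power2)
  have nP: "norm (P *v x) \<le> \<kappa> * norm x" for x
    by (rule norm_symmetric_form_bound[OF symP P0 P_up])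
  define L where "L x = transpose B *v (P *v (A *v x))" for x
  have linL: "linear L"
    unfolding L_def by (rule linearI) (simp_all add: matrix_vector_right_distrib matrix_vector_mult_scaleR)
  define K where "K = matrix (\<lambda>x. - \<mu> *\<^sub>R L (((*v) A ^^ r) x))"
  have lin_it: "linear ((*v) A ^^ r)"
    by (rule linearI) (simp_all add: iterate_mult_linear flip: scalar_mult_eq_scaleR)
  have "linear (\<lambda>x. - \<mu> *\<^sub>R L (((*v) A ^^ r) x))"
    by (rule linearI) (simp_all add: linear_add[OF lin_it] linear_cmul[OF lin_it] linear_add[OF linL]
        linear_cmul[OF linL] scaleR_right_distrib mult.commute)
  then have K: "K *v x = - \<mu> *\<^sub>R L (((*v) A ^^ r) x)" for x
    by (simp add: K_def matrix_works)
  \<comment> \<open>kept above \<open>1 / 2\<close> because the weights for the delayed terms halve in every step\<close>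
  define \<rho> where "\<rho> = 1 - min (1 / 2) (\<epsilon> * dm / D)"
  have \<rho>: "1 / 2 \<le> \<rho>" "\<rho> < 1" using \<epsilon> dm0 D0 by (auto simp: \<rho>_def min_def)
  have \<rho>D: "(1 - \<rho>) * D \<le> \<epsilon> * dm" using D0 by (simp add: \<rho>_def min_def field_simps)
  define \<theta> where "\<theta> = C1 * (\<kappa>\<^sup>2 * C2)"
  have \<theta>: "0 \<le> \<theta>" "\<theta> * 2 ^ Suc r \<le> 1"
  proof -
    have "\<theta> * 2 ^ Suc r = \<kappa> * (\<kappa> * (C1 * C2 * 2 ^ Suc r))" by (simp add: \<theta>_def power2_eq_square)
    also have "\<dots> \<le> 1 * 1" by (intro mult_mono \<kappa>) (use \<kappa> C in auto)
    finally show "\<theta> * 2 ^ Suc r \<le> 1" by simp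
  qed (use C in \<open>simp add: \<theta>_def\<close>)
  have nL: "norm (L x) \<le> b2 * \<kappa> * norm (A *v x)" for x
  proof -
    have "norm (L x) \<le> b2 * norm (P *v (A *v x))" unfolding L_def by (rule b2)
    also have "\<dots> \<le> b2 * (\<kappa> * norm (A *v x))" using b2 by (intro mult_left_mono nP) auto
    finally show ?thesis by (simp add: mult.assoc)
  qed
  define cq where "cq = (b2 * \<kappa> * \<alpha>)\<^sup>2"
  define G where "G = 1 + 2 * c\<^sup>2 + 2 * (b1\<^sup>2 * (\<mu>\<^sup>2 * cH * cq))"
  have G1: "1 \<le> G" using cH0 by (simp add: G_def cq_def)
  define C4 where "C4 = (D * (2 * G) ^ r + real r * cq)"
  have C4: "0 < C4"
    unfolding C4_def using D0 G1 by (intro add_pos_nonneg mult_pos_pos) (auto simp: cq_def)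
  define M where "M = (C4 / (\<epsilon> * dm) + (2 * G) ^ r) / \<rho> ^ r"
  have M0: "0 < M"
    unfolding M_def using C4 \<epsilon> dm0 G1 \<rho> by (intro divide_pos_pos add_pos_pos) auto
  have main: "(\<Sum>i\<in>UNIV. (norm (\<xi> (int t) i))\<^sup>2)
        \<le> M * \<rho> ^ t * (\<Sum>s\<in>{- int r..0}. \<Sum>i\<in>UNIV. (norm (\<xi> s i))\<^sup>2)"
    if \<xi>: "\<And>t i. 0 \<le> t \<Longrightarrow> \<xi> (t + 1) i = A *v \<xi> t i + B *v (\<Sum>j\<in>UNIV. H $ i $ j *\<^sub>R (K *v \<xi> (t - int r) j))"
    for \<xi> :: "int \<Rightarrow> 'N \<Rightarrow> real^'s" and t :: nat
  proof -
    define E where "E t = (\<Sum>i\<in>UNIV. (norm (\<xi> t i))\<^sup>2)" for t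
    define qh where "qh t i = L (((*v) A ^^ r) (\<xi> (t - int r) i))" for t i
    define q where "q t i = L (\<xi> t i)" for t i
    define Q where "Q t = (\<Sum>i\<in>UNIV. (norm (qh t i))\<^sup>2)" for t
    define V where "V t = (\<Sum>i\<in>UNIV. d $ i * (\<xi> t i \<bullet> (P *v \<xi> t i)))" for t
    define U where "U t i = (\<Sum>j\<in>UNIV. H $ i $ j *\<^sub>R (K *v \<xi> (t - int r) j))" for t i
    define z where "z t i = (\<Sum>j\<in>UNIV. H $ i $ j *\<^sub>R qh t j)" for t i
    have U: "U t i = - \<mu> *\<^sub>R z t i" for t i
      by (simp add: U_def z_def K qh_def scaleR_sum_right mult.commute flip: sum_negf)
    have E0: "0 \<le> E t" and Q0: "0 \<le> Q t" for t by (simp_all add: E_def Q_def sum_nonneg)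
    have zQ: "(\<Sum>i\<in>UNIV. (norm (z t i))\<^sup>2) \<le> cH * Q t" for t
      unfolding z_def Q_def cH_def by (rule sum_norm_squared_mix_le)
    have UQ: "(\<Sum>i\<in>UNIV. (norm (U t i))\<^sup>2) \<le> \<mu>\<^sup>2 * cH * Q t" for t
    proof -
      have "(\<Sum>i\<in>UNIV. (norm (U t i))\<^sup>2) = \<mu>\<^sup>2 * (\<Sum>i\<in>UNIV. (norm (z t i))\<^sup>2)"
        by (simp add: U power_mult_distrib sum_distrib_left)
      also have "\<dots> \<le> \<mu>\<^sup>2 * (cH * Q t)" by (intro mult_left_mono zQ) simp
      finally show ?thesis by (simp add: mult.assoc)
    qed
    have QE: "Q t \<le> cq * E (t - int r)" for t
    proof -
      have "(norm (qh t i))\<^sup>2 \<le> cq * (norm (\<xi> (t - int r) i))\<^sup>2" for i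
      proof -
        let ?x = "\<xi> (t - int r) i"
        have "norm (qh t i) \<le> b2 * \<kappa> * norm (((*v) A ^^ Suc r) ?x)"
          unfolding qh_def using nL[of "((*v) A ^^ r) ?x"] by simp
        also have "\<dots> \<le> b2 * \<kappa> * (\<alpha> * norm ?x)"
          using b2 \<kappa> by (intro mult_left_mono \<alpha>) auto
        finally have "(norm (qh t i))\<^sup>2 \<le> (b2 * \<kappa> * \<alpha> * norm ?x)\<^sup>2"
          by (intro power_mono) (auto simp: mult.assoc)
        then show ?thesis by (simp add: cq_def power_mult_distrib)
      qed
      then show ?thesis unfolding Q_def E_def sum_distrib_left by (rule sum_mono)
    qed
    have step\<xi>: "\<xi> (t + 1) i = A *v \<xi> t i + B *v U t i" if "0 \<le> t" for t i
      using \<xi>[OF that] by (simp add: U_def)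
    have growth: "E (t + 1) \<le> G * (E t + E (t - int r))" if "0 \<le> t" for t
    proof -
      have "(norm (\<xi> (t + 1) i))\<^sup>2 \<le> 2 * c\<^sup>2 * (norm (\<xi> t i))\<^sup>2 + 2 * b1\<^sup>2 * (norm (U t i))\<^sup>2" for i
      proof -
        have "norm (\<xi> (t + 1) i) \<le> c * norm (\<xi> t i) + b1 * norm (U t i)"
          unfolding step\<xi>[OF that] by (intro order.trans[OF norm_triangle_ineq] add_mono c b1)
        then have "(norm (\<xi> (t + 1) i))\<^sup>2 \<le> (c * norm (\<xi> t i) + b1 * norm (U t i))\<^sup>2" by (intro power_mono) auto
        also have "\<dots> \<le> 2 * c\<^sup>2 * (norm (\<xi> t i))\<^sup>2 + 2 * b1\<^sup>2 * (norm (U t i))\<^sup>2"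
          using zero_le_power2[of "c * norm (\<xi> t i) - b1 * norm (U t i)"] by (simp add: power2_eq_square algebra_simps)
        finally show ?thesis .
      qed
      then have "E (t + 1) \<le> (\<Sum>i\<in>UNIV. 2 * c\<^sup>2 * (norm (\<xi> t i))\<^sup>2 + 2 * b1\<^sup>2 * (norm (U t i))\<^sup>2)"
        unfolding E_def by (rule sum_mono)
      also have "\<dots> = 2 * c\<^sup>2 * E t + 2 * b1\<^sup>2 * (\<Sum>i\<in>UNIV. (norm (U t i))\<^sup>2)"
        by (simp add: E_def sum.distrib sum_distrib_left)
      also have "\<dots> \<le> 2 * c\<^sup>2 * E t + 2 * b1\<^sup>2 * (\<mu>\<^sup>2 * cH * (cq * E (t - int r)))"
        using cH0 by (intro add_left_mono mult_left_mono order.trans[OF UQ] QE) auto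
      also have "\<dots> \<le> G * E t + G * E (t - int r)"
        using cH0 by (intro add_mono) (auto simp: G_def cq_def E0 algebra_simps)
      finally show ?thesis by (simp add: algebra_simps)
    qed
    define h where "h = (\<Sum>s\<in>{- int r..0}. E s)"
    have Eh: "E s \<le> (2 * G) ^ n * h" if "- int r \<le> s" "s \<le> int n" for s n
      unfolding h_def by (rule delay_growth_bound[OF E0 growth G1 that])
    have h0: "0 \<le> h" by (simp add: h_def sum_nonneg E0)
    have V_low: "\<epsilon> * dm * E t \<le> V t" for t
      unfolding V_def E_def sum_distrib_left
    proof (rule sum_mono)
      fix i
      have "dm * (\<epsilon> * (norm (\<xi> t i))\<^sup>2) \<le> d $ i * (\<xi> t i \<bullet> (P *v \<xi> t i))"
        by (intro mult_mono dm P_low) (use d \<epsilon> in \<open>auto intro: less_imp_le\<close>)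
      then show "\<epsilon> * dm * (norm (\<xi> t i))\<^sup>2 \<le> d $ i * (\<xi> t i \<bullet> (P *v \<xi> t i))" by (simp add: mult_ac)
    qed
    have V0: "0 \<le> V t" for t unfolding V_def using d P0 by (intro sum_nonneg mult_nonneg_nonneg) (auto intro: less_imp_le)
    have V_up: "V t \<le> D * E t" for t
      unfolding V_def E_def sum_distrib_left
    proof (rule sum_mono)
      fix i
      have "\<xi> t i \<bullet> (P *v \<xi> t i) \<le> 1 * (norm (\<xi> t i))\<^sup>2"
        by (rule order.trans[OF P_up mult_right_mono[OF \<kappa>(2)]]) simp
      then show "d $ i * (\<xi> t i \<bullet> (P *v \<xi> t i)) \<le> D * (norm (\<xi> t i))\<^sup>2"
        using D0 by (intro mult_mono dD) (auto simp: P0)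
    qed
    have V_step: "V (t + 1) \<le> \<rho> * V t - Q t + \<theta> * (\<Sum>s<r. Q (t - 1 - int s))" if t: "int r \<le> t" for t
    proof -
      have t0: "0 \<le> t" using t by linarith
      define \<delta> where "\<delta> i = q t i - qh t i" for i
      have \<delta>: "\<delta> i = (\<Sum>s<r. L (((*v) A ^^ s) (B *v U (t - 1 - int s) i)))" for i
      proof -
        have "\<xi> t i = ((*v) A ^^ r) (\<xi> (t - int r) i) + (\<Sum>s<r. ((*v) A ^^ s) (B *v U (t - 1 - int s) i))"
          using variation_of_constants[of "\<lambda>t. \<xi> t i" A "\<lambda>t. B *v U t i" r t] step\<xi> t by blast
        then show ?thesis
          by (simp add: \<delta>_def q_def qh_def linear_add[OF linL] linear_sum[OF linL])
      qed
      define \<Delta> where "\<Delta> = (\<Sum>i\<in>UNIV. (norm (\<delta> i))\<^sup>2)"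
      have \<Delta>: "\<Delta> \<le> \<kappa>\<^sup>2 * C2 * (\<Sum>s<r. Q (t - 1 - int s))"
      proof -
        let ?k = "(b2 * \<kappa> * \<alpha> * b1)\<^sup>2"
        have each: "(norm (L (((*v) A ^^ s) (B *v U \<tau> i))))\<^sup>2 \<le> ?k * (norm (U \<tau> i))\<^sup>2" if "s < r" for s \<tau> i
        proof -
          have "norm (L (((*v) A ^^ s) (B *v U \<tau> i))) \<le> b2 * \<kappa> * norm (((*v) A ^^ Suc s) (B *v U \<tau> i))"
            using nL[of "((*v) A ^^ s) (B *v U \<tau> i)"] by simp
          also have "\<dots> \<le> b2 * \<kappa> * (\<alpha> * norm (B *v U \<tau> i))"
            using b2 \<kappa> that by (intro mult_left_mono \<alpha>) auto
          also have "\<dots> \<le> b2 * \<kappa> * (\<alpha> * (b1 * norm (U \<tau> i)))"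
            using b2 \<kappa> \<alpha>1 by (intro mult_left_mono b1) auto
          finally have "(norm (L (((*v) A ^^ s) (B *v U \<tau> i))))\<^sup>2 \<le> (b2 * \<kappa> * \<alpha> * b1 * norm (U \<tau> i))\<^sup>2"
            by (intro power_mono) (auto simp: mult.assoc)
          then show ?thesis by (simp add: power_mult_distrib)
        qed
        have "\<Delta> \<le> (\<Sum>i\<in>UNIV. real r * (\<Sum>s<r. ?k * (norm (U (t - 1 - int s) i))\<^sup>2))"
          unfolding \<Delta>_def \<delta>
          by (intro sum_mono order.trans[OF norm_sum_squared_le] mult_left_mono each) auto
        also have "\<dots> = real r * ?k * (\<Sum>s<r. \<Sum>i\<in>UNIV. (norm (U (t - 1 - int s) i))\<^sup>2)"
          by (simp add: sum_distrib_left mult.assoc) (rule sum.swap)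
        also have "\<dots> \<le> real r * ?k * (\<Sum>s<r. \<mu>\<^sup>2 * cH * Q (t - 1 - int s))"
          by (intro mult_left_mono sum_mono UQ) auto
        also have "\<dots> = \<kappa>\<^sup>2 * C2 * (\<Sum>s<r. Q (t - 1 - int s))"
          by (simp add: C2_def sum_distrib_left[symmetric] power_mult_distrib mult_ac)
        finally show ?thesis .
      qed
      have node: "\<xi> (t + 1) i \<bullet> (P *v \<xi> (t + 1) i) \<le> \<xi> t i \<bullet> (P *v \<xi> t i) - \<epsilon> * (norm (\<xi> t i))\<^sup>2
          + (norm (q t i))\<^sup>2 + 2 * (U t i \<bullet> q t i) + \<kappa> * b1\<^sup>2 * (norm (U t i))\<^sup>2" for i
      proof -
        define y where "y = A *v \<xi> t i"
        define u where "u = B *v U t i"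
        have uPy: "u \<bullet> (P *v y) = U t i \<bullet> q t i"
          using dot_lmul_matrix[of "P *v y" B "U t i"] by (simp add: u_def q_def L_def y_def inner_commute)
        have yPu: "y \<bullet> (P *v u) = u \<bullet> (P *v y)"
          using dot_lmul_matrix[of y P u] symP by (metis inner_commute transpose_matrix_vector)
        have "(norm u)\<^sup>2 \<le> (b1 * norm (U t i))\<^sup>2" unfolding u_def by (intro power_mono b1) auto
        then have "u \<bullet> (P *v u) \<le> \<kappa> * (b1 * norm (U t i))\<^sup>2"
          using \<kappa> by (intro order.trans[OF P_up] mult_left_mono) auto
        moreover have "y \<bullet> (P *v y) \<le> \<xi> t i \<bullet> (P *v \<xi> t i) - \<epsilon> * (norm (\<xi> t i))\<^sup>2 + (norm (q t i))\<^sup>2"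
          unfolding y_def q_def L_def by (rule P_A)
        ultimately show ?thesis
          unfolding step\<xi>[OF t0] y_def[symmetric] u_def[symmetric]
          by (simp add: matrix_vector_right_distrib inner_left_distrib inner_right_distrib yPu uPy power_mult_distrib)
      qed
      have "V (t + 1) \<le> (\<Sum>i\<in>UNIV. d $ i * (\<xi> t i \<bullet> (P *v \<xi> t i) - \<epsilon> * (norm (\<xi> t i))\<^sup>2
          + (norm (q t i))\<^sup>2 + 2 * (U t i \<bullet> q t i) + \<kappa> * b1\<^sup>2 * (norm (U t i))\<^sup>2))"
        unfolding V_def by (intro sum_mono mult_left_mono node) (use d in \<open>auto intro: less_imp_le\<close>)
      also have "\<dots> = V t - \<epsilon> * (\<Sum>i\<in>UNIV. d $ i * (norm (\<xi> t i))\<^sup>2) + (\<Sum>i\<in>UNIV. d $ i * (norm (q t i))\<^sup>2)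
          + 2 * (\<Sum>i\<in>UNIV. d $ i * (U t i \<bullet> q t i)) + \<kappa> * b1\<^sup>2 * (\<Sum>i\<in>UNIV. d $ i * (norm (U t i))\<^sup>2)"
        by (simp add: V_def sum.distrib sum_subtractf sum_distrib_left algebra_simps)
      finally have V1: "V (t + 1) \<le> \<dots>" .
      \<comment> \<open>the terms of the increment of \<open>V\<close>; the coupling leaves \<open>- 2 * Q t\<close>, of which the input term takes half\<close>
      have T1: "\<epsilon> * dm * E t \<le> \<epsilon> * (\<Sum>i\<in>UNIV. d $ i * (norm (\<xi> t i))\<^sup>2)"
        unfolding E_def mult.assoc sum_distrib_left[of dm] using \<epsilon>
        by (intro mult_left_mono sum_mono mult_right_mono dm) auto
      have T23: "(\<Sum>i\<in>UNIV. d $ i * (norm (q t i))\<^sup>2) + 2 * (\<Sum>i\<in>UNIV. d $ i * (U t i \<bullet> q t i))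
          \<le> - 2 * Q t + C1 * \<Delta>"
        using high_gain_coupling_estimate[where qh = "qh t" and \<delta> = \<delta>, OF less_imp_le[OF d] dD less_imp_le[OF D0] coercive]
        by (simp add: U z_def \<delta>_def Q_def \<Delta>_def C1_def cH_def \<mu>_def)
      have T4: "\<kappa> * b1\<^sup>2 * (\<Sum>i\<in>UNIV. d $ i * (norm (U t i))\<^sup>2) \<le> Q t"
      proof -
        have "(\<Sum>i\<in>UNIV. d $ i * (norm (U t i))\<^sup>2) \<le> D * (\<Sum>i\<in>UNIV. (norm (U t i))\<^sup>2)"
          unfolding sum_distrib_left by (intro sum_mono mult_right_mono dD) simp
        also have "\<dots> \<le> D * (\<mu>\<^sup>2 * cH * Q t)" using D0 by (intro mult_left_mono UQ) auto
        finally have "\<kappa> * b1\<^sup>2 * (\<Sum>i\<in>UNIV. d $ i * (norm (U t i))\<^sup>2) \<le> \<kappa> * b1\<^sup>2 * (D * (\<mu>\<^sup>2 * cH * Q t))"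
          using \<kappa> by (intro mult_left_mono) auto
        also have "\<dots> = (\<kappa> * C0) * Q t" by (simp add: C0_def mult_ac)
        also have "\<dots> \<le> 1 * Q t" by (intro mult_right_mono \<kappa> Q0)
        finally show ?thesis by simp
      qed
      have T5: "C1 * \<Delta> \<le> \<theta> * (\<Sum>s<r. Q (t - 1 - int s))"
        using mult_left_mono[OF \<Delta> C(2)] by (simp add: \<theta>_def mult.assoc)
      have "V t - \<epsilon> * dm * E t \<le> \<rho> * V t"
      proof -
        have "(1 - \<rho>) * V t \<le> (1 - \<rho>) * (D * E t)" using \<rho> by (intro mult_left_mono V_up) auto
        also have "\<dots> \<le> \<epsilon> * dm * E t" using mult_right_mono[OF \<rho>D E0[of t]] by (simp add: mult.assoc)
        finally show ?thesis by (simp add: algebra_simps)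
      qed
      then show ?thesis using V1 T1 T23 T4 T5 by linarith
    qed
    have V_decay: "V (int n) \<le> \<rho> ^ (n - r) * (V (int r) + (\<Sum>s<r. Q (int (r - Suc s))))" if "r \<le> n" for n
    proof (rule delayed_decay[where V = "\<lambda>n. V (int n)" and Q = "\<lambda>n. Q (int n)" and \<theta> = \<theta>, OF V0 Q0 _ \<rho>(1) \<theta> that])
      fix n assume n: "r \<le> n"
      have "(\<Sum>s<r. Q (int n - 1 - int s)) = (\<Sum>s<r. Q (int (n - Suc s)))"
        using n by (intro sum.cong) (auto simp: of_nat_diff algebra_simps)
      then show "V (int (Suc n)) \<le> \<rho> * V (int n) - Q (int n) + \<theta> * (\<Sum>s<r. Q (int (n - Suc s)))"
        using V_step[of "int n"] n by (simp add: add.commute)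
    qed
    have init: "V (int r) + (\<Sum>s<r. Q (int (r - Suc s))) \<le> C4 * h"
    proof -
      have "V (int r) \<le> D * ((2 * G) ^ r * h)"
        using D0 by (intro order.trans[OF V_up] mult_left_mono Eh) auto
      moreover have "Q (int (r - Suc s)) \<le> cq * h" if "s < r" for s
      proof -
        have "E (int (r - Suc s) - int r) \<le> h" using Eh[of "int (r - Suc s) - int r" 0] that by simp
        then show ?thesis by (intro order.trans[OF QE] mult_left_mono) (auto simp: cq_def)
      qed
      then have "(\<Sum>s<r. Q (int (r - Suc s))) \<le> (\<Sum>s<r. cq * h)" by (intro sum_mono) auto
      ultimately show ?thesis by (simp add: C4_def algebra_simps)
    qed
    have "E (int t) \<le> M * \<rho> ^ t * h"
    proof (cases "r \<le> t")
      case True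
      have "\<epsilon> * dm * E (int t) \<le> \<rho> ^ (t - r) * (C4 * h)"
        by (rule order.trans[OF V_low order.trans[OF V_decay[OF True] mult_left_mono[OF init]]]) (use \<rho> in auto)
      then have "E (int t) \<le> \<rho> ^ (t - r) * (C4 / (\<epsilon> * dm)) * h"
        using \<epsilon> dm0 by (simp add: field_simps)
      also have "\<rho> ^ (t - r) = \<rho> ^ t / \<rho> ^ r"
        using True \<rho> by (simp add: power_diff)
      also have "\<rho> ^ t / \<rho> ^ r * (C4 / (\<epsilon> * dm)) * h \<le> \<rho> ^ t / \<rho> ^ r * (C4 / (\<epsilon> * dm) + (2 * G) ^ r) * h"
        using \<rho> G1 h0 by (intro mult_right_mono mult_left_mono) auto
      finally show ?thesis by (simp add: M_def mult_ac)
    next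
      case False
      have "E (int t) \<le> (2 * G) ^ r * h" using False by (intro Eh) auto
      also have "\<dots> \<le> (\<rho> ^ t / \<rho> ^ r) * ((2 * G) ^ r * h)"
      proof -
        have "\<rho> ^ r \<le> \<rho> ^ t" using False \<rho> by (intro power_decreasing) auto
        then have "1 \<le> \<rho> ^ t / \<rho> ^ r" using \<rho> by (simp add: field_simps)
        then show ?thesis using mult_right_mono[of 1 "\<rho> ^ t / \<rho> ^ r" "(2 * G) ^ r * h"] G1 h0 by simp
      qed
      also have "\<dots> \<le> (\<rho> ^ t / \<rho> ^ r) * ((C4 / (\<epsilon> * dm) + (2 * G) ^ r) * h)"
        using \<rho> C4 \<epsilon> dm0 h0 by (intro mult_right_mono mult_left_mono) auto
      finally show ?thesis by (simp add: M_def mult_ac)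
    qed
    then show ?thesis by (simp add: E_def h_def)
  qed
  have "0 < \<rho>" using \<rho> by linarith
  then show ?thesis
    using M0 \<rho>(2) main by (intro exI[of _ K] exI[of _ M] exI[of _ \<rho>] conjI allI impI) blast+
qed

section \<open>Delay systems: existence and perturbation\<close>

lemma delay_trajectory_exists:
  fixes f :: "'x \<Rightarrow> 'x \<Rightarrow> 'x" and h :: "int \<Rightarrow> 'x"
  obtains X where "\<And>t. t \<le> 0 \<Longrightarrow> X t = h t" "\<And>t. 0 \<le> t \<Longrightarrow> X (t + 1) = f (X t) (X (t - int r))"
proof -
  define ext where "ext n g = g(int n + 1 := f (g (int n)) (g (int n - int r)))" for n and g :: "int \<Rightarrow> 'x"
  define H where "H = rec_nat h ext"
  have H: "H 0 = h" "H (Suc n) = ext n (H n)" for n by (simp_all add: H_def)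
  have keep: "H (n + m) t = H n t" if "t \<le> int n" for n m t
    using that by (induction m) (auto simp: H ext_def)
  define X where "X t = H (nat t) t" for t
  have X: "X t = H n t" if "t \<le> int n" for n t
  proof -
    have "H (nat t + (n - nat t)) t = H (nat t) t" by (rule keep) simp
    then show ?thesis using that by (simp add: X_def nat_le_iff)
  qed
  show thesis
  proof
    show "X t = h t" if "t \<le> 0" for t using that X[of t 0] by (simp add: H)
    show "X (t + 1) = f (X t) (X (t - int r))" if "0 \<le> t" for t
    proof -
      obtain n where n: "t = int n" by (rule nonneg_int_cases[OF \<open>0 \<le> t\<close>])
      have "X (t + 1) = H (Suc n) (int n + 1)" using X[of "t + 1" "Suc n"] by (simp add: n)
      also have "\<dots> = f (H n (int n)) (H n (int n - int r))" by (simp add: H ext_def)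
      finally show ?thesis using X[of "int n" n] X[of "int n - int r" n] by (simp add: n)
    qed
  qed
qed

text \<open>Over a block of \<open>T\<close> steps a perturbed trajectory stays close to the nominal one with the same initial
history. If \<open>T\<close> is so long that nominal trajectories shrink to a quarter, and \<open>\<eta>\<close> so small that the
difference is at most a quarter, every block halves the history.\<close>

lemma exponentially_stable_perturbation:
  fixes M0 M1 :: "'x::euclidean_space \<Rightarrow> 'x"
  assumes lin: "linear M0" "linear M1"
    and stable: "exponentially_stable r (\<lambda>X. \<forall>t\<ge>0. X (t + 1) = M0 (X t) + M1 (X (t - int r)))"
  obtains \<eta> where "0 < \<eta>"
    "\<And>X. (\<And>t. 0 \<le> t \<Longrightarrow> norm (X (t + 1) - (M0 (X t) + M1 (X (t - int r)))) \<le> \<eta> * (norm (X t) + norm (X (t - int r)))) \<Longrightarrow>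
      (\<lambda>t :: nat. X (int t)) \<longlonglongrightarrow> 0"
proof -
  obtain M \<rho> where M: "0 < M" "0 < \<rho>" "\<rho> < 1"
    and decay: "\<And>X t. (\<And>t. 0 \<le> t \<Longrightarrow> X (t + 1) = M0 (X t) + M1 (X (t - int r))) \<Longrightarrow>
      norm (X (int t)) \<le> M * \<rho> ^ t * Max ((\<lambda>s. norm (X s)) ` {- int r..0})" for X :: "int \<Rightarrow> 'x" and t :: nat
    using stable unfolding exponentially_stable_def by metis
  obtain g0 where g0: "0 < g0" "\<And>x. norm (M0 x) \<le> g0 * norm x" using linear_bounded_pos[OF lin(1)] by metis
  obtain g1 where g1: "0 < g1" "\<And>x. norm (M1 x) \<le> g1 * norm x" using linear_bounded_pos[OF lin(2)] by metis
  define g where "g = g0 + g1 + 1"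
  have g: "1 \<le> g" "norm (M0 x) \<le> g * norm x" "norm (M1 x) \<le> g * norm x" for x
    using g0 g1 order.trans[OF g0(2) mult_right_mono[of g0 g "norm x"]] order.trans[OF g1(2) mult_right_mono[of g1 g "norm x"]]
    by (auto simp: g_def)
  have "(\<lambda>n. M * \<rho> ^ n) \<longlonglongrightarrow> M * 0" using M by (intro tendsto_mult_left LIMSEQ_realpow_zero) auto
  then have "\<forall>\<^sub>F n in sequentially. M * \<rho> ^ n < 1 / 4"
    by (rule order_tendstoD) simp
  then obtain n0 where n0: "M * \<rho> ^ n0 < 1 / 4" by (auto simp: eventually_sequentially)
  define T where "T = n0 + r + 1"
  define C0 where "C0 = (2 * (g + 1)) ^ T * real (r + 1)"
  have C0: "1 \<le> C0"
  proof -
    have "1 * 1 \<le> (2 * (g + 1)) ^ T * real (r + 1)"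
      using g by (intro mult_mono one_le_power) auto
    then show ?thesis by (simp add: C0_def)
  qed
  define \<eta> where "\<eta> = 1 / (8 * C0 * (2 * g + 1) ^ T)"
  have big: "1 \<le> (2 * g + 1) ^ T" using g by (simp add: one_le_power)
  have \<eta>: "0 < \<eta>" "\<eta> \<le> 1" "(2 * g + 1) ^ T * (2 * \<eta> * C0) = 1 / 4"
  proof -
    have "1 * 1 \<le> C0 * (2 * g + 1) ^ T" using C0 big by (intro mult_mono) auto
    then show "\<eta> \<le> 1" by (simp add: \<eta>_def)
    show "0 < \<eta>" "(2 * g + 1) ^ T * (2 * \<eta> * C0) = 1 / 4" using C0 big g by (simp_all add: \<eta>_def)
  qed
  let ?pert = "\<lambda>X. \<forall>t\<ge>0. norm (X (t + 1) - (M0 (X t) + M1 (X (t - int r)))) \<le> \<eta> * (norm (X t) + norm (X (t - int r)))"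
  have block: "(\<forall>s\<in>{- int r..int T}. norm (X s) \<le> C0 * h) \<and> (\<forall>s\<in>{int T - int r..int T}. norm (X s) \<le> h / 2)"
    if X: "?pert X" and h: "\<And>s. s \<in> {- int r..0} \<Longrightarrow> norm (X s) \<le> h" for X h
  proof -
    have "norm (X 0) \<le> h" by (rule h) simp
    then have h0: "0 \<le> h" by (meson norm_ge_zero order_trans)
    have growth: "norm (X (t + 1)) \<le> (g + 1) * (norm (X t) + norm (X (t - int r)))" if "0 \<le> t" for t
    proof -
      let ?d = "X (t + 1) - (M0 (X t) + M1 (X (t - int r)))"
      have "norm (X (t + 1)) \<le> norm ?d + norm (M0 (X t)) + norm (M1 (X (t - int r)))"
        using norm_triangle_ineq[of ?d "M0 (X t) + M1 (X (t - int r))"] norm_triangle_ineq[of "M0 (X t)" "M1 (X (t - int r))"]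
        by simp
      also have "\<dots> \<le> \<eta> * (norm (X t) + norm (X (t - int r))) + g * norm (X t) + g * norm (X (t - int r))"
        using X that by (intro add_mono g) auto
      also have "\<dots> \<le> 1 * (norm (X t) + norm (X (t - int r))) + g * norm (X t) + g * norm (X (t - int r))"
        using \<eta> by (intro add_mono mult_right_mono) auto
      finally show ?thesis by (simp add: algebra_simps)
    qed
    have XC: "norm (X s) \<le> C0 * h" if "s \<in> {- int r..int T}" for s
    proof -
      have "norm (X s) \<le> (2 * (g + 1)) ^ T * (\<Sum>u\<in>{- int r..0}. norm (X u))"
        by (rule delay_growth_bound[OF norm_ge_zero growth]) (use g that in auto)
      also have "\<dots> \<le> (2 * (g + 1)) ^ T * (\<Sum>u\<in>{- int r..0}. h)"
        using g by (intro mult_left_mono sum_mono h) auto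
      finally show ?thesis by (simp add: C0_def algebra_simps)
    qed
    obtain Z where Z: "\<And>t. t \<le> 0 \<Longrightarrow> Z t = X t" "\<And>t. 0 \<le> t \<Longrightarrow> Z (t + 1) = M0 (Z t) + M1 (Z (t - int r))"
      by (rule delay_trajectory_exists[of X "\<lambda>x y. M0 x + M1 y" r]) blast
    have maxZ: "Max ((\<lambda>s. norm (Z s)) ` {- int r..0}) \<le> h"
      by (subst Max_le_iff) (use h Z(1) in auto)
    define e where "e = 2 * \<eta> * C0 * h"
    have e0: "0 \<le> e" using \<eta> C0 h0 by (simp add: e_def)
    have diff: "norm (X s - Z s) \<le> (2 * g + 1) ^ n * e" if "- int r \<le> s" "s \<le> int n" "n \<le> T" for s n
      using that
    proof (induction n arbitrary: s)
      case 0
      then show ?case using Z(1)[of s] e0 by simp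
    next
      case (Suc n)
      have b: "0 \<le> (2 * g + 1) ^ n * e" "e \<le> (2 * g + 1) ^ n * e"
        using g e0 mult_right_mono[OF one_le_power[of "2 * g + 1" n] e0] by simp_all
      show ?case
      proof (cases "s \<le> int n")
        case True
        then have "norm (X s - Z s) \<le> (2 * g + 1) ^ n * e" using Suc by auto
        also have "\<dots> \<le> (2 * g + 1) * ((2 * g + 1) ^ n * e)"
          using mult_right_mono[of 1 "2 * g + 1", OF _ b(1)] g by simp
        finally show ?thesis by (simp add: mult.assoc)
      next
        case False
        then have s: "s = int n + 1" using Suc.prems by simp
        let ?t = "int n" and ?d = "X (int n + 1) - (M0 (X (int n)) + M1 (X (int n - int r)))"
        have "X s - Z s = ?d + M0 (X ?t - Z ?t) + M1 (X (?t - int r) - Z (?t - int r))"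
          by (simp add: s Z(2) linear_diff[OF lin(1)] linear_diff[OF lin(2)])
        then have "norm (X s - Z s) \<le> norm ?d + norm (M0 (X ?t - Z ?t)) + norm (M1 (X (?t - int r) - Z (?t - int r)))"
          by (metis (no_types, lifting) add_right_mono norm_triangle_ineq order_trans)
        also have "norm ?d \<le> \<eta> * (norm (X ?t) + norm (X (?t - int r)))" using X by simp
        also have "\<dots> \<le> \<eta> * (C0 * h + C0 * h)"
          using \<eta> Suc.prems by (intro mult_left_mono add_mono XC) auto
        also have "\<dots> = e" by (simp add: e_def)
        also have "norm (M0 (X ?t - Z ?t)) \<le> g * ((2 * g + 1) ^ n * e)"
          using g Suc.prems by (intro order.trans[OF g(2)] mult_left_mono Suc.IH) auto
        also have "norm (M1 (X (?t - int r) - Z (?t - int r))) \<le> g * ((2 * g + 1) ^ n * e)"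
          using g Suc.prems by (intro order.trans[OF g(3)] mult_left_mono Suc.IH) auto
        finally show ?thesis using b(2) by (simp add: algebra_simps)
      qed
    qed
    have "norm (X s) \<le> h / 2" if s: "s \<in> {int T - int r..int T}" for s
    proof -
      have s0: "0 \<le> s" using s by (simp add: T_def)
      have "norm (X s) \<le> norm (X s - Z s) + norm (Z s)" using norm_triangle_ineq[of "X s - Z s" "Z s"] by simp
      also have "norm (X s - Z s) \<le> (2 * g + 1) ^ T * e" using s s0 by (intro diff) auto
      also have "\<dots> = h / 4"
        using arg_cong[OF \<eta>(3), of "\<lambda>c. c * h"] by (simp add: e_def mult.assoc)
      also have "norm (Z s) \<le> M * \<rho> ^ nat s * h"
      proof -
        have "norm (Z (int (nat s))) \<le> M * \<rho> ^ nat s * Max ((\<lambda>s. norm (Z s)) ` {- int r..0})"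
          by (rule decay) (rule Z(2))
        also have "\<dots> \<le> M * \<rho> ^ nat s * h"
          using M by (intro mult_left_mono maxZ) auto
        finally show ?thesis using s0 by simp
      qed
      also have "\<dots> \<le> M * \<rho> ^ n0 * h"
        using M h0 s by (intro mult_right_mono mult_left_mono power_decreasing) (auto simp: T_def)
      also have "\<dots> \<le> 1 / 4 * h" using n0 h0 by (intro mult_right_mono) auto
      finally show ?thesis by simp
    qed
    then show ?thesis using XC by blast
  qed
  have "(\<lambda>t :: nat. X (int t)) \<longlonglongrightarrow> 0" if X: "?pert X" for X
  proof -
    define h where "h = Max ((\<lambda>s. norm (X s)) ` {- int r..0})"
    have hX: "norm (X s) \<le> h" if "s \<in> {- int r..0}" for s
      unfolding h_def by (rule Max_ge) (use that in auto)
    define Y where "Y k s = X (s + int (k * T))" for k s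
    have Yp: "?pert (Y k)" for k
    proof (intro allI impI)
      fix t :: int assume "0 \<le> t"
      then have "0 \<le> t + int (k * T)" by simp
      moreover have "t + 1 + int (k * T) = t + int (k * T) + 1" "t - int r + int (k * T) = t + int (k * T) - int r" by simp_all
      ultimately show "norm (Y k (t + 1) - (M0 (Y k t) + M1 (Y k (t - int r)))) \<le> \<eta> * (norm (Y k t) + norm (Y k (t - int r)))"
        using X unfolding Y_def by presburger
    qed
    have hist: "\<forall>s\<in>{- int r..0}. norm (Y k s) \<le> h / 2 ^ k" for k
    proof (induction k)
      case 0
      then show ?case using hX by (simp add: Y_def)
    next
      case (Suc k)
      have "norm (Y (Suc k) s) \<le> h / 2 ^ k / 2" if "s \<in> {- int r..0}" for s
      proof -
        have "Y (Suc k) s = Y k (s + int T)" by (simp add: Y_def algebra_simps)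
        moreover have "s + int T \<in> {int T - int r..int T}" using that by auto
        ultimately show ?thesis using block[OF Yp, of k "h / 2 ^ k"] Suc by auto
      qed
      then show ?case by (simp add: mult.commute)
    qed
    have bound: "norm (X (int t)) \<le> C0 * h * (1 / 2) ^ (t div T)" for t
    proof -
      have T0: "0 < T" by (simp add: T_def)
      have "int t = int (t mod T) + int (t div T * T)" by (simp flip: of_nat_add of_nat_mult)
      then have "X (int t) = Y (t div T) (int (t mod T))" by (simp add: Y_def)
      moreover have "int (t mod T) \<in> {- int r..int T}" using T0 by (simp add: less_imp_le)
      ultimately have "norm (X (int t)) \<le> C0 * (h / 2 ^ (t div T))"
        using block[OF Yp, of "t div T" "h / 2 ^ (t div T)"] hist by auto
      then show ?thesis by (simp add: power_divide)
    qed
    have "filterlim (\<lambda>t. t div T) at_top sequentially"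
      by (rule filterlim_at_top_div_const_nat) (simp add: T_def)
    then have "(\<lambda>t. (1 / 2 :: real) ^ (t div T)) \<longlonglongrightarrow> 0"
      using filterlim_compose[OF LIMSEQ_realpow_zero[of "1 / 2 :: real"]] by simp
    then have "(\<lambda>t. C0 * h * (1 / 2) ^ (t div T)) \<longlonglongrightarrow> C0 * h * 0" by (rule tendsto_mult_left)
    then have lim: "(\<lambda>t. C0 * h * (1 / 2) ^ (t div T)) \<longlonglongrightarrow> 0" by simp
    show ?thesis by (rule Lim_null_comparison[OF always_eventually lim]) (use bound in blast)
  qed
  then show thesis using that[of \<eta>] \<eta>(1) by blast
qed

section \<open>The internal model\<close>

lemma matrix_power_mult: "matrix_power M k *v v = ((*v) M ^^ k) v"
  by (induction k) (simp_all add: matrix_power_def flip: matrix_vector_mul_assoc)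

lemma char_polynomial_eq_charpoly: "char_polynomial M = charpoly M"
  by (simp add: char_polynomial_def charpoly_def)

lemma matrix_poly_mult: "matrix_poly f M *v v = poly_act f M v"
proof -
  have "(\<Sum>k\<in>I. coeff f k *\<^sub>R matrix_power M k) *v v = (\<Sum>k\<in>I. coeff f k *s (((*v) M ^^ k) v))" if "finite I" for I
    using that
    by (induction I) (simp_all add: matrix_vector_mult_add_rdistrib matrix_power_mult scalar_mult_eq_scaleR
        flip: scaleR_matrix_vector_assoc)
  then show ?thesis by (simp add: matrix_poly_def poly_act_def)
qed

lemma controllable_krylov:
  fixes \<beta> :: "real^'k^'k"
  assumes "controllable \<beta> (columnvector \<sigma> :: real^1^'k)"
  shows "dim ((\<lambda>i. ((*v) \<beta> ^^ i) \<sigma>) ` {..<CARD('k)}) = CARD('k)"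
proof -
  have col: "columns (columnvector x :: real^1^'k) = {x}" for x
    by (auto simp: columns_def column_def columnvector_def vec_eq_iff)
  have "columns (matrix_power \<beta> i ** (columnvector \<sigma> :: real^1^'k)) = {((*v) \<beta> ^^ i) \<sigma>}" for i
    by (simp add: col matrix_power_mult flip: dot_rowvector_columnvector)
  then show ?thesis using assms by (simp add: controllable_def UNION_singleton_eq_range)
qed

text \<open>A normal vector of the hyperplane spanned by the first \<open>k - 1\<close> vectors \<open>\<beta>\<^sup>i \<sigma>\<close>; all \<open>k\<close> of them span the space.\<close>

lemma controllable_dual_vector:
  fixes \<beta> :: "real^'k^'k"
  assumes ctr: "controllable \<beta> (columnvector \<sigma> :: real^1^'k)"
  obtains h where "\<And>i. i < CARD('k) - 1 \<Longrightarrow> h \<bullet> ((*v) \<beta> ^^ i) \<sigma> = 0"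
    "h \<bullet> ((*v) \<beta> ^^ (CARD('k) - 1)) \<sigma> \<noteq> 0"
proof -
  let ?b = "\<lambda>i. ((*v) \<beta> ^^ i) \<sigma>" and ?k = "CARD('k)"
  have "dim (?b ` {..<?k - 1}) \<le> card (?b ` {..<?k - 1})" by (rule dim_le_card') simp
  also have "\<dots> \<le> card {..<?k - 1}" by (rule card_image_le) simp
  also have "\<dots> < DIM(real^'k)" by simp
  finally obtain h where h: "h \<noteq> 0" "\<And>y. y \<in> span (?b ` {..<?k - 1}) \<Longrightarrow> orthogonal h y"
    by (rule orthogonal_to_subspace_exists) blast
  have 0: "h \<bullet> ?b i = 0" if "i < ?k - 1" for i
    using h(2)[OF span_base, of "?b i"] that by (auto simp: orthogonal_def)
  moreover have "h \<bullet> ?b (?k - 1) \<noteq> 0"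
  proof
    assume "h \<bullet> ?b (?k - 1) = 0"
    then have "h \<bullet> ?b i = 0" if "i < ?k" for i
      using 0[of i] that by (cases "i = ?k - 1") auto
    then have "orthogonal h y" if "y \<in> ?b ` {..<?k}" for y
      using that by (auto simp: orthogonal_def)
    then have "orthogonal h y" if "y \<in> span (?b ` {..<?k})" for y
      using that orthogonal_to_span by blast
    moreover have "span (?b ` {..<?k}) = UNIV"
      using controllable_krylov[OF ctr] dim_eq_full[of "?b ` {..<?k}"] by simp
    ultimately have "orthogonal h h" by blast
    then show False using h(1) by (simp add: orthogonal_self)
  qed
  ultimately show thesis using that by blast
qed

text \<open>Such an \<open>l\<close> is a root of the minimal polynomial \<open>f\<close> of \<open>S\<close>. If it were no eigenvalue of \<open>S\<close>, the factor \<open>S - l\<close>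
could be cancelled from \<open>f(S) = 0\<close>, and the real part of the complex cofactor would annihilate \<open>S\<close>.\<close>

lemma eigenvalue_min_internal_model:
  fixes S :: "real^'q^'q" and \<beta> :: "real^'k^'k"
  assumes minp: "is_minimal_polynomial S (char_polynomial \<beta>)"
    and v: "v \<noteq> 0" "complex_matrix \<beta> *v v = l *s v"
  shows "l \<in> spectrum S"
proof (rule ccontr)
  assume l: "l \<notin> spectrum S"
  define f where "f = char_polynomial \<beta>"
  define fc where "fc = map_poly complex_of_real f"
  have cfc: "coeff fc i = complex_of_real (coeff f i)" for i
    by (simp add: fc_def coeff_map_poly)
  have dfc: "degree fc = degree f"
    by (simp add: fc_def degree_map_poly)
  have act: "Re_vector (poly_act fc (complex_matrix M) X) = poly_act f M (Re_vector X)"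
    "Im_vector (poly_act fc (complex_matrix M) X) = poly_act f M (Im_vector X)" for M :: "real^'c^'c" and X
    unfolding poly_act_def dfc cfc iterate_complex_matrix[symmetric]
    by (simp_all add: Re_vector_def Im_vector_def vec_eq_iff)
  have complex_eq_0: "X = 0" if "Re_vector X = 0" "Im_vector X = 0" for X :: "complex^'c"
    using that by (simp add: vec_eq_iff Re_vector_def Im_vector_def complex_eq_iff)
  have f\<beta>: "poly_act fc (complex_matrix \<beta>) v = 0"
    by (rule complex_eq_0) (simp_all add: act f_def char_polynomial_eq_charpoly cayley_hamilton)
  have "((*v) (complex_matrix \<beta>) ^^ i) v = l ^ i *s v" for i
    by (induction i) (simp_all add: v matrix_vector_mult_smult vector_smult_assoc mult.commute)
  then have "poly_act fc (complex_matrix \<beta>) v = poly fc l *s v"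
    unfolding poly_act_def poly_altdef by (simp add: vector_smult_assoc vec.scale_sum_left)
  then have "poly fc l = 0" using f\<beta> v(1) by simp
  then obtain g where g: "fc = [:-l, 1:] * g" by (auto simp: poly_eq_0_iff_dvd dvd_def)
  have lf: "coeff f (degree f) = 1" using minp by (simp add: is_minimal_polynomial_def f_def)
  have lfc: "lead_coeff fc = 1" by (simp add: cfc dfc lf)
  then have g0: "g \<noteq> 0" using g by auto
  have "degree fc = degree [:-l, 1:] + degree g" unfolding g by (rule degree_mult_eq) (use g0 in auto)
  then have dg: "degree f = Suc (degree g)" by (simp add: dfc)
  have "lead_coeff fc = lead_coeff [:-l, 1:] * lead_coeff g" unfolding g by (rule lead_coeff_mult)
  then have lg: "lead_coeff g = 1" using lfc by simp
  have gS: "poly_act g (complex_matrix S) X = 0" for X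
  proof (rule ccontr)
    let ?Y = "poly_act g (complex_matrix S) X"
    assume "?Y \<noteq> 0"
    moreover have "poly_act fc (complex_matrix S) X = 0"
    proof (rule complex_eq_0)
      have "poly_act f S x = 0" for x
        using minp matrix_poly_mult[of f S x] by (simp add: is_minimal_polynomial_def f_def)
      then show "Re_vector (poly_act fc (complex_matrix S) X) = 0" "Im_vector (poly_act fc (complex_matrix S) X) = 0"
        by (simp_all add: act)
    qed
    then have "complex_matrix S *v ?Y = l *s ?Y" unfolding g poly_act_linear_factor by simp
    ultimately show False using l by (auto simp: spectrum_def)
  qed
  define gr where "gr = map_poly Re g"
  have cgr: "coeff gr i = Re (coeff g i)" for i by (simp add: gr_def coeff_map_poly)
  have "coeff gr (degree g) = 1" by (simp add: cgr lg)
  then have gr0: "gr \<noteq> 0" by auto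
  have dgr: "degree gr \<le> degree g" by (rule degree_le) (simp add: cgr coeff_eq_0)
  have "poly_act gr S x = 0" for x
  proof -
    have "Im_vector (complex_vector x) = 0" by (simp add: Im_vector_def complex_vector_def vec_eq_iff)
    then have im: "Im_vector (((*v) (complex_matrix S) ^^ i) (complex_vector x)) = 0" for i
      by (simp add: iterate_complex_matrix iterate_mult_linear)
    have "poly_act gr S x = (\<Sum>i\<le>degree g. coeff gr i *s Re_vector (((*v) (complex_matrix S) ^^ i) (complex_vector x)))"
      by (subst poly_act_bound[OF dgr]) (simp add: iterate_complex_matrix Re_complex_vector)
    also have "\<dots> = Re_vector (poly_act g (complex_matrix S) (complex_vector x))"
      using im by (simp add: poly_act_def cgr Re_vector_def Im_vector_def vec_eq_iff)
    also have "\<dots> = 0" by (simp add: gS Re_vector_def vec_eq_iff)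
    finally show ?thesis .
  qed
  then have "matrix_poly gr S = 0" by (simp add: matrix_eq matrix_poly_mult)
  then have "degree f \<le> degree gr" using minp gr0 by (simp add: is_minimal_polynomial_def f_def)
  then show False using dgr dg by simp
qed

text \<open>By variation of constants and Cayley-Hamilton, the combination of the shifts of \<open>\<zeta>\<close> is
\<open>\<Sum>\<^sub>j f\<^sub>j \<Sum>\<^sub>s e(t + s) \<beta>\<^sup>j\<^sup>-\<^sup>1\<^sup>-\<^sup>s \<sigma>\<close>. Pairing with a vector that is orthogonal to \<open>\<beta>\<^sup>i \<sigma>\<close> for \<open>i < k - 1\<close> leaves the term
\<open>j = k\<close>, \<open>s = 0\<close>, which is a nonzero multiple of \<open>e(t)\<close>.\<close>

lemma internal_model_regulates:
  fixes \<beta> :: "real^'k^'k" and \<zeta> :: "nat \<Rightarrow> real^'k" and e :: "nat \<Rightarrow> real"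
  assumes ctr: "controllable \<beta> (columnvector \<sigma> :: real^1^'k)"
    and rec: "\<And>t. \<zeta> (Suc t) = \<beta> *v \<zeta> t + e t *\<^sub>R \<sigma>"
    and lim: "(\<lambda>t. \<Sum>j\<le>degree (charpoly \<beta>). coeff (charpoly \<beta>) j *\<^sub>R \<zeta> (t + j)) \<longlonglongrightarrow> 0"
  shows "e \<longlonglongrightarrow> 0"
proof -
  let ?f = "charpoly \<beta>" and ?k = "CARD('k)" and ?it = "\<lambda>i. ((*v) \<beta> ^^ i)"
  obtain h where h: "\<And>i. i < ?k - 1 \<Longrightarrow> h \<bullet> ?it i \<sigma> = 0" and c: "h \<bullet> ?it (?k - 1) \<sigma> \<noteq> 0"
    using controllable_dual_vector[OF ctr] by blast
  have deg: "degree ?f = ?k" and lead: "coeff ?f ?k = 1" using charpoly_monic[of \<beta>] by simp_all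
  have sol: "\<zeta> (t + j) = ?it j (\<zeta> t) + (\<Sum>s<j. e (t + s) *\<^sub>R ?it (j - Suc s) \<sigma>)" for t j
  proof (induction j)
    case (Suc j)
    have "\<zeta> (t + Suc j) = \<beta> *v ?it j (\<zeta> t) + (\<Sum>s<j. e (t + s) *\<^sub>R (\<beta> *v ?it (j - Suc s) \<sigma>)) + e (t + j) *\<^sub>R \<sigma>"
      by (simp add: rec Suc matrix_vector_right_distrib matrix_vector_mult_sum matrix_vector_mult_scaleR)
    also have "(\<Sum>s<j. e (t + s) *\<^sub>R (\<beta> *v ?it (j - Suc s) \<sigma>)) = (\<Sum>s<j. e (t + s) *\<^sub>R ?it (Suc j - Suc s) \<sigma>)"
      by (intro sum.cong) (auto simp: Suc_diff_Suc simp flip: funpow.simps(2) comp_apply[of "(*v) \<beta>"])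
    finally show ?case by simp
  qed simp
  have "h \<bullet> (\<Sum>j\<le>degree ?f. coeff ?f j *\<^sub>R \<zeta> (t + j)) = (h \<bullet> ?it (?k - 1) \<sigma>) * e t" for t
  proof -
    have "(\<Sum>j\<le>degree ?f. coeff ?f j *\<^sub>R \<zeta> (t + j))
        = poly_act ?f \<beta> (\<zeta> t) + (\<Sum>j\<le>?k. coeff ?f j *\<^sub>R (\<Sum>s<j. e (t + s) *\<^sub>R ?it (j - Suc s) \<sigma>))"
      unfolding sol by (simp add: poly_act_def scaleR_right_distrib sum.distrib deg scalar_mult_eq_scaleR)
    then have "h \<bullet> (\<Sum>j\<le>degree ?f. coeff ?f j *\<^sub>R \<zeta> (t + j))
        = (\<Sum>j\<le>?k. coeff ?f j * (\<Sum>s<j. e (t + s) * (h \<bullet> ?it (j - Suc s) \<sigma>)))"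
      by (simp add: cayley_hamilton inner_sum_right)
    also have "\<dots> = (\<Sum>j\<le>?k. if j = ?k then e t * (h \<bullet> ?it (?k - 1) \<sigma>) else 0)"
    proof (rule sum.cong)
      fix j assume j: "j \<in> {..?k}"
      have "(\<Sum>s<j. e (t + s) * (h \<bullet> ?it (j - Suc s) \<sigma>))
          = (\<Sum>s<j. if s = 0 \<and> j = ?k then e t * (h \<bullet> ?it (?k - 1) \<sigma>) else 0)"
      proof (rule sum.cong)
        fix s assume s: "s \<in> {..<j}"
        show "e (t + s) * (h \<bullet> ?it (j - Suc s) \<sigma>) = (if s = 0 \<and> j = ?k then e t * (h \<bullet> ?it (?k - 1) \<sigma>) else 0)"
        proof (cases "s = 0 \<and> j = ?k")
          case False
          then have "j - Suc s < ?k - 1" using s j by auto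
          then show ?thesis using False by (auto simp: h)
        qed simp
      qed simp
      also have "\<dots> = (if j = ?k then e t * (h \<bullet> ?it (?k - 1) \<sigma>) else 0)"
        by (cases "j = ?k") simp_all
      finally show "coeff ?f j * (\<Sum>s<j. e (t + s) * (h \<bullet> ?it (j - Suc s) \<sigma>))
          = (if j = ?k then e t * (h \<bullet> ?it (?k - 1) \<sigma>) else 0)"
        by (simp add: lead)
    qed simp
    finally show ?thesis by (simp add: mult.commute)
  qed
  moreover have "(\<lambda>t. h \<bullet> (\<Sum>j\<le>degree ?f. coeff ?f j *\<^sub>R \<zeta> (t + j))) \<longlonglongrightarrow> h \<bullet> 0"
    by (intro tendsto_inner tendsto_const lim)
  ultimately have "(\<lambda>t. (h \<bullet> ?it (?k - 1) \<sigma>) * e t) \<longlonglongrightarrow> 0" by simp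
  then have "(\<lambda>t. inverse (h \<bullet> ?it (?k - 1) \<sigma>) * ((h \<bullet> ?it (?k - 1) \<sigma>) * e t)) \<longlonglongrightarrow> inverse (h \<bullet> ?it (?k - 1) \<sigma>) * 0"
    by (intro tendsto_mult tendsto_const)
  then show ?thesis using c by (simp flip: mult.assoc)
qed

lemma sum_pair_row:
  fixes g :: "'a::finite \<times> 'b::finite \<Rightarrow> 'c::comm_monoid_add"
  shows "(\<Sum>x\<in>UNIV. if fst x = l then g x else 0) = (\<Sum>k\<in>UNIV. g (l, k))"
proof -
  have "(\<Sum>x\<in>UNIV. if fst x = l then g x else 0) = (\<Sum>l'\<in>UNIV. \<Sum>k\<in>UNIV. if l' = l then g (l', k) else 0)"
    by (simp add: sum.cartesian_product case_prod_unfold) (intro sum.cong, auto)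
  also have "\<dots> = (\<Sum>k\<in>UNIV. g (l, k))"
    by (subst sum.swap) simp
  finally show ?thesis .
qed

lemma internal_model_G1_mult: "(internal_model_G1 \<beta> *v z) $ (l, k) = (\<beta> *v (\<chi> k. z $ (l, k))) $ k"
proof -
  have "(internal_model_G1 \<beta> *v z) $ (l, k) = (\<Sum>x\<in>UNIV. if fst x = l then \<beta> $ k $ snd x * z $ x else 0)"
    unfolding internal_model_G1_def kronecker_def matrix_vector_mult_def mat_def
    by (auto intro!: sum.cong)
  then show ?thesis by (simp add: sum_pair_row matrix_vector_mult_def)
qed

lemma internal_model_G2_mult: "(internal_model_G2 \<sigma> *v e) $ (l, k) = e $ l * \<sigma> $ k"
  by (simp add: internal_model_G2_def kronecker_def matrix_vector_mult_def mat_def columnvector_def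
      if_distrib[of "\<lambda>c. c * _"] cong: if_cong)

section \<open>The closed loop as a delay system\<close>

lemma virtual_error_eq_laplacian:
  "virtual_error Ed a P F v x i t
    = (\<Sum>j\<in>UNIV. leader_laplacian Ed a $ i $ j *\<^sub>R regulated_output P F v x j t)"
proof -
  define g where "g k = node_output P F v x k t - node_output P F v x None t" for k
  have "virtual_error Ed a P F v x i t = (\<Sum>k\<in>neighbors Ed (Some i). a (Some i) k *\<^sub>R (g (Some i) - g k))"
    by (simp add: virtual_error_def g_def)
  also have "\<dots> = (\<Sum>j\<in>UNIV. leader_laplacian Ed a $ i $ j *\<^sub>R g (Some j))"
    by (rule sum_neighbors_eq_laplacian) (simp add: g_def)
  finally show ?thesis by (simp add: g_def regulated_output_def)
qed

lemma relative_state_eq_laplacian: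
  "relative_state Ed a rcom x i t = (\<Sum>j\<in>UNIV. leader_laplacian Ed a $ i $ j *\<^sub>R (x (t - int rcom) $ j))"
  unfolding relative_state_def by (subst sum_neighbors_eq_laplacian) (simp_all add: node_state_def)

lemma plant_components:
  "plant_A p = fst p" "plant_B p = fst (snd p)" "plant_E p = fst (snd (snd p))" "plant_C p = snd (snd (snd p))"
  by (cases p; simp)+

text \<open>The right-hand side of the closed loop is split so that the uncertain matrices enter bilinearly in
\<open>loop_now\<close> and \<open>loop_delayed\<close>: a small uncertainty then changes it by little relative to the state.\<close>

definition loop_free ::
  "real^('z::finite)^'z \<Rightarrow> ((real^('n::finite))^('N::finite)) \<times> ((real^'z)^'N) \<Rightarrow> ((real^'n)^'N) \<times> ((real^'z)^'N)" where
  "loop_free G1 X = (0, \<chi> i. G1 *v (snd X $ i))"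

definition loop_now ::
  "real^('N::finite)^'N \<Rightarrow> real^('p::finite)^('z::finite) \<Rightarrow> ('n::finite, 'm::finite, 'p, 'q::finite) plant ^ 'N
    \<Rightarrow> ((real^'n)^'N) \<times> ((real^'z)^'N) \<Rightarrow> ((real^'n)^'N) \<times> ((real^'z)^'N)" where
  "loop_now H G2 P X = (\<chi> i. plant_A (P $ i) *v (fst X $ i),
     \<chi> i. G2 *v (\<Sum>j\<in>UNIV. H $ i $ j *\<^sub>R (plant_C (P $ j) *v (fst X $ j))))"

definition loop_delayed ::
  "real^('N::finite)^'N \<Rightarrow> real^('n::finite)^('m::finite) \<Rightarrow> real^('z::finite)^'m \<Rightarrow> ('n, 'm, 'p::finite, 'q::finite) plant ^ 'N
    \<Rightarrow> ((real^'n)^'N) \<times> ((real^'z)^'N) \<Rightarrow> ((real^'n)^'N) \<times> ((real^'z)^'N)" where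
  "loop_delayed H Kx Kz P X =
     (\<chi> i. plant_B (P $ i) *v (Kx *v (\<Sum>j\<in>UNIV. H $ i $ j *\<^sub>R (fst X $ j)) + Kz *v (snd X $ i)), 0)"

definition loop_forcing ::
  "real^('N::finite)^'N \<Rightarrow> real^('p::finite)^('z::finite) \<Rightarrow> real^('q::finite)^'p \<Rightarrow> ('n::finite, 'm::finite, 'p, 'q) plant ^ 'N
    \<Rightarrow> real^'q \<Rightarrow> ((real^'n)^'N) \<times> ((real^'z)^'N)" where
  "loop_forcing H G2 F P v = (\<chi> i. plant_E (P $ i) *v v, \<chi> i. G2 *v (\<Sum>j\<in>UNIV. H $ i $ j *\<^sub>R (F *v v)))"

lemma closed_loop_iff_delay_system:
  "closed_loop Ed a rcom rcon S F (\<lambda>i. P $ i) G1 G2 Kx Kz v (\<lambda>t. fst (X t)) (\<lambda>t. snd (X t)) \<longleftrightarrow>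
    (\<forall>t\<ge>0. v (t + 1) = S *v v t \<and>
      X (t + 1) = loop_free G1 (X t) + loop_now (leader_laplacian Ed a) G2 P (X t)
        + loop_delayed (leader_laplacian Ed a) Kx Kz P (X (t - int (rcom + rcon)))
        + loop_forcing (leader_laplacian Ed a) G2 F P (v t))"
proof -
  have ro: "regulated_output (\<lambda>i. P $ i) F v (\<lambda>t. fst (X t)) j t = plant_C (P $ j) *v (fst (X t) $ j) + F *v v t" for j t
    by (simp add: regulated_output_def node_output_def)
  have dl: "t - int rcon - int rcom = t - int (rcom + rcon)" for t by simp
  show ?thesis
    unfolding closed_loop_def control_input_def relative_state_eq_laplacian virtual_error_eq_laplacian ro dl
      prod_eq_iff vec_eq_iff[of "fst (X _)"] vec_eq_iff[of "snd (X _)"]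
    by (simp add: loop_free_def loop_now_def loop_delayed_def loop_forcing_def
        matrix_vector_right_distrib scaleR_right_distrib sum.distrib algebra_simps all_conj_distrib)
qed

lemma vec_lambda_add: "(\<chi> i. f i) + (\<chi> i. g i) = (\<chi> i. f i + g i)"
  by (simp add: vec_eq_iff)

lemma vec_lambda_scaleR: "c *\<^sub>R (\<chi> i. f i) = (\<chi> i. c *\<^sub>R f i)"
  by (simp add: vec_eq_iff)

lemma sum_scaleR_commute: "(\<Sum>j\<in>I. c j *\<^sub>R (r *\<^sub>R z j)) = r *\<^sub>R (\<Sum>j\<in>I. c j *\<^sub>R (z j :: 'v::real_vector))"
  by (simp add: scaleR_sum_right mult.commute)

lemma scaleR_matrix_mult: "(c *\<^sub>R M) *v x = c *\<^sub>R (M *v (x :: real^'n))"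
  by (simp add: scaleR_matrix_vector_assoc)

lemmas loop_linear_simps = prod_eq_iff vec_lambda_add vec_lambda_scaleR sum_scaleR_commute scaleR_matrix_mult
  plant_components matrix_vector_right_distrib matrix_vector_mult_add_rdistrib matrix_vector_mult_scaleR
  scaleR_right_distrib sum.distrib

lemma linear_loop_free: "linear (loop_free G1)"
  by (rule linearI) (simp_all add: loop_free_def loop_linear_simps del: scaleR_scaleR)

lemma bilinear_loop_now: "bilinear (loop_now H G2)"
  unfolding bilinear_def
  by (intro conjI allI; rule linearI) (simp_all add: loop_now_def loop_linear_simps del: scaleR_scaleR)

lemma bilinear_loop_delayed: "bilinear (loop_delayed H Kx Kz)"
  unfolding bilinear_def
  by (intro conjI allI; rule linearI) (simp_all add: loop_delayed_def loop_linear_simps add_ac del: scaleR_scaleR)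

lemma linear_loop_forcing: "linear (loop_forcing H G2 F P)"
  by (rule linearI) (simp_all add: loop_forcing_def loop_linear_simps del: scaleR_scaleR)

text \<open>Applying the minimal polynomial of the exosystem, as a polynomial in the time shift, to a trajectory
  removes the exosystem signal and leaves a trajectory of the unforced loop; the internal model then
  reads the virtual errors off from it.\<close>

theorem stable_loop_regulates_robustly:
  fixes P :: "('n::finite, 'm::finite, 'p::finite, 'q::finite) plant" and F :: "real^'q^'p"
    and Ed :: "('N::finite option \<times> 'N option) set" and a :: "'N option \<Rightarrow> 'N option \<Rightarrow> real"
    and \<beta> :: "real^'k::finite^'k" and Kx :: "real^'n^'m" and Kz :: "real^('p \<times> 'k)^'m"
  assumes graph: "weighted_adjacency Ed a" and reach: "\<And>v. (None, v) \<in> Ed\<^sup>*"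
    and gen: "is_min_internal_model_generator S \<beta> \<sigma>"
    and G: "G1 = internal_model_G1 \<beta>" "G2 = internal_model_G2 \<sigma>"
    and stable: "exponentially_stable (rcom + rcon)
       (\<lambda>X :: int \<Rightarrow> ((real^'n)^'N) \<times> ((real^('p \<times> 'k))^'N).
          closed_loop Ed a rcom rcon S F (\<lambda>i. P) G1 G2 Kx Kz (\<lambda>t. 0) (\<lambda>t. fst (X t)) (\<lambda>t. snd (X t)))"
  shows "solves_cooperative_robust_output_regulation Ed a rcom rcon S F P G1 G2 Kx Kz"
proof -
  define H where "H = leader_laplacian Ed a"
  define r where "r = rcom + rcon"
  define Pc :: "('n, 'm, 'p, 'q) plant ^ 'N" where "Pc = (\<chi> i. P)"
  let ?f = "charpoly \<beta>"
  define M0 where "M0 w X = loop_free G1 X + loop_now H G2 w X" for w :: "('n, 'm, 'p, 'q) plant ^ 'N" and X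
  define M1 where "M1 w X = loop_delayed H Kx Kz w X" for w :: "('n, 'm, 'p, 'q) plant ^ 'N" and X
  have linM0: "linear (M0 w)" for w
    unfolding M0_def using bilinear_loop_now by (intro linear_compose_add linear_loop_free) (auto simp: bilinear_def)
  have linM1: "linear (M1 w)" for w
    unfolding M1_def using bilinear_loop_delayed by (auto simp: bilinear_def)
  have loop: "closed_loop Ed a rcom rcon S F (\<lambda>i. w $ i) G1 G2 Kx Kz v (\<lambda>t. fst (X t)) (\<lambda>t. snd (X t)) \<longleftrightarrow>
      (\<forall>t\<ge>0. v (t + 1) = S *v v t \<and> X (t + 1) = M0 w (X t) + M1 w (X (t - int r)) + loop_forcing H G2 F w (v t))" for w v X
    unfolding closed_loop_iff_delay_system M0_def M1_def H_def r_def by simp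
  have "(\<lambda>i. P) = (\<lambda>i. Pc $ i)" by (simp add: Pc_def)
  then have st: "exponentially_stable r (\<lambda>X. \<forall>t\<ge>0. X (t + 1) = M0 Pc (X t) + M1 Pc (X (t - int r)))"
    using stable loop[of Pc "\<lambda>t. 0"] by (simp add: r_def linear_0[OF linear_loop_forcing])
  obtain \<eta> where \<eta>: "0 < \<eta>" and decay:
    "\<And>X. (\<And>t. 0 \<le> t \<Longrightarrow> norm (X (t + 1) - (M0 Pc (X t) + M1 Pc (X (t - int r)))) \<le> \<eta> * (norm (X t) + norm (X (t - int r)))) \<Longrightarrow>
      (\<lambda>t :: nat. X (int t)) \<longlonglongrightarrow> 0"
    by (rule exponentially_stable_perturbation[OF linM0 linM1 st]) blast
  obtain c0 where c0: "0 < c0" "\<And>w X. norm (loop_now H G2 w X) \<le> c0 * norm (w :: ('n, 'm, 'p, 'q) plant ^ 'N) * norm X"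
    using bilinear_bounded_pos[OF bilinear_loop_now[of H G2]] by metis
  obtain c1 where c1: "0 < c1" "\<And>w X. norm (loop_delayed H Kx Kz w X) \<le> c1 * norm (w :: ('n, 'm, 'p, 'q) plant ^ 'N) * norm X"
    using bilinear_bounded_pos[OF bilinear_loop_delayed[of H Kx Kz]] by metis
  obtain d where d: "d v* H = vec 1" "\<And>i. 0 < d $ i"
    unfolding H_def using laplacian_positive_weights[OF graph reach] by metis
  define W :: "(('n, 'm, 'p, 'q) plant ^ 'N) set" where "W = ball 0 (\<eta> / (c0 + c1))"
  have W: "open W" "0 \<in> W" using \<eta> c0 c1 by (simp_all add: W_def)
  have reg: "(\<lambda>t::nat. regulated_output (\<lambda>i. P + w $ i) F v x i (int t)) \<longlonglongrightarrow> 0"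
    if w: "w \<in> W" and cl: "closed_loop Ed a rcom rcon S F (\<lambda>i. P + w $ i) G1 G2 Kx Kz v x zb" for w v x zb i
  proof -
    define Q where "Q = Pc + w"
    have Q: "(\<lambda>i. P + w $ i) = (\<lambda>i. Q $ i)" by (simp add: Q_def Pc_def)
    define X where "X t = (x t, zb t)" for t
    have cl': "closed_loop Ed a rcom rcon S F (\<lambda>i. Q $ i) G1 G2 Kx Kz v (\<lambda>t. fst (X t)) (\<lambda>t. snd (X t))"
      using cl by (simp add: X_def Q)
    then have v_step: "v (t + 1) = S *v v t"
      and X_step: "X (t + 1) = M0 Q (X t) + M1 Q (X (t - int r)) + loop_forcing H G2 F Q (v t)" if "0 \<le> t" for t
      using that unfolding loop by blast+
    have v_iter: "v (t + int j) = ((*v) S ^^ j) (v t)" if "0 \<le> t" for t j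
    proof (induction j)
      case (Suc j)
      have "v (t + int j + 1) = S *v v (t + int j)" using that by (intro v_step) simp
      then show ?case using Suc by (simp add: algebra_simps)
    qed simp
    define Y where "Y t = (\<Sum>j\<le>degree ?f. coeff ?f j *\<^sub>R X (t + int j))" for t
    have Y_step: "Y (t + 1) = M0 Q (Y t) + M1 Q (Y (t - int r))" if t: "0 \<le> t" for t
    proof -
      have "X (t + 1 + int j) = M0 Q (X (t + int j)) + M1 Q (X (t - int r + int j)) + loop_forcing H G2 F Q (v (t + int j))" for j
        using X_step[of "t + int j"] t by (simp add: algebra_simps)
      then have "Y (t + 1) = M0 Q (Y t) + M1 Q (Y (t - int r))
          + loop_forcing H G2 F Q (\<Sum>j\<le>degree ?f. coeff ?f j *\<^sub>R v (t + int j))"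
        by (simp add: Y_def scaleR_right_distrib sum.distrib linear_sum[OF linM0] linear_sum[OF linM1] linear_sum[OF linear_loop_forcing]
            linear_cmul[OF linM0] linear_cmul[OF linM1] linear_cmul[OF linear_loop_forcing])
      moreover have "(\<Sum>j\<le>degree ?f. coeff ?f j *\<^sub>R v (t + int j)) = poly_act ?f S (v t)"
        using t by (simp add: poly_act_def v_iter scalar_mult_eq_scaleR)
      moreover have "poly_act ?f S (v t) = 0"
        using gen matrix_poly_mult[of ?f S "v t"]
        by (simp add: is_min_internal_model_generator_def is_minimal_polynomial_def char_polynomial_eq_charpoly)
      ultimately show ?thesis by (simp add: linear_0[OF linear_loop_forcing])
    qed
    have "(\<lambda>t :: nat. Y (int t)) \<longlonglongrightarrow> 0"
    proof (rule decay)
      fix t :: int assume t: "0 \<le> t"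
      have "Y (t + 1) - (M0 Pc (Y t) + M1 Pc (Y (t - int r)))
          = loop_now H G2 w (Y t) + loop_delayed H Kx Kz w (Y (t - int r))"
        unfolding Y_step[OF t] by (simp add: M0_def M1_def Q_def bilinear_ladd[OF bilinear_loop_now] bilinear_ladd[OF bilinear_loop_delayed])
      also have "norm \<dots> \<le> c0 * norm w * norm (Y t) + c1 * norm w * norm (Y (t - int r))"
        by (intro order.trans[OF norm_triangle_ineq] add_mono c0 c1)
      also have "\<dots> \<le> (c0 + c1) * norm w * norm (Y t) + (c0 + c1) * norm w * norm (Y (t - int r))"
        using c0 c1 by (intro add_mono mult_right_mono) auto
      also have "\<dots> = ((c0 + c1) * norm w) * (norm (Y t) + norm (Y (t - int r)))"
        by (simp add: algebra_simps)
      also have "\<dots> \<le> \<eta> * (norm (Y t) + norm (Y (t - int r)))"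
        using w c0 c1 by (intro mult_right_mono) (auto simp: W_def field_simps)
      finally show "norm (Y (t + 1) - (M0 Pc (Y t) + M1 Pc (Y (t - int r)))) \<le> \<eta> * (norm (Y t) + norm (Y (t - int r)))" .
    qed
    then have Ylim: "(\<lambda>t :: nat. snd (Y (int t))) \<longlonglongrightarrow> 0"
      using tendsto_snd by fastforce
    define ev where "ev i t = virtual_error Ed a (\<lambda>i. Q $ i) F v x i t" for i t
    have zb_step: "zb (t + 1) $ i = G1 *v (zb t $ i) + G2 *v ev i t" if "0 \<le> t" for t i
      using cl that unfolding closed_loop_def Q ev_def by blast
    have "(\<lambda>t :: nat. ev i (int t) $ l) \<longlonglongrightarrow> 0" for i l
    proof (rule internal_model_regulates[of \<beta> \<sigma> "\<lambda>t. \<chi> k. zb (int t) $ i $ (l, k)"])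
      show "controllable \<beta> (columnvector \<sigma> :: real^1^'k)"
        using gen by (simp add: is_min_internal_model_generator_def)
      show "(\<chi> k. zb (int (Suc t)) $ i $ (l, k)) = \<beta> *v (\<chi> k. zb (int t) $ i $ (l, k)) + ev i (int t) $ l *\<^sub>R \<sigma>" for t
        using zb_step[of "int t" i]
        by (simp add: vec_eq_iff[where 'b = 'k] add.commute G internal_model_G1_mult internal_model_G2_mult)
      have "(\<lambda>t. \<chi> k. snd (Y (int t)) $ i $ (l, k)) \<longlonglongrightarrow> (\<chi> k. (0 :: (real^('p \<times> 'k))^'N) $ i $ (l, k))"
        by (intro tendsto_vec_lambda tendsto_vec_nth Ylim)
      moreover have "(\<chi> k. snd (Y (int t)) $ i $ (l, k))
          = (\<Sum>j\<le>degree ?f. coeff ?f j *\<^sub>R (\<chi> k. zb (int (t + j)) $ i $ (l, k)))" for t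
        by (simp add: Y_def X_def vec_eq_iff snd_sum)
      moreover have "(\<chi> k. (0 :: (real^('p \<times> 'k))^'N) $ i $ (l, k)) = (0 :: real^'k)" by (simp add: vec_eq_iff)
      ultimately show "(\<lambda>t. \<Sum>j\<le>degree ?f. coeff ?f j *\<^sub>R (\<chi> k. zb (int (t + j)) $ i $ (l, k))) \<longlonglongrightarrow> 0" by simp
    qed
    then have evlim: "(\<lambda>t :: nat. ev i (int t)) \<longlonglongrightarrow> 0" for i
      by (intro vec_tendstoI) simp
    define e where "e i t = regulated_output (\<lambda>i. Q $ i) F v x i t" for i t
    have bound: "(norm (e i t))\<^sup>2 \<le> 4 * (\<Sum>i\<in>UNIV. (d $ i)\<^sup>2 * (norm (ev i t))\<^sup>2)" for i t
    proof -
      have "(\<Sum>i\<in>UNIV. (norm (e i t))\<^sup>2) / 2 \<le> (\<Sum>i\<in>UNIV. d $ i * (e i t \<bullet> ev i t))"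
        using laplacian_weighted_coercive[OF graph d[unfolded H_def], of "\<lambda>i. e i t"]
        by (simp add: ev_def e_def virtual_error_eq_laplacian)
      also have "\<dots> \<le> (\<Sum>i\<in>UNIV. (norm (e i t))\<^sup>2 / 4 + (d $ i)\<^sup>2 * (norm (ev i t))\<^sup>2)"
      proof (rule sum_mono)
        fix i
        have "d $ i * (e i t \<bullet> ev i t) \<le> d $ i * (norm (e i t) * norm (ev i t))"
          using d(2)[of i] by (intro mult_left_mono norm_cauchy_schwarz) auto
        also have "\<dots> \<le> (norm (e i t))\<^sup>2 / 4 + (d $ i)\<^sup>2 * (norm (ev i t))\<^sup>2"
          using zero_le_power2[of "norm (e i t) / 2 - d $ i * norm (ev i t)"] by (simp add: power2_eq_square algebra_simps)
        finally show "d $ i * (e i t \<bullet> ev i t) \<le> \<dots>" .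
      qed
      also have "\<dots> = (\<Sum>i\<in>UNIV. (norm (e i t))\<^sup>2) / 4 + (\<Sum>i\<in>UNIV. (d $ i)\<^sup>2 * (norm (ev i t))\<^sup>2)"
        by (simp add: sum.distrib sum_divide_distrib)
      finally have "(\<Sum>i\<in>UNIV. (norm (e i t))\<^sup>2) \<le> 4 * (\<Sum>i\<in>UNIV. (d $ i)\<^sup>2 * (norm (ev i t))\<^sup>2)" by linarith
      moreover have "(norm (e i t))\<^sup>2 \<le> (\<Sum>i\<in>UNIV. (norm (e i t))\<^sup>2)" by (rule member_le_sum) auto
      ultimately show ?thesis by linarith
    qed
    have "(\<lambda>t :: nat. 4 * (\<Sum>i\<in>UNIV. (d $ i)\<^sup>2 * (norm (ev i (int t)))\<^sup>2)) \<longlonglongrightarrow> 4 * (\<Sum>i\<in>UNIV. (d $ i)\<^sup>2 * (norm (0 :: real^'p))\<^sup>2)"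
      by (intro tendsto_intros evlim)
    then have lim: "(\<lambda>t :: nat. 4 * (\<Sum>i\<in>UNIV. (d $ i)\<^sup>2 * (norm (ev i (int t)))\<^sup>2)) \<longlonglongrightarrow> 0" by simp
    have "(\<lambda>t :: nat. (norm (e i (int t)))\<^sup>2) \<longlonglongrightarrow> 0"
      by (rule Lim_null_comparison[OF always_eventually lim]) (use bound in simp)
    then have "(\<lambda>t :: nat. sqrt ((norm (e i (int t)))\<^sup>2)) \<longlonglongrightarrow> sqrt 0" by (rule tendsto_real_sqrt)
    then show ?thesis by (simp add: e_def Q tendsto_norm_zero_iff)
  qed
  show ?thesis
    unfolding solves_cooperative_robust_output_regulation_def
    using stable W reg by blast
qed

section \<open>Stabilizability of the plant with its internal model\<close>

lemma sum_UNIV_sum: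
  fixes f :: "'a::finite + 'b::finite \<Rightarrow> 'c::comm_monoid_add"
  shows "(\<Sum>x\<in>UNIV. f x) = (\<Sum>a\<in>UNIV. f (Inl a)) + (\<Sum>b\<in>UNIV. f (Inr b))"
  using sum.Plus[of UNIV UNIV f] by (simp add: o_def)

lemma complex_matrix_add: "complex_matrix (M + L) = complex_matrix M + complex_matrix L"
  by (simp add: complex_matrix_def vec_eq_iff)

lemma complex_matrix_mult: "complex_matrix (M ** L) = complex_matrix M ** complex_matrix L"
  by (simp add: complex_matrix_def matrix_matrix_mult_def vec_eq_iff)

lemma left_eigenvalue_in_spectrum:
  "w \<noteq> 0 \<Longrightarrow> w v* complex_matrix M = l *s w \<Longrightarrow> l \<in> spectrum M"
  using left_eigenvalue_iff[of "complex_matrix M" l] unfolding spectrum_def by blast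

lemma stabilizable_imp_hautus:
  assumes "stabilizable A B"
  shows "hautus_stabilizable (complex_matrix A) (complex_matrix B)"
  unfolding hautus_stabilizable_def
proof (intro allI impI notI, elim conjE)
  fix w l assume w: "w \<noteq> 0" "w v* complex_matrix A = l *s w" "1 \<le> cmod l" and 0: "w v* complex_matrix B = 0"
  obtain K where K: "\<And>l. l \<in> spectrum (A + B ** K) \<Longrightarrow> cmod l < 1"
    using assms by (auto simp: stabilizable_def)
  have "w v* complex_matrix (A + B ** K) = l *s w"
    using w 0 by (simp add: complex_matrix_add complex_matrix_mult vector_matrix_mult_add_rdistrib flip: vector_matrix_mul_assoc)
  then show False using K[OF left_eigenvalue_in_spectrum[OF w(1)]] w(3) by force
qed

text \<open>A relation between the rows expresses one of them by the others, so fewer vectors than the rank would span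
the row space.\<close>

lemma full_row_rank_left_kernel:
  fixes M :: "'a::field^'n^'m"
  assumes rank: "rank M = CARD('m)" and 0: "\<rho> v* M = 0"
  shows "\<rho> = 0"
proof (rule ccontr)
  assume "\<rho> \<noteq> 0"
  then obtain i where i: "\<rho> $ i \<noteq> 0" by (auto simp: vec_eq_iff)
  let ?R = "(\<lambda>j. row j M) ` (UNIV - {i})"
  have "(\<Sum>j\<in>UNIV. \<rho> $ j *s row j M) = 0"
    using 0 by (simp add: vec_eq_iff vector_matrix_mult_def row_def mult.commute)
  then have "\<rho> $ i *s row i M + (\<Sum>j\<in>UNIV - {i}. \<rho> $ j *s row j M) = 0"
    by (simp add: sum.remove[of UNIV i])
  then have "\<rho> $ i *s row i M = - (\<Sum>j\<in>UNIV - {i}. \<rho> $ j *s row j M)" by (simp add: eq_neg_iff_add_eq_0)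
  moreover have "- (\<Sum>j\<in>UNIV - {i}. \<rho> $ j *s row j M) \<in> vec.span ?R"
    by (intro vec.span_neg vec.span_sum vec.span_scale vec.span_base) auto
  ultimately have "inverse (\<rho> $ i) *s (\<rho> $ i *s row i M) \<in> vec.span ?R"
    by (metis vec.span_scale)
  then have "row i M \<in> vec.span ?R" using i by (simp add: vector_smult_assoc)
  then have "row j M \<in> vec.span ?R" for j
    by (cases "j = i") (auto intro: vec.span_base)
  then have "rows M \<subseteq> vec.span ?R" by (auto simp: rows_def)
  then have "vec.dim (rows M) \<le> card ?R" by (rule vec.dim_le_card) simp
  also have "\<dots> \<le> card (UNIV - {i})" by (rule card_image_le) simp
  also have "\<dots> < CARD('m)" by (simp add: card_Diff_singleton)
  finally show False using rank by (simp add: row_rank_def_gen)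
qed

text \<open>The controller state has no input of its own.\<close>

definition input_block :: "real^'m^'n \<Rightarrow> real^'m^('n::finite + 'z::finite)" where
  "input_block B = (\<chi> i j. case i of Inl a \<Rightarrow> B $ a $ j | Inr _ \<Rightarrow> 0)"

definition left_part :: "'a^('n::finite + 'z::finite) \<Rightarrow> 'a^'n" where
  "left_part w = (\<chi> a. w $ Inl a)"

definition right_part :: "'a^('n::finite + 'z::finite) \<Rightarrow> 'a^'z" where
  "right_part w = (\<chi> b. w $ Inr b)"

definition join :: "'a^'n::finite \<Rightarrow> 'a^'z::finite \<Rightarrow> 'a^('n + 'z)" where
  "join x z = (\<chi> c. case c of Inl a \<Rightarrow> x $ a | Inr b \<Rightarrow> z $ b)"

lemma join_parts: "left_part (join x z) = x" "right_part (join x z) = z" "join (left_part w) (right_part w) = w"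
  by (auto simp: left_part_def right_part_def join_def vec_eq_iff split: sum.splits)

lemma vec_sum_eq_iff: "w = w' \<longleftrightarrow> left_part w = left_part w' \<and> right_part w = right_part w'"
  by (metis join_parts(3))

lemma block_matrix_left_mult:
  fixes w :: "'a::comm_ring_1^('n::finite + 'z::finite)"
  shows "left_part (w v* block_matrix M11 M12 M21 M22) = left_part w v* M11 + right_part w v* M21"
    "right_part (w v* block_matrix M11 M12 M21 M22) = left_part w v* M12 + right_part w v* M22"
  by (simp_all add: vec_eq_iff left_part_def right_part_def block_matrix_def vector_matrix_mult_def sum_UNIV_sum)

lemma block_matrix_mult_join:
  fixes x :: "'a::comm_ring_1^'n::finite" and z :: "'a^'z::finite"
  shows "block_matrix M11 M12 M21 M22 *v join x z = join (M11 *v x + M12 *v z) (M21 *v x + M22 *v z)"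
  by (simp add: vec_eq_iff join_def block_matrix_def matrix_vector_mult_def sum_UNIV_sum split: sum.splits)

lemma complex_block_matrix:
  "complex_matrix (block_matrix M11 M12 M21 M22)
    = block_matrix (complex_matrix M11) (complex_matrix M12) (complex_matrix M21) (complex_matrix M22)"
  by (simp add: vec_eq_iff complex_matrix_def block_matrix_def split: sum.splits)

lemma input_block_left_mult:
  "w v* complex_matrix (input_block B) = left_part w v* complex_matrix B"
  by (simp add: vec_eq_iff left_part_def complex_matrix_def input_block_def vector_matrix_mult_def sum_UNIV_sum)

lemma input_block_mult: "input_block B *v u = join (B *v u) 0"
  by (simp add: vec_eq_iff join_def input_block_def matrix_vector_mult_def split: sum.splits)

text \<open>The vector annihilates all \<open>\<beta>\<^sup>i \<sigma>\<close>, which span the real space; hence its real and imaginary parts vanish.\<close>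

lemma controllable_left_eigenvector:
  fixes \<beta> :: "real^'k^'k"
  assumes ctr: "controllable \<beta> (columnvector \<sigma> :: real^1^'k)"
    and u: "u v* complex_matrix \<beta> = l *s u" "scalar_product u (complex_vector \<sigma>) = 0"
  shows "u = 0"
proof -
  let ?b = "\<lambda>i. ((*v) \<beta> ^^ i) \<sigma>"
  have cv: "complex_vector (\<beta> *v x) = complex_matrix \<beta> *v complex_vector x" for x
    by (simp add: complex_vector_def complex_matrix_def matrix_vector_mult_def vec_eq_iff)
  have z: "scalar_product u (complex_vector (?b i)) = 0" for i
    by (induction i) (simp_all add: u cv scalar_product_linear flip: scalar_product_vector_matrix)
  have sp: "Re (scalar_product u (complex_vector x)) = Re_vector u \<bullet> x"
    "Im (scalar_product u (complex_vector x)) = Im_vector u \<bullet> x" for x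
    by (simp_all add: scalar_product_def complex_vector_def Re_vector_def Im_vector_def inner_vec_def)
  have orth: "orthogonal (Re_vector u) (?b i)" "orthogonal (Im_vector u) (?b i)" for i
    using z[of i] sp[of "?b i"] by (simp_all add: orthogonal_def)
  have span: "span (?b ` {..<CARD('k)}) = UNIV"
    using controllable_krylov[OF ctr] dim_eq_full[of "?b ` {..<CARD('k)}"] by simp
  have "orthogonal (Re_vector u) y \<and> orthogonal (Im_vector u) y" for y
    using orthogonal_to_span[of y "?b ` {..<CARD('k)}"] orth span by auto
  then have "Re_vector u = 0" "Im_vector u = 0" by (metis orthogonal_self)+
  then show ?thesis by (simp add: vec_eq_iff Re_vector_def Im_vector_def complex_eq_iff)
qed

lemma internal_model_left_mult:
  shows "(w v* complex_matrix (internal_model_G1 \<beta>)) $ (l, k) = ((\<chi> k. w $ (l, k)) v* complex_matrix \<beta>) $ k"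
    "(w v* complex_matrix (internal_model_G2 \<sigma>)) $ l = scalar_product (\<chi> k. w $ (l, k)) (complex_vector \<sigma>)"
proof -
  have "(w v* complex_matrix (internal_model_G1 \<beta>)) $ (l, k)
      = (\<Sum>x\<in>UNIV. if fst x = l then w $ x * complex_of_real (\<beta> $ snd x $ k) else 0)"
    unfolding internal_model_G1_def kronecker_def vector_matrix_mult_def mat_def complex_matrix_def
    by (auto intro!: sum.cong)
  then show "(w v* complex_matrix (internal_model_G1 \<beta>)) $ (l, k) = ((\<chi> k. w $ (l, k)) v* complex_matrix \<beta>) $ k"
    by (simp add: sum_pair_row vector_matrix_mult_def complex_matrix_def mult.commute)
  have "(w v* complex_matrix (internal_model_G2 \<sigma>)) $ l
      = (\<Sum>x\<in>UNIV. if fst x = l then w $ x * complex_of_real (\<sigma> $ snd x) else 0)"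
    unfolding internal_model_G2_def kronecker_def vector_matrix_mult_def mat_def complex_matrix_def columnvector_def
    by (auto intro!: sum.cong)
  then show "(w v* complex_matrix (internal_model_G2 \<sigma>)) $ l = scalar_product (\<chi> k. w $ (l, k)) (complex_vector \<sigma>)"
    by (simp add: sum_pair_row scalar_product_def complex_vector_def)
qed

text \<open>Some component of \<open>w\<close> along one of the copies of \<open>\<beta>\<close> is nonzero, and it is a left eigenvector of \<open>\<beta>\<close>.\<close>

lemma internal_model_left_eigenvector:
  fixes S :: "real^'q^'q" and \<beta> :: "real^'k::finite^'k" and w :: "complex^('p::finite \<times> 'k)"
  assumes gen: "is_min_internal_model_generator S \<beta> \<sigma>"
    and w: "w \<noteq> 0" "w v* complex_matrix (internal_model_G1 \<beta>) = l *s w"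
  shows "l \<in> spectrum S" "w v* complex_matrix (internal_model_G2 \<sigma>) \<noteq> 0"
proof -
  obtain l0 k0 where "w $ (l0, k0) \<noteq> 0" using w(1) by (auto simp: vec_eq_iff)
  define u where "u = (\<chi> k. w $ (l0, k))"
  have u0: "u \<noteq> 0" using \<open>w $ (l0, k0) \<noteq> 0\<close> by (auto simp: u_def vec_eq_iff)
  have u\<beta>: "u v* complex_matrix \<beta> = l *s u"
    using arg_cong[OF w(2), of "\<lambda>x. x $ (l0, _)"]
    by (simp add: vec_eq_iff[where 'b = 'k] u_def internal_model_left_mult)
  obtain v where "v \<noteq> 0" "complex_matrix \<beta> *v v = l *s v"
    using left_eigenvalue_iff[of "complex_matrix \<beta>" l] u0 u\<beta> by blast
  then show "l \<in> spectrum S"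
    using gen eigenvalue_min_internal_model by (auto simp: is_min_internal_model_generator_def)
  show "w v* complex_matrix (internal_model_G2 \<sigma>) \<noteq> 0"
  proof
    assume "w v* complex_matrix (internal_model_G2 \<sigma>) = 0"
    then have "scalar_product u (complex_vector \<sigma>) = 0"
      unfolding u_def by (simp flip: internal_model_left_mult(2))
    then have "u = 0"
      using gen u\<beta> controllable_left_eigenvector by (auto simp: is_min_internal_model_generator_def)
    then show False using u0 by simp
  qed
qed

text \<open>A left eigenvector \<open>(w\<^sub>1, w\<^sub>2)\<close> with \<open>w\<^sub>2 = 0\<close> is one of \<open>A\<close>. Otherwise \<open>w\<^sub>2\<close> is a left eigenvector of \<open>G1\<close>, its
eigenvalue lies in the spectrum of \<open>S\<close>, and if the input does not see it, then \<open>(w\<^sub>1, w\<^sub>2 G2)\<close> is in the left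
kernel of the matrix in the rank condition. So \<open>w\<^sub>2 G2 = 0\<close>, against the controllability of \<open>(\<beta>, \<sigma>)\<close>.\<close>

lemma plant_with_internal_model:
  fixes A :: "real^('n::finite)^'n" and B :: "real^'m^'n" and C :: "real^'n^('p::finite)" and S :: "real^'q^'q"
    and \<beta> :: "real^'k::finite^'k"
  assumes stab: "stabilizable A B"
    and rank_cond: "\<And>l. l \<in> spectrum S \<Longrightarrow>
      rank (block_matrix (complex_matrix A - mat l) (complex_matrix B) (complex_matrix C) 0)
        = CARD('n) + CARD('p)"
    and S_unit: "\<And>l. l \<in> spectrum S \<Longrightarrow> cmod l = 1"
    and A_disc: "\<And>l. l \<in> spectrum A \<Longrightarrow> cmod l \<le> 1"
    and gen: "is_min_internal_model_generator S \<beta> \<sigma>"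
    and G: "G1 = internal_model_G1 \<beta>" "G2 = internal_model_G2 \<sigma>"
  shows "hautus_stabilizable (complex_matrix (block_matrix A 0 (G2 ** C) G1)) (complex_matrix (input_block B))" (is ?stab)
    and "left_spectrum_in_disc (complex_matrix (block_matrix A 0 (G2 ** C) G1))" (is ?disc)
proof -
  let ?A = "block_matrix A 0 (G2 ** C) G1"
  have c0: "complex_matrix 0 = 0" by (simp add: complex_matrix_def vec_eq_iff)
  have parts: "left_part w v* complex_matrix A + right_part w v* complex_matrix (G2 ** C) = l *s left_part w"
    "right_part w v* complex_matrix G1 = l *s right_part w"
    if "w v* complex_matrix ?A = l *s w" for w l
  proof -
    have "left_part (w v* complex_matrix ?A) = l *s left_part w" "right_part (w v* complex_matrix ?A) = l *s right_part w"
      unfolding that by (simp_all add: left_part_def right_part_def vec_eq_iff)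
    then show "left_part w v* complex_matrix A + right_part w v* complex_matrix (G2 ** C) = l *s left_part w"
      "right_part w v* complex_matrix G1 = l *s right_part w"
      by (simp_all add: complex_block_matrix block_matrix_left_mult c0)
  qed
  have zero: "w = 0" if "left_part w = 0" "right_part w = 0" for w :: "complex^('n + ('p \<times> 'k))"
    using that by (subst vec_sum_eq_iff) (simp add: left_part_def right_part_def vec_eq_iff)
  show ?disc
    unfolding left_spectrum_in_disc_def
  proof (intro allI impI, elim conjE)
    fix w l assume w: "w \<noteq> 0" "w v* complex_matrix ?A = l *s w"
    show "cmod l \<le> 1"
    proof (cases "right_part w = 0")
      case True
      then have "left_part w \<noteq> 0" using zero w(1) by blast
      moreover have "left_part w v* complex_matrix A = l *s left_part w" using parts[OF w(2)] True by simp
      ultimately show ?thesis using A_disc left_eigenvalue_in_spectrum by blast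
    next
      case False
      then have "l \<in> spectrum S"
        using internal_model_left_eigenvector(1)[OF gen False] parts(2)[OF w(2)] G by simp
      then show ?thesis using S_unit by simp
    qed
  qed
  show ?stab
    unfolding hautus_stabilizable_def
  proof (intro allI impI notI, elim conjE)
    fix w l assume w: "w \<noteq> 0" "w v* complex_matrix ?A = l *s w" "1 \<le> cmod l"
      and "w v* complex_matrix (input_block B) = 0"
    then have B0: "left_part w v* complex_matrix B = 0" by (simp add: input_block_left_mult)
    show False
    proof (cases "right_part w = 0")
      case True
      then have "left_part w \<noteq> 0" using zero w(1) by blast
      moreover have "left_part w v* complex_matrix A = l *s left_part w" using parts[OF w(2)] True by simp
      ultimately show ?thesis
        using stabilizable_imp_hautus[OF stab] w(3) B0 by (auto simp: hautus_stabilizable_def)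
    next
      case False
      note im = internal_model_left_eigenvector[OF gen False parts(2)[OF w(2), unfolded G]]
      define \<rho> where "\<rho> = join (left_part w) (right_part w v* complex_matrix G2)"
      have mat: "x v* mat c = c *s x" for x :: "complex^'n" and c
        by (simp add: vec_eq_iff vector_matrix_mult_def mat_def if_distrib[of "\<lambda>c. _ * c"] if_distrib[of "\<lambda>c. c * _"] cong: if_cong)
      have "\<rho> v* block_matrix (complex_matrix A - mat l) (complex_matrix B) (complex_matrix C) 0 = 0"
      proof (subst vec_sum_eq_iff, intro conjI)
        have "left_part w v* complex_matrix A - l *s left_part w + (right_part w v* complex_matrix G2) v* complex_matrix C = 0"
          using parts(1)[OF w(2)] by (simp add: complex_matrix_mult vector_matrix_mul_assoc algebra_simps)
        then show "left_part (\<rho> v* block_matrix (complex_matrix A - mat l) (complex_matrix B) (complex_matrix C) 0) = left_part 0"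
          by (simp add: block_matrix_left_mult \<rho>_def join_parts vector_matrix_mult_diff_rdistrib mat)
             (simp add: left_part_def vec_eq_iff)
        show "right_part (\<rho> v* block_matrix (complex_matrix A - mat l) (complex_matrix B) (complex_matrix C) 0) = right_part 0"
          by (simp add: block_matrix_left_mult \<rho>_def join_parts B0) (simp add: right_part_def vec_eq_iff)
      qed
      then have "\<rho> = 0"
        by (rule full_row_rank_left_kernel[rotated]) (simp add: rank_cond[OF im(1)])
      then have "right_part \<rho> = 0" by (simp add: right_part_def vec_eq_iff)
      then show False using im(2) by (simp add: \<rho>_def join_parts G)
    qed
  qed
qed

section \<open>The distributed control law\<close>

lemma norm_join: "(norm (join x z))\<^sup>2 = (norm (x :: real^'n::finite))\<^sup>2 + (norm (z :: real^'z::finite))\<^sup>2"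
  unfolding power2_norm_eq_inner by (simp add: inner_vec_def sum_UNIV_sum join_def)

lemma norm_vec_squared: "(norm (x :: ('a::real_inner)^'n))\<^sup>2 = (\<Sum>i\<in>UNIV. (norm (x $ i))\<^sup>2)"
  unfolding power2_norm_eq_inner by (simp add: inner_vec_def)

lemma norm_Pair_squared: "(norm (p :: 'a::real_inner \<times> 'b::real_inner))\<^sup>2 = (norm (fst p))\<^sup>2 + (norm (snd p))\<^sup>2"
  by (cases p) (simp add: norm_Pair)

text \<open>In the coordinates \<open>\<zeta> = H\<^sup>-\<^sup>1 zb\<close> every controller state is driven by the output of its own
  follower only, and the inputs are the Laplacian applied to a common feedback of the states \<open>(x, \<zeta>)\<close>.\<close>

theorem nominal_loop_stabilizable:
  fixes P :: "('n::finite, 'm::finite, 'p::finite, 'q::finite) plant" and F :: "real^'q^'p"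
    and Ed :: "('N::finite option \<times> 'N option) set" and a :: "'N option \<Rightarrow> 'N option \<Rightarrow> real"
    and G1 :: "real^('z::finite)^'z" and S :: "real^'q^'q"
  assumes graph: "weighted_adjacency Ed a" and reach: "\<And>v. (None, v) \<in> Ed\<^sup>*"
    and stab: "hautus_stabilizable (complex_matrix (block_matrix (plant_A P) 0 (G2 ** plant_C P) G1))
      (complex_matrix (input_block (plant_B P)))"
    and disc: "left_spectrum_in_disc (complex_matrix (block_matrix (plant_A P) 0 (G2 ** plant_C P) G1))"
  shows "\<exists>(Kx :: real^'n^'m) (Kz :: real^'z^'m). exponentially_stable (rcom + rcon)
       (\<lambda>X :: int \<Rightarrow> ((real^'n)^'N) \<times> ((real^'z)^'N).
          closed_loop Ed a rcom rcon S F (\<lambda>i. P) G1 G2 Kx Kz (\<lambda>t. 0) (\<lambda>t. fst (X t)) (\<lambda>t. snd (X t)))"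
proof -
  let ?A = "plant_A P" and ?B = "plant_B P" and ?C = "plant_C P"
  define H where "H = leader_laplacian Ed a"
  define r where "r = rcom + rcon"
  obtain d where d: "d v* H = vec 1" "\<And>i. 0 < d $ i"
    unfolding H_def using laplacian_positive_weights[OF graph reach] by metis
  obtain J where J: "H ** J = mat 1" "J ** H = mat 1"
    using laplacian_invertible[OF graph reach] unfolding H_def invertible_def by blast
  have coercive: "(\<Sum>i\<in>UNIV. (norm (q i))\<^sup>2) / 2 \<le> (\<Sum>i\<in>UNIV. d $ i * (q i \<bullet> (\<Sum>j\<in>UNIV. H $ i $ j *\<^sub>R q j)))"
    for q :: "'N \<Rightarrow> real^'m"
    unfolding H_def by (rule laplacian_weighted_coercive[OF graph d[unfolded H_def]])
  obtain K :: "real^('n + 'z)^'m" and M \<rho> where M: "0 < M" "0 < \<rho>" "\<rho> < 1"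
    and decay: "\<And>(\<xi> :: int \<Rightarrow> 'N \<Rightarrow> real^('n + 'z)) t. (\<forall>t\<ge>0. \<forall>i. \<xi> (t + 1) i = block_matrix ?A 0 (G2 ** ?C) G1 *v \<xi> t i
        + input_block ?B *v (\<Sum>j\<in>UNIV. H $ i $ j *\<^sub>R (K *v \<xi> (t - int r) j))) \<Longrightarrow>
      (\<Sum>i\<in>UNIV. (norm (\<xi> (int t) i))\<^sup>2) \<le> M * \<rho> ^ t * (\<Sum>s\<in>{- int r..0}. \<Sum>i\<in>UNIV. (norm (\<xi> s i))\<^sup>2)"
    using low_gain_network_stabilization[where r = r, OF stab disc d(2) coercive] by blast
  define Kx where "Kx = (\<chi> i j. K $ i $ Inl j)"
  define Kz where "Kz = (\<chi> i j. K $ i $ Inr j)"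
  have K: "K *v join x z = Kx *v x + Kz *v z" for x z
    by (simp add: vec_eq_iff matrix_vector_mult_def Kx_def Kz_def join_def sum_UNIV_sum)
  define cH where "cH = (\<Sum>i\<in>UNIV. \<Sum>j\<in>UNIV. (H $ i $ j)\<^sup>2)"
  define cJ where "cJ = (\<Sum>i\<in>UNIV. \<Sum>j\<in>UNIV. (J $ i $ j)\<^sup>2)"
  have c0: "0 \<le> cH" "0 \<le> cJ" by (simp_all add: cH_def cJ_def sum_nonneg)
  define M' where "M' = (1 + cH) * (M * (real (r + 1) * (1 + cJ)))"
  have M': "0 < M'" unfolding M'_def using c0 M by (intro mult_pos_pos) auto
  have "norm (X (int t)) \<le> sqrt M' * sqrt \<rho> ^ t * Max ((\<lambda>s. norm (X s)) ` {- int r..0})"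
    if cl: "closed_loop Ed a rcom rcon S F (\<lambda>i. P) G1 G2 Kx Kz (\<lambda>t. 0) (\<lambda>t. fst (X t)) (\<lambda>t. snd (X t))"
    for X :: "int \<Rightarrow> ((real^'n)^'N) \<times> ((real^'z)^'N)" and t
  proof -
    define x where "x t i = fst (X t) $ i" for t i
    define zb where "zb t i = snd (X t) $ i" for t i
    define \<zeta> where "\<zeta> t i = (\<Sum>j\<in>UNIV. J $ i $ j *\<^sub>R zb t j)" for t i
    have mix: "(\<Sum>j\<in>UNIV. L $ i $ j *\<^sub>R (\<Sum>k\<in>UNIV. L' $ j $ k *\<^sub>R y k)) = (\<Sum>k\<in>UNIV. (L ** L') $ i $ k *\<^sub>R y k)"
      for L L' :: "real^'N^'N" and y :: "'N \<Rightarrow> 'v::real_vector" and i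
    proof -
      have "(\<Sum>j\<in>UNIV. L $ i $ j *\<^sub>R (\<Sum>k\<in>UNIV. L' $ j $ k *\<^sub>R y k)) = (\<Sum>j\<in>UNIV. \<Sum>k\<in>UNIV. (L $ i $ j * L' $ j $ k) *\<^sub>R y k)"
        by (simp add: scaleR_sum_right)
      also have "\<dots> = (\<Sum>k\<in>UNIV. \<Sum>j\<in>UNIV. (L $ i $ j * L' $ j $ k) *\<^sub>R y k)" by (rule sum.swap)
      finally show ?thesis by (simp add: matrix_matrix_mult_def scaleR_sum_left)
    qed
    have one: "(\<Sum>k\<in>UNIV. (mat 1 :: real^'N^'N) $ i $ k *\<^sub>R y k) = y i" for y :: "'N \<Rightarrow> 'v::real_vector" and i
      by (simp add: mat_def if_distrib[of "\<lambda>c. c *\<^sub>R _"] cong: if_cong)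
    have zb: "zb t i = (\<Sum>j\<in>UNIV. H $ i $ j *\<^sub>R \<zeta> t j)" for t i
      unfolding \<zeta>_def mix J one ..
    have linsum: "L *v (\<Sum>j\<in>UNIV. c j *\<^sub>R y j) = (\<Sum>j\<in>UNIV. c j *\<^sub>R (L *v y j))" for L :: "real^'c^'e" and c :: "'N \<Rightarrow> real" and y
      by (simp add: matrix_vector_mult_sum matrix_vector_mult_scaleR)
    have x_step: "x (t + 1) i = ?A *v x t i + ?B *v (\<Sum>j\<in>UNIV. H $ i $ j *\<^sub>R (K *v join (x (t - int r) j) (\<zeta> (t - int r) j)))"
      and zb_step: "zb (t + 1) i = G1 *v zb t i + G2 *v (\<Sum>j\<in>UNIV. H $ i $ j *\<^sub>R (?C *v x t j))"
      if t: "0 \<le> t" for t i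
    proof -
      have *: "x (t + 1) i = ?A *v x t i + ?B *v control_input Ed a rcom Kx Kz (\<lambda>t. fst (X t)) (\<lambda>t. snd (X t)) i (t - int rcon)"
        "zb (t + 1) i = G1 *v zb t i + G2 *v virtual_error Ed a (\<lambda>i. P) F (\<lambda>t. 0) (\<lambda>t. fst (X t)) i t"
        using cl t unfolding closed_loop_def x_def zb_def by simp_all
      have dl: "t - int rcon - int rcom = t - int r" by (simp add: r_def)
      show "x (t + 1) i = ?A *v x t i + ?B *v (\<Sum>j\<in>UNIV. H $ i $ j *\<^sub>R (K *v join (x (t - int r) j) (\<zeta> (t - int r) j)))"
        unfolding *(1) control_input_def relative_state_eq_laplacian dl H_def[symmetric]
        by (simp add: x_def[symmetric] zb_def[symmetric] zb K linsum scaleR_right_distrib sum.distrib)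
      show "zb (t + 1) i = G1 *v zb t i + G2 *v (\<Sum>j\<in>UNIV. H $ i $ j *\<^sub>R (?C *v x t j))"
        unfolding *(2) virtual_error_eq_laplacian H_def[symmetric]
        by (simp add: regulated_output_def node_output_def x_def)
    qed
    have \<zeta>_step: "\<zeta> (t + 1) i = G1 *v \<zeta> t i + G2 *v (?C *v x t i)" if t: "0 \<le> t" for t i
    proof -
      have "\<zeta> (t + 1) i = (\<Sum>j\<in>UNIV. J $ i $ j *\<^sub>R (G1 *v zb t j))
          + (\<Sum>j\<in>UNIV. J $ i $ j *\<^sub>R (\<Sum>k\<in>UNIV. H $ j $ k *\<^sub>R (G2 *v (?C *v x t k))))"
        by (simp add: \<zeta>_def zb_step[OF t] linsum scaleR_right_distrib sum.distrib)
      also have "\<dots> = G1 *v \<zeta> t i + G2 *v (?C *v x t i)"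
        unfolding mix J one by (simp add: \<zeta>_def linsum)
      finally show ?thesis .
    qed
    define \<xi> where "\<xi> t i = join (x t i) (\<zeta> t i)" for t i
    have join_add: "join u v + join u' v' = join (u + u') (v + v')" for u u' :: "real^'n" and v v' :: "real^'z"
      by (simp add: join_def vec_eq_iff split: sum.splits)
    have \<xi>_step: "\<xi> (t + 1) i = block_matrix ?A 0 (G2 ** ?C) G1 *v \<xi> t i
        + input_block ?B *v (\<Sum>j\<in>UNIV. H $ i $ j *\<^sub>R (K *v \<xi> (t - int r) j))" if t: "0 \<le> t" for t i
      by (simp add: \<xi>_def x_step[OF t] \<zeta>_step[OF t] block_matrix_mult_join input_block_mult join_add
          flip: matrix_vector_mul_assoc) (simp add: add.commute)
    define E where "E t = (\<Sum>i\<in>UNIV. (norm (\<xi> t i))\<^sup>2)" for t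
    have E: "E t = (\<Sum>i\<in>UNIV. (norm (x t i))\<^sup>2) + (\<Sum>i\<in>UNIV. (norm (\<zeta> t i))\<^sup>2)" for t
      by (simp add: E_def \<xi>_def norm_join sum.distrib)
    have NX: "(norm (X t))\<^sup>2 = (\<Sum>i\<in>UNIV. (norm (x t i))\<^sup>2) + (\<Sum>i\<in>UNIV. (norm (zb t i))\<^sup>2)" for t
      by (simp add: norm_Pair_squared norm_vec_squared x_def zb_def)
    have nn: "0 \<le> (\<Sum>i\<in>UNIV. (norm (x t i))\<^sup>2)" "0 \<le> (\<Sum>i\<in>UNIV. (norm (zb t i))\<^sup>2)" "0 \<le> (\<Sum>i\<in>UNIV. (norm (\<zeta> t i))\<^sup>2)" for t
      by (simp_all add: sum_nonneg)
    have XE: "(norm (X t))\<^sup>2 \<le> (1 + cH) * E t" for t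
    proof -
      have "(\<Sum>i\<in>UNIV. (norm (zb t i))\<^sup>2) \<le> cH * (\<Sum>i\<in>UNIV. (norm (\<zeta> t i))\<^sup>2)"
        unfolding zb cH_def by (rule sum_norm_squared_mix_le)
      moreover have "0 \<le> cH * (\<Sum>i\<in>UNIV. (norm (x t i))\<^sup>2)" using c0 nn by simp
      ultimately show ?thesis using nn(3)[of t] unfolding NX E by (simp add: algebra_simps)
    qed
    have EX: "E t \<le> (1 + cJ) * (norm (X t))\<^sup>2" for t
    proof -
      have "(\<Sum>i\<in>UNIV. (norm (\<zeta> t i))\<^sup>2) \<le> cJ * (\<Sum>i\<in>UNIV. (norm (zb t i))\<^sup>2)"
        unfolding \<zeta>_def cJ_def by (rule sum_norm_squared_mix_le)
      moreover have "0 \<le> cJ * (\<Sum>i\<in>UNIV. (norm (x t i))\<^sup>2)" using c0 nn by simp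
      ultimately show ?thesis using nn(2)[of t] unfolding NX E by (simp add: algebra_simps)
    qed
    define h where "h = Max ((\<lambda>s. norm (X s)) ` {- int r..0})"
    have hX: "norm (X s) \<le> h" if "s \<in> {- int r..0}" for s
      unfolding h_def by (rule Max_ge) (use that in auto)
    have h0: "0 \<le> h" using hX[of 0] norm_ge_zero[of "X 0"] by (simp del: norm_ge_zero)
    have "(\<Sum>s\<in>{- int r..0}. E s) \<le> (\<Sum>s\<in>{- int r..0}. (1 + cJ) * h\<^sup>2)"
      using c0 by (intro sum_mono order.trans[OF EX] mult_left_mono power_mono hX) auto
    also have "\<dots> = real (r + 1) * (1 + cJ) * h\<^sup>2" by (simp add: algebra_simps)
    finally have hist: "(\<Sum>s\<in>{- int r..0}. E s) \<le> \<dots>" .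
    have "(norm (X (int t)))\<^sup>2 \<le> (1 + cH) * E (int t)" by (rule XE)
    also have "\<dots> \<le> (1 + cH) * (M * \<rho> ^ t * (\<Sum>s\<in>{- int r..0}. E s))"
      using c0 decay[of \<xi> t] \<xi>_step by (intro mult_left_mono) (auto simp: E_def)
    also have "\<dots> \<le> (1 + cH) * (M * \<rho> ^ t * (real (r + 1) * (1 + cJ) * h\<^sup>2))"
      using c0 M by (intro mult_left_mono hist) auto
    also have "\<dots> = M' * \<rho> ^ t * h\<^sup>2" by (simp add: M'_def mult_ac)
    finally have "norm (X (int t)) \<le> sqrt (M' * \<rho> ^ t * h\<^sup>2)" by (rule real_le_rsqrt)
    then show ?thesis using h0 by (simp add: h_def real_sqrt_mult real_sqrt_power)
  qed
  then have "exponentially_stable r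
       (\<lambda>X :: int \<Rightarrow> ((real^'n)^'N) \<times> ((real^'z)^'N).
          closed_loop Ed a rcom rcon S F (\<lambda>i. P) G1 G2 Kx Kz (\<lambda>t. 0) (\<lambda>t. fst (X t)) (\<lambda>t. snd (X t)))"
    unfolding exponentially_stable_def using M M'
    by (intro exI[of _ "sqrt M'"] exI[of _ "sqrt \<rho>"]) simp
  then show ?thesis unfolding r_def by blast
qed

section \<open>Necessity of the spanning tree\<close>

text \<open>The tree is built by giving every node a parent that is strictly closer to the root.\<close>

lemma contains_directed_spanning_tree_iff_reachable:
  "contains_directed_spanning_tree Ed r \<longleftrightarrow> (\<forall>v. (r, v) \<in> Ed\<^sup>*)"
proof
  assume "contains_directed_spanning_tree Ed r"
  then obtain T where "T \<subseteq> Ed" "\<And>v. (r, v) \<in> T\<^sup>*"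
    by (auto simp: contains_directed_spanning_tree_def is_directed_tree_def)
  then show "\<forall>v. (r, v) \<in> Ed\<^sup>*" using rtrancl_mono by blast
next
  assume reach: "\<forall>v. (r, v) \<in> Ed\<^sup>*"
  define dist where "dist v = (LEAST n. (r, v) \<in> Ed ^^ n)" for v
  have dist: "(r, v) \<in> Ed ^^ dist v" for v
    unfolding dist_def using reach rtrancl_power[of "(r, v)" Ed] by (metis LeastI_ex)
  have dist_le: "(r, v) \<in> Ed ^^ n \<Longrightarrow> dist v \<le> n" for v n
    unfolding dist_def by (rule Least_le)
  have "\<exists>u. (u, v) \<in> Ed \<and> dist u < dist v" if "v \<noteq> r" for v
  proof -
    obtain m where m: "dist v = Suc m" using dist[of v] \<open>v \<noteq> r\<close> by (cases "dist v") auto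
    then obtain u where u: "(r, u) \<in> Ed ^^ m" "(u, v) \<in> Ed" using dist[of v] by auto
    then show ?thesis using dist_le[OF u(1)] m by auto
  qed
  then obtain p where p: "\<And>v. v \<noteq> r \<Longrightarrow> (p v, v) \<in> Ed \<and> dist (p v) < dist v" by metis
  define T where "T = {(p v, v) | v. v \<noteq> r}"
  have "(r, v) \<in> T\<^sup>*" for v
  proof (induction "dist v" arbitrary: v rule: less_induct)
    case less
    show ?case
    proof (cases "v = r")
      case False
      then have "(r, p v) \<in> T\<^sup>*" "(p v, v) \<in> T" using less p by (auto simp: T_def)
      then show ?thesis by (rule rtrancl_into_rtrancl)
    qed simp
  qed
  then have "is_directed_tree T r" by (auto simp: is_directed_tree_def T_def)
  moreover have "T \<subseteq> Ed" using p by (auto simp: T_def)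
  ultimately show "contains_directed_spanning_tree Ed r"
    by (auto simp: contains_directed_spanning_tree_def)
qed

text \<open>On an eigenvector of \<open>G1\<close> the orbit keeps its modulus, so its real or its imaginary part does not decay.\<close>

lemma internal_model_not_decaying:
  fixes S :: "real^'q^'q" and \<beta> :: "real^'k::finite^'k"
  assumes gen: "is_min_internal_model_generator S \<beta> \<sigma>" and S_unit: "\<And>l. l \<in> spectrum S \<Longrightarrow> cmod l = 1"
  shows "\<exists>z :: real^('p::finite \<times> 'k). \<not> (\<lambda>t. ((*v) (internal_model_G1 \<beta>) ^^ t) z) \<longlonglongrightarrow> 0"
proof (rule ccontr)
  let ?G1 = "internal_model_G1 \<beta> :: real^('p \<times> 'k)^('p \<times> 'k)"
  assume "\<not> ?thesis"
  then have lim: "(\<lambda>t. ((*v) ?G1 ^^ t) z) \<longlonglongrightarrow> 0" for z by blast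
  have "(axis undefined 1 :: complex^('p \<times> 'k)) \<notin> {0}" by simp
  from eigenvalue_modulo_set[OF this, of "transpose (complex_matrix ?G1)"]
  obtain u l where u: "u \<noteq> 0" "u v* complex_matrix ?G1 = l *s u" by auto
  have l: "cmod l = 1" using S_unit internal_model_left_eigenvector(1)[OF gen u] by blast
  obtain w where w: "w \<noteq> 0" "complex_matrix ?G1 *v w = l *s w"
    using left_eigenvalue_iff[of "complex_matrix ?G1" l] u by blast
  obtain k where k: "w $ k \<noteq> 0" using w(1) by (auto simp: vec_eq_iff)
  have it: "((*v) (complex_matrix ?G1) ^^ t) w = l ^ t *s w" for t
    by (induction t) (simp_all add: w matrix_vector_mult_smult vector_smult_assoc mult.commute)
  have "cmod (w $ k) \<le> \<bar>((*v) ?G1 ^^ t) (Re_vector w) $ k\<bar> + \<bar>((*v) ?G1 ^^ t) (Im_vector w) $ k\<bar>" for t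
  proof -
    have parts: "((*v) ?G1 ^^ t) (Re_vector w) $ k = Re ((l ^ t *s w) $ k)"
      "((*v) ?G1 ^^ t) (Im_vector w) $ k = Im ((l ^ t *s w) $ k)"
      unfolding iterate_complex_matrix[symmetric] it by (simp_all add: Re_vector_def Im_vector_def)
    have "cmod (w $ k) = cmod ((l ^ t *s w) $ k)" by (simp add: norm_mult norm_power l)
    also have "\<dots> \<le> \<bar>Re ((l ^ t *s w) $ k)\<bar> + \<bar>Im ((l ^ t *s w) $ k)\<bar>" by (rule cmod_le)
    finally show ?thesis unfolding parts .
  qed
  moreover have "(\<lambda>t. \<bar>((*v) ?G1 ^^ t) (Re_vector w) $ k\<bar> + \<bar>((*v) ?G1 ^^ t) (Im_vector w) $ k\<bar>)
      \<longlonglongrightarrow> \<bar>(0 :: real^('p \<times> 'k)) $ k\<bar> + \<bar>(0 :: real^('p \<times> 'k)) $ k\<bar>"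
    by (intro tendsto_intros lim)
  ultimately have "cmod (w $ k) \<le> 0"
    by (intro LIMSEQ_le_const[of _ "0::real"]) auto
  then show False using k by simp
qed

text \<open>Followers that the leader cannot reach only listen to each other. If they start in the same state
  they keep a common state, all their relative measurements vanish, and their controllers run freely, with the
  modes of the exosystem, none of which decays.\<close>

theorem stable_loop_imp_reachable:
  fixes P :: "('n::finite, 'm::finite, 'p::finite, 'q::finite) plant" and F :: "real^'q^'p"
    and Ed :: "('N::finite option \<times> 'N option) set" and a :: "'N option \<Rightarrow> 'N option \<Rightarrow> real"
    and \<beta> :: "real^'k::finite^'k" and Kx :: "real^'n^'m" and Kz :: "real^('p \<times> 'k)^'m"
  assumes gen: "is_min_internal_model_generator S \<beta> \<sigma>"
    and S_unit: "\<And>l. l \<in> spectrum S \<Longrightarrow> cmod l = 1"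
    and G1: "G1 = internal_model_G1 \<beta>"
    and stable: "exponentially_stable (rcom + rcon)
       (\<lambda>X :: int \<Rightarrow> ((real^'n)^'N) \<times> ((real^('p \<times> 'k))^'N).
          closed_loop Ed a rcom rcon S F (\<lambda>i. P) G1 G2 Kx Kz (\<lambda>t. 0) (\<lambda>t. fst (X t)) (\<lambda>t. snd (X t)))"
  shows "(None, v) \<in> Ed\<^sup>*"
proof (rule ccontr)
  assume nreach: "(None, v) \<notin> Ed\<^sup>*"
  define U where "U = {i. (None, Some i) \<notin> Ed\<^sup>*}"
  obtain i0 where i0: "v = Some i0" "i0 \<in> U" using nreach by (cases v) (auto simp: U_def)
  have nbr: "\<exists>j\<in>U. k = Some j" if "i \<in> U" "k \<in> neighbors Ed (Some i)" for i k
  proof -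
    have k: "(None, k) \<notin> Ed\<^sup>*"
      using that by (auto simp: U_def neighbors_def intro: rtrancl_into_rtrancl)
    then show ?thesis by (cases k) (auto simp: U_def)
  qed
  obtain z :: "real^('p \<times> 'k)" where z: "\<not> (\<lambda>t. ((*v) G1 ^^ t) z) \<longlonglongrightarrow> 0"
    using internal_model_not_decaying[OF gen S_unit] unfolding G1 by blast
  let ?r = "rcom + rcon" and ?P = "(\<chi> i. P) :: ('n, 'm, 'p, 'q) plant ^ 'N"
  define H where "H = leader_laplacian Ed a"
  define x0 :: "((real^'n)^'N) \<times> ((real^('p \<times> 'k))^'N)" where "x0 = (0, \<chi> i. z)"
  obtain X where X0: "\<And>t. t \<le> 0 \<Longrightarrow> X t = x0"
    and X_step: "\<And>t. 0 \<le> t \<Longrightarrow> X (t + 1) = loop_free G1 (X t) + loop_now H G2 ?P (X t) + loop_delayed H Kx Kz ?P (X (t - int ?r))"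
    by (rule delay_trajectory_exists[of "\<lambda>t. x0" "\<lambda>X Y. loop_free G1 X + loop_now H G2 ?P X + loop_delayed H Kx Kz ?P Y" ?r]) blast
  have "closed_loop Ed a rcom rcon S F (\<lambda>i. ?P $ i) G1 G2 Kx Kz (\<lambda>t. 0) (\<lambda>t. fst (X t)) (\<lambda>t. snd (X t))"
    unfolding closed_loop_iff_delay_system
    using X_step by (simp add: H_def linear_0[OF linear_loop_forcing])
  then have cl: "closed_loop Ed a rcom rcon S F (\<lambda>i. P) G1 G2 Kx Kz (\<lambda>t. 0) (\<lambda>t. fst (X t)) (\<lambda>t. snd (X t))"
    by simp
  define x where "x t = fst (X t)" for t
  define zb where "zb t = snd (X t)" for t
  have x_step: "x (t + 1) $ i = plant_A P *v (x t $ i) + plant_B P *v control_input Ed a rcom Kx Kz x zb i (t - int rcon)"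
    and zb_step: "zb (t + 1) $ i = G1 *v (zb t $ i) + G2 *v virtual_error Ed a (\<lambda>i. P) F (\<lambda>t. 0) x i t" if "0 \<le> t" for t i
    using cl that unfolding closed_loop_def x_def zb_def by simp_all
  define same where "same t \<longleftrightarrow> (\<forall>i\<in>U. \<forall>j\<in>U. x t $ i = x t $ j \<and> zb t $ i = zb t $ j)" for t
  have rel0: "relative_state Ed a rcom x i t = 0" if i: "i \<in> U" and s: "same (t - int rcom)" for i t
    unfolding relative_state_def
  proof (rule sum.neutral, rule ballI)
    fix k assume "k \<in> neighbors Ed (Some i)"
    then obtain j where j: "j \<in> U" "k = Some j" using nbr[OF i] by blast
    then have "x (t - int rcom) $ i = x (t - int rcom) $ j" using i s unfolding same_def by blast
    then show "a (Some i) k *\<^sub>R (node_state x (Some i) (t - int rcom) - node_state x k (t - int rcom)) = 0"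
      by (simp add: node_state_def j)
  qed
  have err0: "virtual_error Ed a (\<lambda>i. P) F (\<lambda>t. 0) x i t = 0" if i: "i \<in> U" and s: "same t" for i t
    unfolding virtual_error_def
  proof (rule sum.neutral, rule ballI)
    fix k assume "k \<in> neighbors Ed (Some i)"
    then obtain j where j: "j \<in> U" "k = Some j" using nbr[OF i] by blast
    then have "x (t) $ i = x (t) $ j" using i s unfolding same_def by blast
    then show "a (Some i) k *\<^sub>R (node_output (\<lambda>i. P) F (\<lambda>t. 0) x (Some i) t - node_output (\<lambda>i. P) F (\<lambda>t. 0) x k t) = 0"
      by (simp add: node_output_def j)
  qed
  have "\<forall>t\<le>int n. same t" for n
  proof (induction n)
    case 0
    then show ?case using X0 by (simp add: same_def x_def zb_def x0_def)
  next
    case (Suc n)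
    let ?t = "int n"
    have s: "same ?t" "same (?t - int rcon - int rcom)" using Suc by simp_all
    have "x (?t + 1) $ i = x (?t + 1) $ j \<and> zb (?t + 1) $ i = zb (?t + 1) $ j" if ij: "i \<in> U" "j \<in> U" for i j
    proof -
      have "x ?t $ i = x ?t $ j" "zb ?t $ i = zb ?t $ j"
        "zb (?t - int rcon - int rcom) $ i = zb (?t - int rcon - int rcom) $ j"
        using s ij unfolding same_def by blast+
      then show ?thesis
        by (simp add: x_step zb_step control_input_def err0[OF ij(1) s(1)] err0[OF ij(2) s(1)]
            rel0[OF ij(1) s(2)] rel0[OF ij(2) s(2)])
    qed
    then have new: "same (?t + 1)" unfolding same_def by blast
    show ?case
    proof (intro allI impI)
      fix t assume "t \<le> int (Suc n)"
      then have "t \<le> int n \<or> t = int n + 1" by auto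
      then show "same t" using Suc new by auto
    qed
  qed
  then have same: "same (int n)" for n by blast
  have zb: "zb (int n) $ i0 = ((*v) G1 ^^ n) z" for n
  proof (induction n)
    case 0
    then show ?case using X0[of 0] by (simp add: zb_def x0_def)
  next
    case (Suc n)
    then show ?case using zb_step[of "int n" i0] err0[OF i0(2) same[of n]] by (simp add: add.commute)
  qed
  obtain M \<rho> where M: "0 < \<rho>" "\<rho> < 1"
    and decay: "\<And>t. norm (X (int t)) \<le> M * \<rho> ^ t * Max ((\<lambda>s. norm (X s)) ` {- int ?r..0})"
    using stable cl unfolding exponentially_stable_def by blast
  define h where "h = Max ((\<lambda>s. norm (X s)) ` {- int ?r..0})"
  have bound: "norm (((*v) G1 ^^ n) z) \<le> M * \<rho> ^ n * h" for n
  proof -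
    have "norm (zb (int n) $ i0) \<le> norm (zb (int n))" by (rule Finite_Cartesian_Product.norm_nth_le)
    also have "\<dots> \<le> norm (X (int n))" unfolding zb_def using norm_snd_le[of "snd (X (int n))" "fst (X (int n))"] by simp
    finally show ?thesis using decay[of n] by (simp add: zb h_def)
  qed
  have "(\<lambda>n. M * \<rho> ^ n * h) \<longlonglongrightarrow> M * 0 * h"
    using M by (intro tendsto_intros LIMSEQ_realpow_zero) auto
  then have lim: "(\<lambda>n. M * \<rho> ^ n * h) \<longlonglongrightarrow> 0" by simp
  have "(\<lambda>n. ((*v) G1 ^^ n) z) \<longlonglongrightarrow> 0"
    by (rule Lim_null_comparison[OF always_eventually lim]) (use bound in blast)
  then show False using z by contradiction
qed

theorem theorem4p1:
  fixes A :: "real^('n::finite)^'n" and B :: "real^'m^'n" and E :: "real^'q^'n" and C :: "real^'n^('p::finite)"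
    and S :: "real^'q^'q" and F :: "real^'q^'p"
    and G1 :: "real^('p \<times> 'k::finite)^('p \<times> 'k)" and G2 :: "real^'p^('p \<times> 'k)"
    and Ed :: "('N::finite option \<times> 'N option) set"
    and a :: "'N option \<Rightarrow> 'N option \<Rightarrow> real"
    and rcom rcon :: nat
  assumes graph: "weighted_adjacency Ed a"
    and stab: "stabilizable A B"
    and rank_cond: "\<And>l. l \<in> spectrum S \<Longrightarrow>
      rank (block_matrix (complex_matrix A - mat l) (complex_matrix B) (complex_matrix C) 0)
        = CARD('n) + CARD('p)"
    and S_unit: "\<And>l. l \<in> spectrum S \<Longrightarrow> cmod l = 1"
    and A_disc: "\<And>l. l \<in> spectrum A \<Longrightarrow> cmod l \<le> 1"
    and internal_model: "is_min_p_copy_internal_model S G1 G2"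
  shows "(\<exists>(Kx :: real^'n^'m) (Kz :: real^('p \<times> 'k)^'m).
           solves_cooperative_robust_output_regulation Ed a rcom rcon S F (A, B, E, C) G1 G2 Kx Kz)
         \<longleftrightarrow> contains_directed_spanning_tree Ed None"
proof -
  obtain \<beta> \<sigma> where gen: "is_min_internal_model_generator S \<beta> \<sigma>"
    and G: "G1 = internal_model_G1 \<beta>" "G2 = internal_model_G2 \<sigma>"
    using internal_model unfolding is_min_p_copy_internal_model_def by blast
  show ?thesis
    unfolding contains_directed_spanning_tree_iff_reachable
  proof
    assume "\<exists>(Kx :: real^'n^'m) (Kz :: real^('p \<times> 'k)^'m).
      solves_cooperative_robust_output_regulation Ed a rcom rcon S F (A, B, E, C) G1 G2 Kx Kz"
    then show "\<forall>v. (None, v) \<in> Ed\<^sup>*"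
      using stable_loop_imp_reachable[OF gen S_unit G(1)]
      unfolding solves_cooperative_robust_output_regulation_def by blast
  next
    assume "\<forall>v. (None, v) \<in> Ed\<^sup>*"
    then have reach: "(None, v) \<in> Ed\<^sup>*" for v by blast
    have "\<exists>(Kx :: real^'n^'m) (Kz :: real^('p \<times> 'k)^'m). exponentially_stable (rcom + rcon)
       (\<lambda>X :: int \<Rightarrow> ((real^'n)^'N) \<times> ((real^('p \<times> 'k))^'N).
          closed_loop Ed a rcom rcon S F (\<lambda>i. (A, B, E, C)) G1 G2 Kx Kz (\<lambda>t. 0) (\<lambda>t. fst (X t)) (\<lambda>t. snd (X t)))"
    proof (rule nominal_loop_stabilizable[OF graph reach])
      show "hautus_stabilizable
          (complex_matrix (block_matrix (plant_A (A, B, E, C)) 0 (G2 ** plant_C (A, B, E, C)) G1))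
          (complex_matrix (input_block (plant_B (A, B, E, C))))"
        unfolding plant_A.simps plant_B.simps plant_C.simps
        by (rule plant_with_internal_model(1)[OF stab rank_cond S_unit A_disc gen G])
      show "left_spectrum_in_disc
          (complex_matrix (block_matrix (plant_A (A, B, E, C)) 0 (G2 ** plant_C (A, B, E, C)) G1))"
        unfolding plant_A.simps plant_C.simps
        by (rule plant_with_internal_model(2)[OF stab rank_cond S_unit A_disc gen G])
    qed
    then show "\<exists>(Kx :: real^'n^'m) (Kz :: real^('p \<times> 'k)^'m).
      solves_cooperative_robust_output_regulation Ed a rcom rcon S F (A, B, E, C) G1 G2 Kx Kz"
      using stable_loop_regulates_robustly[OF graph reach gen G] by blast
  qed
qed

end
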